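(* Assume $n\ge 3$ and $\mathbf{char}(q)=\ell\ge 3$, let $m\ge 1$ be an integer and $N=n(m\ell-1)$. For $0\le s\le N$ consider the $\mathfrak u_q(\mathfrak{sl}_n)$-module $\mathcal A_q^{(s)}(n,\mathbf m)$. For $\alpha\in\mathbb Z_+^n(s,\mathbf m)$ write $\mathfrak V_\alpha=\mathfrak u_q(\mathfrak{sl}_n).x^{(\alpha)}$. Then: (1) For any nonzero $y\in\mathcal A_q^{(s)}(n,\mathbf m)$, if the submodule $\mathfrak u_q(\mathfrak{sl}_n).y$ is simple, then $\mathrm{Edeg}(y)=E(s)_0$. (2) $\mathrm{Soc}\,\mathcal A_q^{(s)}(n,\mathbf m)=\mathrm{span}_k\{x^{(\alpha)}\in\mathcal A_q^{(s)}(n,\mathbf m)\mid |\mathcal E(\alpha)|=E(s)_0\}$. (3) $\mathcal A_q^{(s)}(n,\mathbf m)=\sum_{\alpha\in\mathbb Z_+^n(s,\mathbf m):\ |\mathcal E(\alpha)|=E(s)}\mathfrak V_\alpha$. (4) When $0\le s\le \ell-1$ or $N-(\ell-1)\le s\le N$: $\mathcal A_q^{(s)}(n,\mathbf m)=\mathfrak V_\eta$ is simple, where $\eta=(s,0,\dots,0)$ if $0\le s<\ell$, respectively $\eta=(m\ell-1,\dots,m\ell-1,(m-1)\ell+h)$ with $s=|\eta|=n(m-1)\ell+(n-1)(\ell-1)+h$, $0\le h\le \ell-1$, if $N-(\ell-1)\le s\le N$; and $x^{(\eta)}$ is the respective highest weight vector. (5) When $\ell\le s\le N-\ell$: $\mathcal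 A_q^{(s)}(n,\mathbf m)$ is indecomposable. Moreover: (i) for $(\ell-1)+1\le s\le n(\ell-1)$: $\mathrm{Soc}\,\mathcal A_q^{(s)}(n,\mathbf m)=\mathfrak V_\eta$ is simple, where $\eta=(\underbrace{\ell-1,\dots,\ell-1}_{j},h,0,\dots,0)$ with $s=|\eta|=j(\ell-1)+h$, $1\le h\le\ell-1$, $1\le j<n$, and $x^{(\eta)}$ is the highest weight vector; (ii) for $n(\ell-1)+1\le s\le N-\ell$: write $s=\kappa\ell+h+(n-1)(\ell-1)$ with $1\le\kappa\le n(m-1)-1$ and $0\le h\le\ell-1$. Then $\mathrm{Soc}\,\mathcal A_q^{(s)}(n,\mathbf m)=\bigoplus_{\eta(\underline\kappa)\in\wp}\mathfrak V_{\eta(\underline\kappa)}$ is non-simple, where $$\wp=\Bigl\{\eta(\underline\kappa)=\bigl(\kappa_1\ell+(\ell-1),\dots,\kappa_{n-1}\ell+(\ell-1),\kappa_n\ell+h\bigr)\ \Big|\ \textstyle\sum_i\kappa_i=\kappa,\ 0\le\kappa_i\le m-1\Bigr\},$$ and the $x^{(\eta(\underline\kappa))}$ are the respective highest weight vectors of the modules $\mathfrak V_{\eta(\underline\kappa)}$.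
   Context: $k$ is an algebraically closed field of characteristic $0$ and $q\in k^*$, $q\ne\pm1$. $[a]=\frac{q^a-q^{-a}}{q-q^{-1}}$ for $a\in\mathbb Z$; $\mathbf{char}(q)$ is the smallest positive integer $\ell$ with $[\ell]=0$ (so $q$ is either a primitive $2\ell$-th root of unity, or $\ell$ is odd and $q$ is a primitive $\ell$-th root of unity). $U_q(\mathfrak{sl}_n)$ is the usual quantum group with generators $e_i,f_i,K_i^{\pm1}$ ($1\le i\le n-1$), and $\mathfrak u_q(\mathfrak{sl}_n)=U_q(\mathfrak{sl}_n)/(e_i^\ell,f_i^\ell,K_i^{2\ell}-1)$. $\mathcal A_q(n)$ is the $k$-vector space with basis $\{x^{(\alpha)}\mid\alpha\in\mathbb Z_+^n\}$ ($\mathbb Z_+$ = nonnegative integers), with $\mathfrak u_q(\mathfrak{sl}_n)$-action (where $x^{(\beta)}:=0$ if $\beta\notin\mathbb Z_+^n$, and $\varepsilon_i$ is the $i$-th unit vector) $$e_i.x^{(\beta)}=[\beta_i+1]x^{(\beta+\varepsilon_i-\varepsilon_{i+1})},\quad f_i.x^{(\beta)}=[\beta_{i+1}+1]x^{(\beta-\varepsilon_i+\varepsilon_{i+1})},\quad K_i^{\pm1}.x^{(\beta)}=q^{\pm(\beta_i-\beta_{i+1})}x^{(\beta)}.$$ For an integer $m\ge1$, $\mathbf m=(m\ell-1,\dots,m\ell-1)\in\mathbb Z_+^n$; $\alpha\le\mathbf m$ means $\alpha_i\le m\ell-1$ for all $i$; $|\alpha|=\sum_i\alpha_i$. $\mathbb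 Z_+^n(s,\mathbf m)=\{\alpha\in\mathbb Z_+^n\mid|\alpha|=s,\ \alpha\le\mathbf m\}$ and $\mathcal A_q^{(s)}(n,\mathbf m)=\mathrm{span}_k\{x^{(\alpha)}\mid\alpha\in\mathbb Z_+^n(s,\mathbf m)\}$, a $\mathfrak u_q(\mathfrak{sl}_n)$-submodule of $\mathcal A_q(n)$. Energy degree: $\mathcal E_i(\alpha)=\mathrm{Edeg}_i\,x^{(\alpha)}=\lfloor\alpha_i/\ell\rfloor$, $\mathcal E(\alpha)=(\mathcal E_1(\alpha),\dots,\mathcal E_n(\alpha))$, $\mathrm{Edeg}\,x^{(\alpha)}=|\mathcal E(\alpha)|=\sum_i\lfloor\alpha_i/\ell\rfloor$. For nonzero $y=\sum_\alpha k_\alpha x^{(\alpha)}$, $\mathrm{Edeg}(y)=\max\{\mathrm{Edeg}\,x^{(\alpha)}\mid k_\alpha\ne0\}$. For $0\le s\le N$, $E(s)_0$ (resp. $E(s)$) is the minimum (resp. maximum) of $\mathrm{Edeg}\,x^{(\alpha)}$ over $\alpha\in\mathbb Z_+^n(s,\mathbf m)$. $\mathrm{Soc}$ is the socle. A highest weight vector of a module is a nonzero simultaneous eigenvector of the $K_i$, killed by all $e_i$, that generates the module. *)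

theory Defs
  imports
    "HOL-Library.Poly_Mapping"
    "HOL-Computational_Algebra.Polynomial"
    "HOL-Algebra.QuotRing"
begin

definition qint :: "'k::field \<Rightarrow> int \<Rightarrow> 'k" where
  "qint q a = (q powi a - q powi (- a)) / (q - inverse q)"

definition qchar :: "'k::field \<Rightarrow> nat" where
  "qchar q = (if \<exists>l>0. qint q (int l) = 0 then LEAST l. 0 < l \<and> qint q (int l) = 0 else 0)"

text \<open>The type \<open>'a \<Rightarrow>\<^sub>0 'k\<close> is the \<open>'k\<close>-vector space with basis \<open>'a\<close>.\<close>

definition scal :: "'k::field \<Rightarrow> ('a \<Rightarrow>\<^sub>0 'k) \<Rightarrow> ('a \<Rightarrow>\<^sub>0 'k)" where
  "scal c v = Poly_Mapping.map ((*) c) v"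

lemma lookup_scal [simp]: "Poly_Mapping.lookup (scal c v) a = c * Poly_Mapping.lookup v a"
  by (simp add: scal_def Poly_Mapping.map.rep_eq when_def)

global_interpretation scal: vector_space scal
  by unfold_locales (auto intro!: poly_mapping_eqI simp: lookup_add algebra_simps)

definition lin_ext :: "('a \<Rightarrow> ('b \<Rightarrow>\<^sub>0 'k::field)) \<Rightarrow> ('a \<Rightarrow>\<^sub>0 'k) \<Rightarrow> ('b \<Rightarrow>\<^sub>0 'k)" where
  "lin_ext f v = (\<Sum>a\<in>Poly_Mapping.keys v. scal (Poly_Mapping.lookup v a) (f a))"

text \<open>A module is given by its underlying set \<open>M\<close>, a subset of an ambient abelian group, and an
  action \<open>act\<close>. The rings below are unital \<open>'k\<close>-algebras, so submodules are closed under
  negation and are linear subspaces.\<close>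

definition lsubmodule ::
  "('r, 'm) ring_scheme \<Rightarrow> ('r \<Rightarrow> 'v::ab_group_add \<Rightarrow> 'v) \<Rightarrow> 'v set \<Rightarrow> 'v set \<Rightarrow> bool" where
  "lsubmodule R act W M \<longleftrightarrow> W \<subseteq> M \<and> 0 \<in> W \<and> (\<forall>x\<in>W. \<forall>y\<in>W. x + y \<in> W) \<and>
     (\<forall>a\<in>carrier R. \<forall>x\<in>W. act a x \<in> W)"

definition cyclic_submodule ::
  "('r, 'm) ring_scheme \<Rightarrow> ('r \<Rightarrow> 'v::ab_group_add \<Rightarrow> 'v) \<Rightarrow> 'v \<Rightarrow> 'v set" where
  "cyclic_submodule R act y = {act a y | a. a \<in> carrier R}"

definition simple_module ::
  "('r, 'm) ring_scheme \<Rightarrow> ('r \<Rightarrow> 'v::ab_group_add \<Rightarrow> 'v) \<Rightarrow> 'v set \<Rightarrow> bool" where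
  "simple_module R act M \<longleftrightarrow> lsubmodule R act M M \<and> M \<noteq> {0} \<and>
     (\<forall>W. lsubmodule R act W M \<longrightarrow> W = {0} \<or> W = M)"

definition module_sum :: "'i set \<Rightarrow> ('i \<Rightarrow> 'v::ab_group_add set) \<Rightarrow> 'v set" where
  "module_sum I V = {\<Sum>i\<in>J. f i | J f. finite J \<and> J \<subseteq> I \<and> (\<forall>i\<in>J. f i \<in> V i)}"

definition is_direct_sum :: "'v set \<Rightarrow> 'i set \<Rightarrow> ('i \<Rightarrow> 'v::ab_group_add set) \<Rightarrow> bool" where
  "is_direct_sum M I V \<longleftrightarrow> M = module_sum I V \<and>
     (\<forall>i\<in>I. V i \<inter> module_sum (I - {i}) V = {0})"

definition socle ::
  "('r, 'm) ring_scheme \<Rightarrow> ('r \<Rightarrow> 'v::ab_group_add \<Rightarrow> 'v) \<Rightarrow> 'v set \<Rightarrow> 'v set" where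
  "socle R act M = module_sum {W. lsubmodule R act W M \<and> simple_module R act W} (\<lambda>W. W)"

definition indecomposable_module ::
  "('r, 'm) ring_scheme \<Rightarrow> ('r \<Rightarrow> 'v::ab_group_add \<Rightarrow> 'v) \<Rightarrow> 'v set \<Rightarrow> bool" where
  "indecomposable_module R act M \<longleftrightarrow> lsubmodule R act M M \<and> M \<noteq> {0} \<and>
     \<not> (\<exists>U W. lsubmodule R act U M \<and> lsubmodule R act W M \<and> U \<noteq> {0} \<and> W \<noteq> {0} \<and>
            U \<inter> W = {0} \<and> M = {u + w | u w. u \<in> U \<and> w \<in> W})"

text \<open>If \<open>act\<close> respects the cosets in a quotient ring, \<open>coset_act act\<close> is the induced action of
  the quotient: the value at a coset is the value at any of its representatives.\<close>

definition coset_act :: "('a \<Rightarrow> 'v \<Rightarrow> 'v) \<Rightarrow> 'a set \<Rightarrow> 'v \<Rightarrow> 'v" where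
  "coset_act act X v = (THE w. \<exists>a\<in>X. w = act a v)"

datatype gen = gE nat | gF nat | gK nat | gKinv nat

fun gen_index :: "gen \<Rightarrow> nat" where
  "gen_index (gE i) = i"
| "gen_index (gF i) = i"
| "gen_index (gK i) = i"
| "gen_index (gKinv i) = i"

text \<open>Words in the generators, as a monoid under concatenation, written additively so that
  \<open>gen word \<Rightarrow>\<^sub>0 'k\<close> with its convolution product is the free algebra on the generators.\<close>

datatype 'g word = Word (letters: "'g list")

instantiation word :: (type) monoid_add
begin

definition zero_word :: "'a word" where
  "0 = Word []"

definition plus_word :: "'a word \<Rightarrow> 'a word \<Rightarrow> 'a word" where
  "u + v = Word (letters u @ letters v)"

instance
  by standard (simp_all add: zero_word_def plus_word_def)

end

definition free_alg :: "nat \<Rightarrow> (gen word \<Rightarrow>\<^sub>0 'k::field) ring" where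
  "free_alg n =
     \<lparr>carrier = {a. \<forall>w\<in>Poly_Mapping.keys a. \<forall>g\<in>set (letters w). gen_index g \<in> {1..n - 1}},
      mult = (*), one = 1, zero = 0, add = (+)\<rparr>"

definition gel :: "gen \<Rightarrow> (gen word \<Rightarrow>\<^sub>0 'k::field)" where
  "gel g = Poly_Mapping.single (Word [g]) 1"

definition cartan :: "nat \<Rightarrow> nat \<Rightarrow> int" where
  "cartan i j = (if i = j then 2 else if i = Suc j \<or> j = Suc i then - 1 else 0)"

text \<open>A defining relation \<open>a = b\<close> is encoded by the element \<open>a - b\<close> of the free algebra.\<close>

definition Uq_relations :: "'k::field \<Rightarrow> nat \<Rightarrow> (gen word \<Rightarrow>\<^sub>0 'k) set" where
  "Uq_relations q n = (let I = {1..n - 1} in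
     {gel (gK i) * gel (gK j) - gel (gK j) * gel (gK i) | i j. i \<in> I \<and> j \<in> I} \<union>
     {gel (gK i) * gel (gKinv i) - 1 | i. i \<in> I} \<union>
     {gel (gKinv i) * gel (gK i) - 1 | i. i \<in> I} \<union>
     {gel (gK i) * gel (gE j) * gel (gKinv i) - scal (q powi cartan i j) (gel (gE j))
        | i j. i \<in> I \<and> j \<in> I} \<union>
     {gel (gK i) * gel (gF j) * gel (gKinv i) - scal (q powi (- cartan i j)) (gel (gF j))
        | i j. i \<in> I \<and> j \<in> I} \<union>
     {gel (gE i) * gel (gF j) - gel (gF j) * gel (gE i) -
        (if i = j then scal (inverse (q - inverse q)) (gel (gK i) - gel (gKinv i)) else 0)
        | i j. i \<in> I \<and> j \<in> I} \<union>
     {gel (X i) * gel (X j) - gel (X j) * gel (X i)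
        | X i j. X \<in> {gE, gF} \<and> i \<in> I \<and> j \<in> I \<and> cartan i j = 0} \<union>
     {gel (X i) ^ 2 * gel (X j) - scal (qint q 2) (gel (X i) * gel (X j) * gel (X i)) +
        gel (X j) * gel (X i) ^ 2
        | X i j. X \<in> {gE, gF} \<and> i \<in> I \<and> j \<in> I \<and> cartan i j = - 1})"

definition Uq :: "'k::field \<Rightarrow> nat \<Rightarrow> (gen word \<Rightarrow>\<^sub>0 'k) set ring" where
  "Uq q n = free_alg n Quot (Idl\<^bsub>free_alg n\<^esub> (Uq_relations q n))"

definition Uq_gen :: "'k::field \<Rightarrow> nat \<Rightarrow> gen \<Rightarrow> (gen word \<Rightarrow>\<^sub>0 'k) set" where
  "Uq_gen q n g = (Idl\<^bsub>free_alg n\<^esub> (Uq_relations q n)) +>\<^bsub>free_alg n\<^esub> gel g"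

definition uq_relations :: "'k::field \<Rightarrow> nat \<Rightarrow> nat \<Rightarrow> (gen word \<Rightarrow>\<^sub>0 'k) set set" where
  "uq_relations q n l = (\<Union>i\<in>{1..n - 1}.
     {Uq_gen q n (gE i) [^]\<^bsub>Uq q n\<^esub> l,
      Uq_gen q n (gF i) [^]\<^bsub>Uq q n\<^esub> l,
      (Uq_gen q n (gK i) [^]\<^bsub>Uq q n\<^esub> (2 * l)) \<ominus>\<^bsub>Uq q n\<^esub> \<one>\<^bsub>Uq q n\<^esub>})"

definition uq :: "'k::field \<Rightarrow> nat \<Rightarrow> (gen word \<Rightarrow>\<^sub>0 'k) set set ring" where
  "uq q n = Uq q n Quot (Idl\<^bsub>Uq q n\<^esub> (uq_relations q n (qchar q)))"

definition uq_gen :: "'k::field \<Rightarrow> nat \<Rightarrow> gen \<Rightarrow> (gen word \<Rightarrow>\<^sub>0 'k) set set" where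
  "uq_gen q n g = (Idl\<^bsub>Uq q n\<^esub> (uq_relations q n (qchar q))) +>\<^bsub>Uq q n\<^esub> Uq_gen q n g"

text \<open>Multi-indices have entries at the positions \<open>1..n\<close> and are 0 elsewhere. Their entries are
  integers, so that the formulas for the action can leave \<open>Zplus n\<close>; there \<open>xpow\<close> is 0.\<close>

type_synonym midx = "nat \<Rightarrow> int"

definition Zplus :: "nat \<Rightarrow> midx set" where
  "Zplus n = {\<alpha>. (\<forall>i\<in>{1..n}. 0 \<le> \<alpha> i) \<and> (\<forall>i. i \<notin> {1..n} \<longrightarrow> \<alpha> i = 0)}"

definition xpow :: "nat \<Rightarrow> midx \<Rightarrow> (midx \<Rightarrow>\<^sub>0 'k::field)" where
  "xpow n \<beta> = (if \<beta> \<in> Zplus n then Poly_Mapping.single \<beta> 1 else 0)"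

fun basis_act :: "'k::field \<Rightarrow> nat \<Rightarrow> gen \<Rightarrow> midx \<Rightarrow> (midx \<Rightarrow>\<^sub>0 'k)" where
  "basis_act q n (gE i) \<beta> =
     scal (qint q (\<beta> i + 1)) (xpow n (\<beta>(i := \<beta> i + 1, Suc i := \<beta> (Suc i) - 1)))"
| "basis_act q n (gF i) \<beta> =
     scal (qint q (\<beta> (Suc i) + 1)) (xpow n (\<beta>(i := \<beta> i - 1, Suc i := \<beta> (Suc i) + 1)))"
| "basis_act q n (gK i) \<beta> = scal (q powi (\<beta> i - \<beta> (Suc i))) (xpow n \<beta>)"
| "basis_act q n (gKinv i) \<beta> = scal (q powi (- (\<beta> i - \<beta> (Suc i)))) (xpow n \<beta>)"

definition word_act ::
  "'k::field \<Rightarrow> nat \<Rightarrow> gen word \<Rightarrow> (midx \<Rightarrow>\<^sub>0 'k) \<Rightarrow> (midx \<Rightarrow>\<^sub>0 'k)" where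
  "word_act q n w v = foldr (\<lambda>g. lin_ext (basis_act q n g)) (letters w) v"

definition free_act ::
  "'k::field \<Rightarrow> nat \<Rightarrow> (gen word \<Rightarrow>\<^sub>0 'k) \<Rightarrow> (midx \<Rightarrow>\<^sub>0 'k) \<Rightarrow> (midx \<Rightarrow>\<^sub>0 'k)" where
  "free_act q n a v = lin_ext (\<lambda>w. word_act q n w v) a"

definition uq_act ::
  "'k::field \<Rightarrow> nat \<Rightarrow> (gen word \<Rightarrow>\<^sub>0 'k) set set \<Rightarrow> (midx \<Rightarrow>\<^sub>0 'k) \<Rightarrow> (midx \<Rightarrow>\<^sub>0 'k)" where
  "uq_act q n = coset_act (coset_act (free_act q n))"

definition mabs :: "nat \<Rightarrow> midx \<Rightarrow> int" where
  "mabs n \<alpha> = (\<Sum>i=1..n. \<alpha> i)"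

text \<open>The bound \<open>\<alpha> \<le> \<^bold>m\<close> depends on \<open>l\<close> and \<open>m\<close> through \<open>\<^bold>m = (m l - 1, \<dots>, m l - 1)\<close>.\<close>

definition Zplus_trunc :: "nat \<Rightarrow> nat \<Rightarrow> int \<Rightarrow> int \<Rightarrow> midx set" where
  "Zplus_trunc n l m s = {\<alpha>\<in>Zplus n. mabs n \<alpha> = s \<and> (\<forall>i\<in>{1..n}. \<alpha> i \<le> m * int l - 1)}"

definition Aq :: "'k::field \<Rightarrow> nat \<Rightarrow> int \<Rightarrow> int \<Rightarrow> (midx \<Rightarrow>\<^sub>0 'k) set" where
  "Aq q n m s = scal.span (xpow n ` Zplus_trunc n (qchar q) m s)"

definition Edeg_idx :: "nat \<Rightarrow> nat \<Rightarrow> midx \<Rightarrow> int" where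
  "Edeg_idx n l \<alpha> = (\<Sum>i=1..n. \<alpha> i div int l)"

definition Edeg :: "nat \<Rightarrow> nat \<Rightarrow> (midx \<Rightarrow>\<^sub>0 'k::field) \<Rightarrow> int" where
  "Edeg n l y = Max (Edeg_idx n l ` Poly_Mapping.keys y)"

definition Emin :: "nat \<Rightarrow> nat \<Rightarrow> int \<Rightarrow> int \<Rightarrow> int" where
  "Emin n l m s = Min (Edeg_idx n l ` Zplus_trunc n l m s)"

definition Emax :: "nat \<Rightarrow> nat \<Rightarrow> int \<Rightarrow> int \<Rightarrow> int" where
  "Emax n l m s = Max (Edeg_idx n l ` Zplus_trunc n l m s)"

abbreviation uq_simple :: "'k::field \<Rightarrow> nat \<Rightarrow> (midx \<Rightarrow>\<^sub>0 'k) set \<Rightarrow> bool" where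
  "uq_simple q n \<equiv> simple_module (uq q n) (uq_act q n)"

abbreviation uq_indecomposable :: "'k::field \<Rightarrow> nat \<Rightarrow> (midx \<Rightarrow>\<^sub>0 'k) set \<Rightarrow> bool" where
  "uq_indecomposable q n \<equiv> indecomposable_module (uq q n) (uq_act q n)"

abbreviation Soc :: "'k::field \<Rightarrow> nat \<Rightarrow> (midx \<Rightarrow>\<^sub>0 'k) set \<Rightarrow> (midx \<Rightarrow>\<^sub>0 'k) set" where
  "Soc q n \<equiv> socle (uq q n) (uq_act q n)"

abbreviation uq_cyclic :: "'k::field \<Rightarrow> nat \<Rightarrow> (midx \<Rightarrow>\<^sub>0 'k) \<Rightarrow> (midx \<Rightarrow>\<^sub>0 'k) set" where
  "uq_cyclic q n \<equiv> cyclic_submodule (uq q n) (uq_act q n)"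

definition Vmod :: "'k::field \<Rightarrow> nat \<Rightarrow> midx \<Rightarrow> (midx \<Rightarrow>\<^sub>0 'k) set" where
  "Vmod q n \<alpha> = uq_cyclic q n (xpow n \<alpha>)"

definition highest_weight_vector ::
  "'k::field \<Rightarrow> nat \<Rightarrow> (midx \<Rightarrow>\<^sub>0 'k) set \<Rightarrow> (midx \<Rightarrow>\<^sub>0 'k) \<Rightarrow> bool" where
  "highest_weight_vector q n M v \<longleftrightarrow> v \<in> M \<and> v \<noteq> 0 \<and>
     (\<forall>i\<in>{1..n - 1}. \<exists>c. uq_act q n (uq_gen q n (gK i)) v = scal c v) \<and>
     (\<forall>i\<in>{1..n - 1}. uq_act q n (uq_gen q n (gE i)) v = 0) \<and>
     M = uq_cyclic q n v"

definition eta_low :: "int \<Rightarrow> midx" where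
  "eta_low s = (\<lambda>i. if i = 1 then s else 0)"

definition eta_high :: "nat \<Rightarrow> nat \<Rightarrow> int \<Rightarrow> int \<Rightarrow> midx" where
  "eta_high n l m h = (\<lambda>i. if i \<in> {1..n - 1} then m * int l - 1
     else if i = n then (m - 1) * int l + h else 0)"

definition eta_mid :: "nat \<Rightarrow> nat \<Rightarrow> int \<Rightarrow> midx" where
  "eta_mid l j h = (\<lambda>i. if i \<in> {1..j} then int l - 1 else if i = Suc j then h else 0)"

definition eta_kappa :: "nat \<Rightarrow> nat \<Rightarrow> int \<Rightarrow> (nat \<Rightarrow> int) \<Rightarrow> midx" where
  "eta_kappa n l h k = (\<lambda>i. if i \<in> {1..n - 1} then k i * int l + (int l - 1)
     else if i = n then k n * int l + h else 0)"

definition wp :: "nat \<Rightarrow> nat \<Rightarrow> int \<Rightarrow> int \<Rightarrow> int \<Rightarrow> midx set" where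
  "wp n l m kap h = {eta_kappa n l h k | k.
     (\<Sum>i=1..n. k i) = kap \<and> (\<forall>i\<in>{1..n}. 0 \<le> k i \<and> k i \<le> m - 1)}"

end

theory Submission
  imports Defs
begin

text \<open>
  Every \<open>e\<^sub>i\<close> and \<open>f\<^sub>i\<close> moves one unit of a multi-index between neighbouring positions, hence
  permutes the monomials up to scalars and zeros, and no weight argument is needed. Write
  \<open>\<beta> = l \<kappa> + \<rho>\<close> with residues \<open>0 \<le> \<rho> i < l\<close>; the energy of \<open>\<beta>\<close> is \<open>|\<kappa>|\<close>. A step with nonzero
  coefficient never raises an entry of \<open>\<kappa>\<close>, and the residues with a given sum are connected by
  invertible steps that fix \<open>\<kappa>\<close>, because raising always ends in the same primitive residue
  \<open>(l - 1, \<dots>, l - 1, h, 0, \<dots>, 0)\<close>. So the monomials with a fixed \<open>\<kappa>\<close> of minimal energy span a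
  simple module, and every nonzero submodule contains a nonzero vector of minimal energy. This
  gives the socle; reversing the energy drops gives generation by the monomials of maximal energy.

  For indecomposability, let \<open>P \<alpha> \<beta>\<close> be the coefficients of the projection onto a summand.
  Commutation with the generators links \<open>P \<alpha> \<beta>\<close> with \<open>P (\<alpha> + \<delta>) (\<beta> + \<delta>)\<close>. Passing through the
  energy level above the minimal one moves a unit of energy simultaneously in both indices; off
  the diagonal one can always reach a wall of the box \<open>0 \<le> \<kappa> i \<le> m - 1\<close> that stops only one of
  them, which forces the coefficient to vanish. So the projection is a scalar on the socle.
\<close>

section \<open>Representations of a ring and of its quotients\<close>

text \<open>The coefficient \<open>[\<beta> b + 1]\<close> of a move into b vanishes exactly when
  \<rho> b = l - 1, so a move never carries into \<kappa> b; a move out of a with \<rho> a = 0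
  borrows, and the energy drops by 1. A drop with nonzero coefficient thus starts at a residue with
  \<rho> a = 0 and \<rho> b < l - 1, and residues of this kind with sum S exist exactly when 0 \<le>
  S \<le> n (l - 1) - l. The residue sum at energy E is s - l E, so for E > 0 the same bound says
  that energy E - 1 is still possible: the minimal level is the one without drops. Dually, a drop
  ends at a residue with \<rho> a = l - 1 and \<rho> b > 0, which requires S \<ge> l. The range in
  part (5) ensures this at the minimal level, where S is s itself or at least (n - 1) (l - 1). The
  ring theory is confined to the beginning: submodules over \<open>uq\<close> turn out to be the
  subspaces stable under the generators (\<open>lsubmodule_iff\<close>), and from there on the
  argument concerns supports of vectors.\<close>

locale ring_rep = ring R for R (structure) +
  fixes act :: "'a \<Rightarrow> 'v::ab_group_add \<Rightarrow> 'v" and A :: "'v set"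
  assumes act_closed: "a \<in> carrier R \<Longrightarrow> v \<in> A \<Longrightarrow> act a v \<in> A"
    and act_vec_zero: "a \<in> carrier R \<Longrightarrow> act a 0 = 0"
    and act_add: "a \<in> carrier R \<Longrightarrow> b \<in> carrier R \<Longrightarrow> v \<in> A \<Longrightarrow> act (a \<oplus> b) v = act a v + act b v"
    and act_mult: "a \<in> carrier R \<Longrightarrow> b \<in> carrier R \<Longrightarrow> v \<in> A \<Longrightarrow> act (a \<otimes> b) v = act a (act b v)"
    and act_one: "v \<in> A \<Longrightarrow> act \<one> v = v"
begin

lemma act_zero: "v \<in> A \<Longrightarrow> act \<zero> v = 0"
  using act_add[of \<zero> \<zero> v] by simp

lemma act_minus:
  assumes "a \<in> carrier R" "v \<in> A"
  shows "act (\<ominus> a) v = - act a v"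
  using act_add[of "\<ominus> a" a v] assms by (simp add: act_zero l_neg eq_neg_iff_add_eq_0)

lemma act_diff:
  assumes "a \<in> carrier R" "b \<in> carrier R" "v \<in> A"
  shows "act (a \<ominus> b) v = act a v - act b v"
  using assms by (simp add: a_minus_def act_add act_minus)

lemma act_pow:
  assumes "a \<in> carrier R" "v \<in> A"
  shows "act (a [^] (k::nat)) v = (act a ^^ k) v"
  using assms(2)
proof (induction k arbitrary: v)
  case (Suc k)
  then show ?case
    by (simp add: act_mult assms act_closed funpow_swap1)
qed (simp add: act_one)

text \<open>Closure under left multiplication rests on \<open>act_vec_zero\<close>, closure under
  right multiplication on \<open>act_closed\<close>.\<close>

lemma annihilator_ideal: "ideal {a \<in> carrier R. \<forall>v\<in>A. act a v = 0} R"
proof (rule idealI)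
  show "subgroup {a \<in> carrier R. \<forall>v\<in>A. act a v = 0} (add_monoid R)"
    by (rule subgroup.intro)
      (auto simp: act_add act_zero act_minus a_inv_def[symmetric])
qed (auto simp: ring_axioms act_mult act_closed act_vec_zero)

context
  fixes S :: "'a set"
  assumes S: "S \<subseteq> carrier R" and S0: "\<And>s v. s \<in> S \<Longrightarrow> v \<in> A \<Longrightarrow> act s v = 0"
begin

lemma act_genideal:
  assumes "a \<in> Idl S" "v \<in> A"
  shows "act a v = 0"
proof -
  have "Idl S \<subseteq> {a \<in> carrier R. \<forall>v\<in>A. act a v = 0}"
    using S S0 by (intro genideal_minimal annihilator_ideal) auto
  then show ?thesis using assms by auto
qed

text \<open>Two representatives of a coset differ by an element of \<open>Idl S\<close>, which kills
  A; so the description in \<open>coset_act\<close> has a unique value.\<close>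

lemma coset_act_coset:
  assumes "a \<in> carrier R" "v \<in> A"
  shows "coset_act act (Idl S +> a) v = act a v"
proof -
  interpret I: ideal "Idl S" R by (rule genideal_ideal[OF S])
  have "act b v = act a v" if "b \<in> Idl S +> a" for b
  proof -
    from that obtain h where "h \<in> Idl S" "b = h \<oplus> a"
      by (auto simp: a_r_coset_def')
    then show ?thesis
      using assms by (simp add: act_add act_genideal I.a_Hcarr)
  qed
  moreover have "a \<in> Idl S +> a"
    by (rule I.a_rcos_self[OF assms(1)])
  ultimately show ?thesis
    unfolding coset_act_def by (intro the_equality) metis+
qed

lemma carrier_quot: "carrier (R Quot (Idl S)) = (\<lambda>a. Idl S +> a) ` carrier R"
  by (auto simp: FactRing_simps)

text \<open>Makes \<open>Uq\<close> a represented ring again, so that the lemmas above apply a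
  second time, to its quotient \<open>uq\<close>.\<close>

lemma quotient_rep: "ring_rep (R Quot (Idl S)) (coset_act act) A"
proof -
  interpret I: ideal "Idl S" R by (rule genideal_ideal[OF S])
  interpret Q: ring "R Quot (Idl S)" by (rule I.quotient_is_ring)
  interpret h: ring_hom_ring R "R Quot (Idl S)" "(+>) (Idl S)" by (rule I.rcos_ring_hom_ring)
  \<comment> \<open>A is an arbitrary set that may miss 0, so \<open>coset_act_coset\<close> does
    not cover this value.\<close>
  have z: "coset_act act (Idl S +> a) 0 = 0" if "a \<in> carrier R" for a
  proof -
    have "act b 0 = 0" if "b \<in> Idl S +> a" for b
      using that \<open>a \<in> carrier R\<close> I.a_subset a_r_coset_subset_G act_vec_zero by blast
    moreover have "a \<in> Idl S +> a"
      by (rule I.a_rcos_self[OF that])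
    ultimately show ?thesis
      unfolding coset_act_def by (intro the_equality) metis+
  qed
  show ?thesis
  proof (intro ring_rep.intro ring_rep_axioms.intro Q.ring_axioms)
    fix a b v assume "a \<in> carrier (R Quot (Idl S))" "b \<in> carrier (R Quot (Idl S))" and v: "v \<in> A"
    then obtain a' b' where a': "a' \<in> carrier R" "a = Idl S +> a'" and b': "b' \<in> carrier R" "b = Idl S +> b'"
      unfolding carrier_quot by blast
    have "a \<oplus>\<^bsub>R Quot (Idl S)\<^esub> b = Idl S +> (a' \<oplus> b')"
      using a' b' by simp
    then show "coset_act act (a \<oplus>\<^bsub>R Quot (Idl S)\<^esub> b) v = coset_act act a v + coset_act act b v"
      by (simp only: a' b' coset_act_coset act_add v a_closed)
    have "a \<otimes>\<^bsub>R Quot (Idl S)\<^esub> b = Idl S +> (a' \<otimes> b')"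
      using a' b' by simp
    then show "coset_act act (a \<otimes>\<^bsub>R Quot (Idl S)\<^esub> b) v = coset_act act a (coset_act act b v)"
      by (simp only: a' b' coset_act_coset act_mult v m_closed act_closed)
  next
    fix v assume v: "v \<in> A"
    have "\<one>\<^bsub>R Quot (Idl S)\<^esub> = Idl S +> \<one>"
      by simp
    then show "coset_act act \<one>\<^bsub>R Quot (Idl S)\<^esub> v = v"
      by (simp only: coset_act_coset act_one v one_closed)
  next
    fix a v assume "a \<in> carrier (R Quot (Idl S))"
    then obtain a' where a': "a' \<in> carrier R" "a = Idl S +> a'"
      unfolding carrier_quot by blast
    show "coset_act act a 0 = 0"
      using a' z by simp
    show "coset_act act a v \<in> A" if "v \<in> A"
      using that by (simp only: a' coset_act_coset act_closed)
  qed
qed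

end

end

section \<open>The action of the free algebra\<close>

lemma lin_ext_superset:
  assumes "finite S" "Poly_Mapping.keys v \<subseteq> S"
  shows "lin_ext f v = (\<Sum>a\<in>S. scal (Poly_Mapping.lookup v a) (f a))"
  unfolding lin_ext_def using assms
  by (intro sum.mono_neutral_left) (auto simp: in_keys_iff)

lemma lin_ext_add: "lin_ext f (v + w) = lin_ext f v + lin_ext f w"
proof -
  let ?S = "Poly_Mapping.keys v \<union> Poly_Mapping.keys w"
  have "finite ?S" by simp
  moreover have "Poly_Mapping.keys (v + w) \<subseteq> ?S" by (rule keys_add)
  ultimately show ?thesis
    by (simp add: lin_ext_superset[of ?S] lookup_add scal.scale_left_distrib sum.distrib)
qed

lemma keys_scal_subset: "Poly_Mapping.keys (scal c v) \<subseteq> Poly_Mapping.keys v"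
  by (auto simp: in_keys_iff)

lemma lin_ext_scal: "lin_ext f (scal c v) = scal c (lin_ext f v)"
  by (subst lin_ext_superset[OF finite_keys keys_scal_subset])
    (simp add: lin_ext_def scal.scale_sum_right)

lemma lin_ext_0 [simp]: "lin_ext f 0 = 0"
  by (simp add: lin_ext_def)

lemma lin_ext_minus: "lin_ext f (- v) = - lin_ext f v"
  using lin_ext_add[of f v "- v"] by (simp add: eq_neg_iff_add_eq_0 add.commute)

lemma lin_ext_diff: "lin_ext f (v - w) = lin_ext f v - lin_ext f w"
  using lin_ext_add[of f v "- w"] by (simp add: lin_ext_minus)

lemma lin_ext_single [simp]: "lin_ext f (Poly_Mapping.single a c) = scal c (f a)"
  by (simp add: lin_ext_superset[of "{a}"])

text \<open>Updating a key outside the support amounts to adding a \<open>single\<close>. Identities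
  that are linear in an element of the free algebra are thereby reduced to words.\<close>

lemma single_induct [case_names single add]:
  fixes v :: "'a \<Rightarrow>\<^sub>0 'k::field"
  assumes "\<And>a c. P (Poly_Mapping.single a c)" "\<And>v w. P v \<Longrightarrow> P w \<Longrightarrow> P (v + w)"
  shows "P v"
proof (induction v rule: update_induct)
  case const
  then show ?case using assms(1)[of undefined 0] by simp
next
  case (update v a c)
  have "Poly_Mapping.update a c v = Poly_Mapping.single a c + v"
    using update(1) by (intro poly_mapping_eqI) (auto simp: lookup_update lookup_add lookup_single in_keys_iff)
  then show ?case using update assms by simp
qed

abbreviation gact :: "'k::field \<Rightarrow> nat \<Rightarrow> gen \<Rightarrow> (midx \<Rightarrow>\<^sub>0 'k) \<Rightarrow> (midx \<Rightarrow>\<^sub>0 'k)" where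
  "gact q n g \<equiv> lin_ext (basis_act q n g)"

lemma word_act_add: "word_act q n w (v + v') = word_act q n w v + word_act q n w v'"
proof -
  have "foldr (gact q n) gs (v + v') = foldr (gact q n) gs v + foldr (gact q n) gs v'" for gs
    by (induction gs) (auto simp: lin_ext_add)
  then show ?thesis by (simp add: word_act_def)
qed

lemma word_act_scal: "word_act q n w (scal c v) = scal c (word_act q n w v)"
proof -
  have "foldr (gact q n) gs (scal c v) = scal c (foldr (gact q n) gs v)" for gs
    by (induction gs) (auto simp: lin_ext_scal)
  then show ?thesis by (simp add: word_act_def)
qed

lemma word_act_plus: "word_act q n (u + w) v = word_act q n u (word_act q n w v)"
  by (simp add: word_act_def plus_word_def)

lemma free_act_add: "free_act q n (a + b) v = free_act q n a v + free_act q n b v"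
  by (simp add: free_act_def lin_ext_add)

lemma free_act_diff: "free_act q n (a - b) v = free_act q n a v - free_act q n b v"
  by (simp add: free_act_def lin_ext_diff)

lemma free_act_scal: "free_act q n (scal c a) v = scal c (free_act q n a v)"
  by (simp add: free_act_def lin_ext_scal)

lemma free_act_single: "free_act q n (Poly_Mapping.single w c) v = scal c (word_act q n w v)"
  by (simp add: free_act_def)

lemma free_act_zero [simp]: "free_act q n 0 v = 0"
  by (simp add: free_act_def)

lemma free_act_one [simp]: "free_act q n 1 v = v"
  by (simp add: free_act_single word_act_def zero_word_def flip: single_one)

lemma free_act_gel: "free_act q n (gel g) v = gact q n g v"
  by (simp add: gel_def free_act_single word_act_def)

lemma free_act_vec_add: "free_act q n a (v + w) = free_act q n a v + free_act q n a w"
  by (induction a rule: single_induct)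
    (auto simp: free_act_single free_act_add word_act_add scal.scale_right_distrib)

lemma free_act_vec_scal: "free_act q n a (scal c v) = scal c (free_act q n a v)"
  by (induction a rule: single_induct)
    (auto simp: free_act_single free_act_add word_act_scal scal.scale_right_distrib mult.commute)

lemma free_act_vec_zero [simp]: "free_act q n a 0 = 0"
  using free_act_vec_scal[of q n a 0 0] by simp

lemma free_act_mult: "free_act q n (a * b) v = free_act q n a (free_act q n b v)"
proof (induction a rule: single_induct)
  case (single u c)
  show ?case
    by (induction b rule: single_induct)
      (auto simp: mult_single free_act_single free_act_add word_act_add word_act_scal word_act_plus
        distrib_left scal.scale_right_distrib)
qed (simp add: free_act_add distrib_right)

lemma free_alg_simps [simp]:
  "mult (free_alg n) = (*)" "one (free_alg n) = 1" "zero (free_alg n) = 0" "add (free_alg n) = (+)"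
  by (simp_all add: free_alg_def)

definition good_words :: "nat \<Rightarrow> gen word set" where
  "good_words n = {w. \<forall>g\<in>set (letters w). gen_index g \<in> {1..n - 1}}"

lemma carrier_free_alg: "a \<in> carrier (free_alg n) \<longleftrightarrow> Poly_Mapping.keys a \<subseteq> good_words n"
  by (auto simp: free_alg_def good_words_def)

lemma free_alg_closed:
  assumes "a \<in> carrier (free_alg n)" "b \<in> carrier (free_alg n)"
  shows "a + b \<in> carrier (free_alg n)" "a - b \<in> carrier (free_alg n)" "a * b \<in> carrier (free_alg n)"
    "- a \<in> carrier (free_alg n)" "scal c a \<in> carrier (free_alg n)"
proof -
  show "a * b \<in> carrier (free_alg n)"
    unfolding carrier_free_alg
  proof
    fix w assume "w \<in> Poly_Mapping.keys (a * b)"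
    then obtain u v where "u \<in> Poly_Mapping.keys a" "v \<in> Poly_Mapping.keys b" "w = u + v"
      using keys_mult[of a b] by blast
    then show "w \<in> good_words n"
      using assms unfolding carrier_free_alg by (auto simp: good_words_def plus_word_def)
  qed
  show "a + b \<in> carrier (free_alg n)" "a - b \<in> carrier (free_alg n)"
    using assms unfolding carrier_free_alg
    by (meson keys_add keys_diff subset_trans Un_least)+
  show "- a \<in> carrier (free_alg n)" "scal c a \<in> carrier (free_alg n)"
    using assms keys_scal_subset[of c a] unfolding carrier_free_alg by auto
qed

lemma free_alg_zero_one: "0 \<in> carrier (free_alg n)" "1 \<in> carrier (free_alg n)"
  by (auto simp: carrier_free_alg good_words_def zero_word_def)

lemma gel_carrier: "gen_index g \<in> {1..n - 1} \<Longrightarrow> gel g \<in> carrier (free_alg n)"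
  by (auto simp: carrier_free_alg gel_def good_words_def)

lemma ring_free_alg: "ring (free_alg n :: (gen word \<Rightarrow>\<^sub>0 'k::field) ring)"
proof (rule ringI)
  show "abelian_group (free_alg n :: (gen word \<Rightarrow>\<^sub>0 'k) ring)"
  proof (rule abelian_groupI, goal_cases)
    case (6 x)
    then show ?case by (intro bexI[of _ "- x"]) (auto intro: free_alg_closed)
  qed (auto simp: add_ac intro: free_alg_closed free_alg_zero_one)
  show "monoid (free_alg n :: (gen word \<Rightarrow>\<^sub>0 'k) ring)"
    by (rule monoidI) (auto simp: mult.assoc intro: free_alg_closed free_alg_zero_one)
qed (auto simp: distrib_left distrib_right)

section \<open>Generators as weighted shifts of multi-indices\<close>

fun shift :: "gen \<Rightarrow> midx \<Rightarrow> midx" where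
  "shift (gE i) \<beta> = \<beta>(i := \<beta> i + 1, Suc i := \<beta> (Suc i) - 1)"
| "shift (gF i) \<beta> = \<beta>(i := \<beta> i - 1, Suc i := \<beta> (Suc i) + 1)"
| "shift _ \<beta> = \<beta>"

fun coef :: "'k::field \<Rightarrow> gen \<Rightarrow> midx \<Rightarrow> 'k" where
  "coef q (gE i) \<beta> = qint q (\<beta> i + 1)"
| "coef q (gF i) \<beta> = qint q (\<beta> (Suc i) + 1)"
| "coef q (gK i) \<beta> = q powi (\<beta> i - \<beta> (Suc i))"
| "coef q (gKinv i) \<beta> = q powi (- (\<beta> i - \<beta> (Suc i)))"

lemma basis_act_eq: "basis_act q n g \<beta> = scal (coef q g \<beta>) (xpow n (shift g \<beta>))"
  by (cases g) auto

lemma qint_0 [simp]: "qint q 0 = 0"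
  by (simp add: qint_def)

lemma shift_into_Zplus:
  assumes "gen_index g \<in> {1..n - 1}" "\<beta> \<notin> Zplus n" "shift g \<beta> \<in> Zplus n"
  shows "coef q g \<beta> = 0"
proof -
  \<comment> \<open>Only the raised entry can have been invalid before and valid after the shift,
    and it rises by 1; all other entries of \<gamma> already satisfy the conditions of
    \<open>Zplus\<close>.\<close>
  have *: "\<gamma> a = -1"
    if ab: "a \<in> {1..n}" "b \<in> {1..n}" "a \<noteq> b" and \<gamma>: "\<gamma> \<notin> Zplus n" "\<gamma>(a := \<gamma> a + 1, b := \<gamma> b - 1) \<in> Zplus n"
    for a b :: nat and \<gamma> :: midx
  proof (rule ccontr)
    assume neq: "\<gamma> a \<noteq> -1"
    have v: "(\<forall>i\<in>{1..n}. 0 \<le> (\<gamma>(a := \<gamma> a + 1, b := \<gamma> b - 1)) i)" "(\<forall>i. i \<notin> {1..n} \<longrightarrow> (\<gamma>(a := \<gamma> a + 1, b := \<gamma> b - 1)) i = 0)"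
      using \<gamma>(2) by (auto simp: Zplus_def simp del: fun_upd_apply)
    have "0 \<le> \<gamma> i" if "i \<in> {1..n}" for i
      using v(1)[rule_format, OF that] ab neq by (auto split: if_splits)
    moreover have "\<gamma> i = 0" if "i \<notin> {1..n}" for i
      using v(2)[rule_format, OF that] ab that by (auto split: if_splits)
    ultimately show False using \<gamma>(1) by (auto simp: Zplus_def)
  qed
  show ?thesis
  proof (cases g)
    case (gE i)
    then have "\<beta> i = -1"
      using assms by (intro *[of i "Suc i" \<beta>]) auto
    then show ?thesis using gE by simp
  next
    case (gF i)
    then have "\<beta> (Suc i) = -1"
      using assms by (intro *[of "Suc i" i \<beta>]) (auto simp: fun_upd_twist)
    then show ?thesis using gF by simp
  qed (use assms in auto)
qed

text \<open>Valid even for \<open>\<beta> \<notin> Zplus n\<close>: a generator that moves such a \<open>\<beta>\<close> back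
  into \<open>Zplus n\<close> has coefficient \<open>[0] = 0\<close>. Hence relations can be checked on coefficients alone.\<close>

lemma gact_xpow:
  assumes "gen_index g \<in> {1..n - 1}"
  shows "gact q n g (xpow n \<beta>) = scal (coef q g \<beta>) (xpow n (shift g \<beta>))"
proof (cases "\<beta> \<in> Zplus n")
  case True
  then show ?thesis by (simp add: xpow_def[of n \<beta>] basis_act_eq)
next
  case False
  then show ?thesis
    using shift_into_Zplus[OF assms False, of q] by (auto simp: xpow_def)
qed

text \<open>For B inside \<open>Zplus n\<close> this is the span of the monomials
  (\<open>span_xpow\<close>). Described by supports, stability under the generators becomes a
  condition on indices.\<close>

definition keyspan :: "'a set \<Rightarrow> ('a \<Rightarrow>\<^sub>0 'k::field) set" where
  "keyspan B = {y. Poly_Mapping.keys y \<subseteq> B}"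

lemma keyspan_subspace: "scal.subspace (keyspan B :: ('a \<Rightarrow>\<^sub>0 'k::field) set)"
proof (unfold scal.subspace_def keyspan_def, intro conjI ballI allI CollectI)
  fix x y :: "'a \<Rightarrow>\<^sub>0 'k"
  assume "x \<in> {y. Poly_Mapping.keys y \<subseteq> B}" "y \<in> {y. Poly_Mapping.keys y \<subseteq> B}"
  then show "Poly_Mapping.keys (x + y) \<subseteq> B"
    using keys_add[of x y] by blast
qed (auto simp: in_keys_iff subset_iff)

lemma poly_mapping_sum_xpow:
  assumes "Poly_Mapping.keys y \<subseteq> Zplus n"
  shows "y = (\<Sum>\<beta>\<in>Poly_Mapping.keys y. scal (Poly_Mapping.lookup y \<beta>) (xpow n \<beta>))"
proof (rule poly_mapping_eqI)
  fix \<gamma>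
  have "Poly_Mapping.lookup (\<Sum>\<beta>\<in>Poly_Mapping.keys y. scal (Poly_Mapping.lookup y \<beta>) (xpow n \<beta>)) \<gamma>
    = (\<Sum>\<beta>\<in>Poly_Mapping.keys y. if \<beta> = \<gamma> then Poly_Mapping.lookup y \<beta> else 0)"
    unfolding lookup_sum using assms
    by (intro sum.cong) (auto simp: xpow_def lookup_single when_def)
  then show "Poly_Mapping.lookup y \<gamma> = Poly_Mapping.lookup (\<Sum>\<beta>\<in>Poly_Mapping.keys y. scal (Poly_Mapping.lookup y \<beta>) (xpow n \<beta>)) \<gamma>"
    by (auto simp: in_keys_iff)
qed

lemma keyspan_subset:
  assumes "B \<subseteq> Zplus n" "scal.subspace W" "\<And>\<beta>. \<beta> \<in> B \<Longrightarrow> xpow n \<beta> \<in> W"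
  shows "keyspan B \<subseteq> W"
proof
  fix y :: "midx \<Rightarrow>\<^sub>0 'a" assume "y \<in> keyspan B"
  then have y: "Poly_Mapping.keys y \<subseteq> B" by (simp add: keyspan_def)
  have "(\<Sum>\<beta>\<in>Poly_Mapping.keys y. scal (Poly_Mapping.lookup y \<beta>) (xpow n \<beta>)) \<in> W"
    using y assms(2,3) by (intro scal.subspace_sum scal.subspace_scale) auto
  then show "y \<in> W"
    using poly_mapping_sum_xpow[of y n] y assms(1) by (metis subset_trans)
qed

lemma xpow_in_keyspan: "\<beta> \<in> B \<Longrightarrow> xpow n \<beta> \<in> keyspan B"
  by (auto simp: keyspan_def xpow_def)

lemma span_xpow:
  assumes "B \<subseteq> Zplus n"
  shows "scal.span (xpow n ` B) = keyspan B"
proof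
  show "scal.span (xpow n ` B) \<subseteq> keyspan B"
    by (intro scal.span_minimal keyspan_subspace) (auto intro: xpow_in_keyspan)
  show "keyspan B \<subseteq> scal.span (xpow n ` B)"
    using assms by (intro keyspan_subset[of _ n]) (auto intro: scal.span_base)
qed

lemma free_act_eq_0:
  assumes "\<And>\<beta>. \<beta> \<in> Zplus n \<Longrightarrow> free_act q n a (xpow n \<beta>) = 0" "v \<in> keyspan (Zplus n)"
  shows "free_act q n a v = 0"
proof -
  have "scal.subspace {v. free_act q n a v = 0}"
    by (auto simp: scal.subspace_def free_act_vec_add free_act_vec_scal)
  then have "keyspan (Zplus n) \<subseteq> {v. free_act q n a v = 0}"
    using assms(1) by (intro keyspan_subset) auto
  then show ?thesis using assms(2) by auto
qed

lemma gact_closed: 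
  assumes "v \<in> keyspan (Zplus n)"
  shows "gact q n g v \<in> keyspan (Zplus n)"
  unfolding lin_ext_def basis_act_eq
  by (intro scal.subspace_sum[OF keyspan_subspace] scal.subspace_scale[OF keyspan_subspace])
     (auto simp: keyspan_def xpow_def)

lemma word_act_closed:
  assumes "v \<in> keyspan (Zplus n)"
  shows "word_act q n w v \<in> keyspan (Zplus n)"
proof -
  have "foldr (gact q n) gs v \<in> keyspan (Zplus n)" for gs
    using assms by (induction gs) (auto intro: gact_closed)
  then show ?thesis by (simp add: word_act_def)
qed

lemma free_act_closed:
  assumes "v \<in> keyspan (Zplus n)"
  shows "free_act q n a v \<in> keyspan (Zplus n)"
  unfolding free_act_def lin_ext_def
  by (intro scal.subspace_sum[OF keyspan_subspace] scal.subspace_scale[OF keyspan_subspace]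
      word_act_closed assms)

lemma free_alg_rep: "ring_rep (free_alg n) (free_act q n) (keyspan (Zplus n))"
  by (intro ring_rep.intro ring_free_alg ring_rep_axioms.intro)
     (auto simp: free_act_closed free_act_add free_act_mult)

section \<open>The defining relations\<close>

context
  fixes q :: "'k::field"
  assumes q: "q \<noteq> 0" "q \<noteq> 1" "q \<noteq> -1"
begin

lemma q_minus_inverse: "q - inverse q \<noteq> 0"
proof
  assume "q - inverse q = 0"
  then have "q * q = 1"
    using q by (simp add: field_simps)
  then show False
    using q square_eq_1_iff by blast
qed

text \<open>With x = q^a and y = q^b the terms in x y and in its inverse cancel, and the rest has a
  factor q - q^-1 that one denominator absorbs. This is the commutator of \<open>e\<close> and
  \<open>f\<close> at one node, evaluated on a monomial.\<close>

lemma qint_commutator: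
  "qint q (b + 1) * qint q a - qint q (a + 1) * qint q b = qint q (a - b)"
proof -
  define d p x y x' y' where "d = inverse (q - inverse q)" "p = inverse q"
    "x = q powi a" "y = q powi b" "x' = inverse x" "y' = inverse y"
  note defs = this
  have d: "d * (q - p) = 1"
    using q_minus_inverse by (simp add: defs)
  have qi: "qint q (b + 1) = d * (y * q - y' * p)" "qint q (a + 1) = d * (x * q - x' * p)"
    "qint q a = d * (x - x')" "qint q b = d * (y - y')" "qint q (a - b) = d * (x * y' - x' * y)"
    unfolding qint_def defs using q
    by (simp_all add: power_int_add power_int_diff power_int_minus divide_inverse mult_ac
        del: minus_add_distrib minus_diff_eq)
  have "qint q (b + 1) * qint q a - qint q (a + 1) * qint q b = d * (d * (q - p)) * (x * y' - x' * y)"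
    unfolding qi by (simp add: algebra_simps)
  then show ?thesis by (simp add: d qi)
qed

text \<open>The Chebyshev recursion, from [2] = q + q^-1; the quantum Serre relations reduce to
  it.\<close>

lemma qint_two_term:
  "qint q (a + 1) - qint q 2 * qint q a + qint q (a - 1) = 0"
proof -
  define d p x x' where "d = inverse (q - inverse q)" "p = inverse q" "x = q powi a" "x' = inverse x"
  note defs = this
  have d: "d * (q - p) = 1"
    using q_minus_inverse by (simp add: defs)
  have qi: "qint q (a + 1) = d * (x * q - x' * p)" "qint q (a - 1) = d * (x * p - x' * q)"
    "qint q a = d * (x - x')"
    unfolding qint_def defs using q
    by (simp_all add: power_int_add power_int_diff power_int_minus divide_inverse mult_ac
        del: minus_add_distrib minus_diff_eq)
  have "qint q 2 = d * (q * q - p * p)"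
    unfolding qint_def defs using q
    by (simp add: power_int_minus divide_inverse power2_eq_square)
  also have "\<dots> = d * (q - p) * (q + p)" by (simp add: algebra_simps)
  finally have "qint q 2 = q + p" by (simp add: d)
  then show ?thesis unfolding qi by (simp add: algebra_simps)
qed

lemma qint_eq_0_iff: "qint q a = 0 \<longleftrightarrow> q powi (2 * a) = 1"
proof -
  have "qint q a = 0 \<longleftrightarrow> q powi a = q powi (- a)"
    using q_minus_inverse by (simp add: qint_def)
  also have "\<dots> \<longleftrightarrow> q powi a * q powi a = 1"
    using q by (simp add: power_int_minus field_simps)
  also have "q powi a * q powi a = q powi (2 * a)"
    using q power_int_add[of q a a] by (simp only: mult_2) simp
  finally show ?thesis .
qed

text \<open>l > 0 means that the minimum in \<open>qchar\<close> exists. Since q^(2l) = 1, [a]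
  vanishes together with [a mod l], and a mod l lies below the minimum.\<close>

lemma qint_eq_0_iff_dvd:
  assumes "qchar q = l" "l > 0"
  shows "qint q a = 0 \<longleftrightarrow> int l dvd a"
proof -
  let ?P = "\<lambda>k::nat. 0 < k \<and> qint q (int k) = 0"
  have ex: "\<exists>k. ?P k" and l: "l = (LEAST k. ?P k)"
    using assms unfolding qchar_def by (auto split: if_splits)
  have Pl: "?P l" unfolding l by (rule LeastI_ex[OF ex])
  then have 1: "q powi (2 * int l) = 1"
    by (simp add: qint_eq_0_iff)
  have "2 * a = 2 * int l * (a div int l) + 2 * (a mod int l)"
    by (metis distrib_left mult.assoc mult_div_mod_eq)
  moreover have "q powi (2 * int l * (a div int l)) = 1"
    unfolding power_int_mult[of q "2 * int l"] 1 by simp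
  ultimately have "q powi (2 * a) = q powi (2 * int l * (a div int l)) * q powi (2 * (a mod int l))"
    using q by (simp only: power_int_add disj_not1 not_False_eq_True simp_thms)
  also have "\<dots> = q powi (2 * (a mod int l))"
    using \<open>q powi (2 * int l * (a div int l)) = 1\<close> by (simp only: mult_1_left)
  finally have eq: "qint q a = 0 \<longleftrightarrow> qint q (a mod int l) = 0"
    by (simp add: qint_eq_0_iff)
  show ?thesis
  proof
    assume "qint q a = 0"
    then have "\<not> (0 < nat (a mod int l) \<and> nat (a mod int l) < l)"
      using eq not_less_Least[of "nat (a mod int l)" ?P] l by auto
    then have "a mod int l = 0"
      using assms(2) by (metis nat_less_iff of_nat_0_less_iff pos_mod_bound pos_mod_sign zero_less_nat_eq
          dual_order.order_iff_strict)
    then show "int l dvd a" by auto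
  next
    assume "int l dvd a"
    then show "qint q a = 0" using eq by simp
  qed
qed

lemma Uq_relations_carrier: "Uq_relations q n \<subseteq> carrier (free_alg n)"
  unfolding Uq_relations_def Let_def
  by (auto simp: power2_eq_square intro!: free_alg_closed gel_carrier free_alg_zero_one split: if_splits)

lemmas free_act_simps = free_act_add free_act_diff free_act_mult free_act_gel free_act_scal free_act_one

lemma cartan_cases:
  obtains "i = j" "cartan i j = 2" | "i = Suc j" "cartan i j = -1" | "j = Suc i" "cartan i j = -1"
  | "i \<noteq> j" "i \<noteq> Suc j" "j \<noteq> Suc i" "cartan i j = 0"
proof -
  consider "i = j" | "i = Suc j" | "j = Suc i" | "i \<noteq> j \<and> i \<noteq> Suc j \<and> j \<noteq> Suc i"
    by blast
  then show thesis
    by cases (simp_all add: that cartan_def)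
qed

lemma shift_commute: "shift g (shift h \<beta>) = shift h (shift g \<beta>)"
  by (cases g; cases h) (auto simp: fun_eq_iff)

text \<open>Shifts commute, so all words of one relation send \<beta> to the same index, and each
  relation becomes a single identity between coefficients.\<close>

lemma free_act_relation_xpow:
  assumes "r \<in> Uq_relations q n"
  shows "free_act q n r (xpow n \<beta>) = 0"
proof -
  let ?I = "{1..n - 1}"
  note simps = free_act_simps gact_xpow lin_ext_scal
  have comb3: "scal a v - scal b v + scal c v = 0" if "a - b + c = 0"
    for a b c :: 'k and v :: "midx \<Rightarrow>\<^sub>0 'k"
    using that by (metis scal.scale_left_diff_distrib scal.scale_left_distrib scal.scale_zero_left)
  have "Uq_relations q n \<subseteq> {r. free_act q n r (xpow n \<beta>) = 0}"
    unfolding Uq_relations_def Let_def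
  proof ((intro Un_least; intro subsetI CollectI; elim CollectE exE conjE), goal_cases KK K1 K2 KE KF EF comm serre)
    case (KK r i j)
    then show ?case by (simp add: simps mult.commute)
  next
    case (K1 r i)
    then show ?case using q by (simp add: simps flip: power_int_add)
  next
    case (K2 r i)
    then show ?case using q by (simp add: simps flip: power_int_add)
  next
    case (KE r i j)
    \<comment> \<open>The shift changes the difference \<beta> i - \<beta> (Suc i) by
      \<open>cartan i j\<close>; apart from this the two powers of q are inverse to each
      other.\<close>
    have *: "q powi (\<beta>' i - \<beta>' (Suc i)) * q powi (- (\<beta> i - \<beta> (Suc i))) = q powi cartan i j"
      if "\<beta>' = shift (gE j) \<beta>" for \<beta>'
      unfolding that using q by (cases i j rule: cartan_cases) (auto simp flip: power_int_add)
    show ?case using KE *[OF refl] by (simp add: simps mult_ac del: shift.simps(1) minus_diff_eq)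
  next
    case (KF r i j)
    have *: "q powi (\<beta>' i - \<beta>' (Suc i)) * q powi (- (\<beta> i - \<beta> (Suc i))) = q powi (- cartan i j)"
      if "\<beta>' = shift (gF j) \<beta>" for \<beta>'
      unfolding that using q by (cases i j rule: cartan_cases) (auto simp flip: power_int_add)
    show ?case using KF *[OF refl] by (simp add: simps mult_ac del: shift.simps(2) minus_diff_eq)
  next
    case (EF r i j)
    show ?case
    proof (cases "i = j")
      case True
      have s: "shift (gE j) (shift (gF j) \<beta>) = \<beta>" "shift (gF j) (shift (gE j) \<beta>) = \<beta>"
        by auto
      \<comment> \<open>The left side compares the two orders of \<open>e\<close> and
        \<open>f\<close>: each operator is evaluated after the other has already shifted its
        entry.\<close>
      have "qint q (\<beta> (Suc j) + 1) * qint q (\<beta> j) - qint q (\<beta> j + 1) * qint q (\<beta> (Suc j)) =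
        inverse (q - inverse q) * (q powi (\<beta> j - \<beta> (Suc j)) - q powi (- (\<beta> j - \<beta> (Suc j))))"
        unfolding qint_commutator by (simp add: qint_def field_simps)
      then have "scal (qint q (\<beta> (Suc j) + 1) * qint q (\<beta> j)) v - scal (qint q (\<beta> j + 1) * qint q (\<beta> (Suc j))) v
          - scal (inverse (q - inverse q)) (scal (q powi (\<beta> j - \<beta> (Suc j))) v - scal (q powi (- (\<beta> j - \<beta> (Suc j)))) v) = 0"
        for v :: "midx \<Rightarrow>\<^sub>0 'k"
        by (simp only: scal.scale_left_diff_distrib[symmetric] scal.scale_scale) simp
      moreover have "gen_index (gE j) \<in> ?I" "gen_index (gF j) \<in> ?I" "gen_index (gK j) \<in> ?I" "gen_index (gKinv j) \<in> ?I"
        using EF by auto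
      ultimately show ?thesis
        unfolding EF(1) using True
        by (simp only: free_act_simps gact_xpow lin_ext_scal s if_True simp_thms scal.scale_scale coef.simps shift.simps(3,4))
          (simp add: fun_upd_twist)
    next
      case False
      have s: "shift (gE i) (shift (gF j) \<beta>) = shift (gF j) (shift (gE i) \<beta>)"
        by (rule shift_commute)
      \<comment> \<open>The two moves read a common entry only for i = j + 1, and then either order
        yields [\<beta> i + 1] [\<beta> i + 2].\<close>
      have c: "coef q (gE i) (shift (gF j) \<beta>) * coef q (gF j) \<beta> = coef q (gF j) (shift (gE i) \<beta>) * coef q (gE i) \<beta>"
        using False by (cases i j rule: cartan_cases) (auto simp: add_ac)
      show ?thesis using EF False c s
        by (simp add: simps mult_ac del: shift.simps coef.simps)
    qed
  next
    case (comm r X i j)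
    have s: "shift (X i) (shift (X j) \<beta>) = shift (X j) (shift (X i) \<beta>)"
      by (rule shift_commute)
    have c: "coef q (X i) (shift (X j) \<beta>) * coef q (X j) \<beta> = coef q (X j) (shift (X i) \<beta>) * coef q (X i) \<beta>"
      using comm(2,5) by (cases i j rule: cartan_cases) auto
    show ?case using comm s c
      by (auto simp: simps mult_ac simp del: shift.simps coef.simps)
  next
    case (serre r X i j)
    let ?a = "shift (X i) \<beta>" and ?b = "shift (X j) \<beta>"
    have s: "shift (X i) (shift (X i) ?b) = shift (X j) (shift (X i) ?a)"
      "shift (X i) (shift (X j) ?a) = shift (X j) (shift (X i) ?a)"
      by (metis shift_commute)+
    have c: "coef q (X j) \<beta> * coef q (X i) ?b * coef q (X i) (shift (X i) ?b) -
      qint q 2 * (coef q (X i) \<beta> * coef q (X j) ?a * coef q (X i) (shift (X j) ?a)) +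
      coef q (X i) \<beta> * coef q (X i) ?a * coef q (X j) (shift (X i) ?a) = 0"
    proof -
      \<comment> \<open>The three products share two factors x and y; the third factor runs through
        [a + 1], [a], [a - 1].\<close>
      have *: "x * (qint q (a + 1)) * y - qint q 2 * (x * qint q a * y) + x * y * qint q (a - 1) = 0" for x y a
      proof -
        have "x * (qint q (a + 1)) * y - qint q 2 * (x * qint q a * y) + x * y * qint q (a - 1) = 
          x * y * (qint q (a + 1) - qint q 2 * qint q a + qint q (a - 1))"
          by (simp add: algebra_simps)
        then show ?thesis by (simp only: qint_two_term) simp
      qed
      from serre(2) have "X = gE \<or> X = gF" by simp
      then show ?thesis
      proof
        assume X: "X = gE"
        show ?thesis
        proof (cases i j rule: cartan_cases)
          case 2
          then show ?thesis using X *[of "qint q (\<beta> j + 1) * qint q (\<beta> i + 1)" "\<beta> i + 1" 1]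
            by (simp add: algebra_simps)
        next
          case 3
          then show ?thesis using X *[of "qint q (\<beta> i + 1)" "\<beta> (Suc i)" "qint q (\<beta> i + 2)"]
            by (simp add: algebra_simps)
        qed (use serre in auto)
      next
        assume X: "X = gF"
        show ?thesis
        proof (cases i j rule: cartan_cases)
          case 2
          then show ?thesis using X *[of "qint q (\<beta> (Suc i) + 1)" "\<beta> i" "qint q (\<beta> (Suc i) + 2)"]
            by (simp add: algebra_simps)
        next
          case 3
          then show ?thesis using X *[of "qint q (\<beta> (Suc j) + 1) * qint q (\<beta> j + 1)" "\<beta> j + 1" 1]
            by (simp add: algebra_simps)
        qed (use serre in auto)
      qed
    qed
    have ind: "gen_index (X i) \<in> ?I" "gen_index (X j) \<in> ?I"
      using serre by auto
    have "free_act q n r (xpow n \<beta>) =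
      scal (coef q (X j) \<beta> * coef q (X i) ?b * coef q (X i) (shift (X i) ?b)) (xpow n (shift (X j) (shift (X i) ?a)))
      - scal (qint q 2 * (coef q (X i) \<beta> * coef q (X j) ?a * coef q (X i) (shift (X j) ?a))) (xpow n (shift (X j) (shift (X i) ?a)))
      + scal (coef q (X i) \<beta> * coef q (X i) ?a * coef q (X j) (shift (X i) ?a)) (xpow n (shift (X j) (shift (X i) ?a)))"
      unfolding serre(1) using s
      by (simp add: free_act_simps lin_ext_scal power2_eq_square gact_xpow[OF ind(1)] gact_xpow[OF ind(2)] mult_ac
           del: shift.simps coef.simps)
    also have "\<dots> = 0"
      by (rule comb3[OF c])
    finally show ?case .
  qed
  then show ?thesis using assms by auto
qed

end

section \<open>Submodules\<close>

definition gen_closed :: "'k::field \<Rightarrow> nat \<Rightarrow> (midx \<Rightarrow>\<^sub>0 'k) set \<Rightarrow> bool" where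
  "gen_closed q n W \<longleftrightarrow> scal.subspace W \<and>
    (\<forall>g. gen_index g \<in> {1..n - 1} \<longrightarrow> (\<forall>y\<in>W. gact q n g y \<in> W))"

lemma gen_closed_subspace: "gen_closed q n W \<Longrightarrow> scal.subspace W"
  by (simp add: gen_closed_def)

lemma gen_closed_gact: "gen_closed q n W \<Longrightarrow> gen_index g \<in> {1..n - 1} \<Longrightarrow> y \<in> W \<Longrightarrow> gact q n g y \<in> W"
  by (simp add: gen_closed_def)

lemma gen_closed_Int: "gen_closed q n U \<Longrightarrow> gen_closed q n W \<Longrightarrow> gen_closed q n (U \<inter> W)"
  by (auto simp: gen_closed_def scal.subspace_inter)

lemma free_act_gen_closed:
  assumes "gen_closed q n W" "a \<in> carrier (free_alg n)" "y \<in> W"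
  shows "free_act q n a y \<in> W"
proof -
  have "foldr (gact q n) gs y \<in> W" if "\<forall>g\<in>set gs. gen_index g \<in> {1..n - 1}" for gs
    using that by (induction gs) (use assms in \<open>auto intro: gen_closed_gact\<close>)
  then have "word_act q n w y \<in> W" if "w \<in> Poly_Mapping.keys a" for w
    using assms(2) that by (auto simp: word_act_def carrier_free_alg good_words_def)
  then show ?thesis
    unfolding free_act_def lin_ext_def using gen_closed_subspace[OF assms(1)]
    by (intro scal.subspace_sum scal.subspace_scale) auto
qed

section \<open>From the free algebra to the small quantum group\<close>

locale quantum_param =
  fixes q :: "'k::field" and n l :: nat
  assumes q: "q \<noteq> 0" "q \<noteq> 1" "q \<noteq> -1"
    and n3: "n \<ge> 3" and l_def: "qchar q = l" and l3: "l \<ge> 3"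
begin

lemma qint_0_iff: "qint q a = 0 \<longleftrightarrow> int l dvd a"
  using l3 by (intro qint_eq_0_iff_dvd q l_def) auto

abbreviation "AA \<equiv> keyspan (Zplus n) :: (midx \<Rightarrow>\<^sub>0 'k) set"

sublocale F: ring_rep "free_alg n" "free_act q n" AA
  by (rule free_alg_rep)

abbreviation "I1 \<equiv> Idl\<^bsub>free_alg n\<^esub> (Uq_relations q n)"

lemma Uq_relations_act: "r \<in> Uq_relations q n \<Longrightarrow> v \<in> AA \<Longrightarrow> free_act q n r v = 0"
  by (rule free_act_eq_0[OF free_act_relation_xpow[OF q]])

lemmas Uq_relations_ok = Uq_relations_carrier[OF q] Uq_relations_act

lemma Uq_rep: "ring_rep (Uq q n) (coset_act (free_act q n)) AA"
  unfolding Uq_def by (intro F.quotient_rep Uq_relations_ok)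

sublocale U: ring_rep "Uq q n" "coset_act (free_act q n)" AA
  by (rule Uq_rep)

lemma Uq_carrier: "carrier (Uq q n) = (\<lambda>a. I1 +>\<^bsub>free_alg n\<^esub> a) ` carrier (free_alg n)"
  unfolding Uq_def by (intro F.carrier_quot Uq_relations_ok)

lemma Uq_act_coset:
  "a \<in> carrier (free_alg n) \<Longrightarrow> v \<in> AA \<Longrightarrow> coset_act (free_act q n) (I1 +>\<^bsub>free_alg n\<^esub> a) v = free_act q n a v"
  by (intro F.coset_act_coset Uq_relations_ok)

lemma Uq_gen_carrier: "gen_index g \<in> {1..n - 1} \<Longrightarrow> Uq_gen q n g \<in> carrier (Uq q n)"
  unfolding Uq_gen_def Uq_carrier by (intro imageI gel_carrier)

lemma Uq_gen_act: "gen_index g \<in> {1..n - 1} \<Longrightarrow> v \<in> AA \<Longrightarrow> coset_act (free_act q n) (Uq_gen q n g) v = gact q n g v"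
  by (simp add: Uq_gen_def Uq_act_coset gel_carrier free_act_gel)

lemma Uq_gen_pow_act:
  assumes "gen_index g \<in> {1..n - 1}" "v \<in> AA"
  shows "coset_act (free_act q n) (Uq_gen q n g [^]\<^bsub>Uq q n\<^esub> (k::nat)) v = (gact q n g ^^ k) v"
proof -
  have "(coset_act (free_act q n) (Uq_gen q n g) ^^ k) v = (gact q n g ^^ k) v \<and> (gact q n g ^^ k) v \<in> AA"
    by (induction k) (auto simp: Uq_gen_act[OF assms(1)] assms(2) gact_closed)
  then show ?thesis
    using U.act_pow[OF Uq_gen_carrier[OF assms(1)] assms(2), of k] by simp
qed

lemma gact_pow_xpow:
  assumes "gen_index g \<in> {1..n - 1}"
  shows "(gact q n g ^^ k) (xpow n \<beta>) =
    scal (\<Prod>t<k. coef q g ((shift g ^^ t) \<beta>)) (xpow n ((shift g ^^ k) \<beta>))"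
  by (induction k) (auto simp: gact_xpow[OF assms] lin_ext_scal mult.commute)

text \<open>A power of a generator minus c is itself an element of the free algebra, so
  \<open>free_act_eq_0\<close> applies. The case c = 0 serves \<open>e\<close> and \<open>f\<close>,
  the case c = 1 serves \<open>K\<close>.\<close>

lemma gact_pow_zero_on_AA:
  assumes "gen_index g \<in> {1..n - 1}" "v \<in> AA"
    and "\<And>\<beta>. \<beta> \<in> Zplus n \<Longrightarrow> (gact q n g ^^ k) (xpow n \<beta>) = scal c (xpow n \<beta>)"
  shows "(gact q n g ^^ k) v = scal c v"
proof -
  have "gact q n g ^^ k = free_act q n (gel g ^ k)"
    by (induction k) (auto simp: free_act_mult free_act_gel)
  then have *: "(gact q n g ^^ k) v - scal c v = free_act q n (gel g ^ k - scal c 1) v" for v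
    by (simp add: free_act_diff free_act_scal)
  have "free_act q n (gel g ^ k - scal c 1) v = 0"
    using assms(3) by (intro free_act_eq_0[OF _ assms(2)]) (simp flip: *)
  then show ?thesis by (simp flip: *)
qed

text \<open>The l applications have coefficients [\<beta> j + 1], ..., [\<beta> j + l] at the raised
  position j, and one of these consecutive arguments is a multiple of l.\<close>

lemma EF_pow_act:
  assumes "g = gE i \<or> g = gF i" "i \<in> {1..n - 1}" "v \<in> AA"
  shows "(gact q n g ^^ l) v = 0"
proof -
  have "(gact q n g ^^ l) (xpow n \<beta>) = 0" for \<beta>
  proof -
    define j where "j = (if g = gE i then i else Suc i)"
    have step: "shift g \<gamma> j = \<gamma> j + 1" for \<gamma>
      using assms(1) by (auto simp: j_def)
    have sh: "((shift g ^^ t) \<beta>) j = \<beta> j + int t" for t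
      by (induction t) (simp_all add: step)
    \<comment> \<open>The distance from \<beta> j + 1 to the next multiple of l.\<close>
    define t where "t = nat ((- (\<beta> j + 1)) mod int l)"
    have "t < l" using l3 by (simp add: t_def nat_less_iff)
    moreover have "int l dvd \<beta> j + 1 + int t"
      using l3 by (simp add: t_def) (simp add: dvd_eq_mod_eq_0 mod_add_right_eq)
    moreover have "coef q g ((shift g ^^ t) \<beta>) = qint q (\<beta> j + int t + 1)"
      using assms(1) sh[of t] by (auto simp: j_def)
    ultimately have "\<exists>t<l. coef q g ((shift g ^^ t) \<beta>) = 0"
      using qint_0_iff by (auto simp: add_ac)
    then have "(\<Prod>t<l. coef q g ((shift g ^^ t) \<beta>)) = 0"
      by (auto simp: prod_zero_iff)
    then show ?thesis
      using assms(1,2) by (subst gact_pow_xpow) auto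
  qed
  then show ?thesis
    using gact_pow_zero_on_AA[of g v l 0] assms by auto
qed

lemma K_pow_act:
  assumes "i \<in> {1..n - 1}" "v \<in> AA"
  shows "(gact q n (gK i) ^^ (2 * l)) v = v"
proof -
  have "(gact q n (gK i) ^^ (2 * l)) (xpow n \<beta>) = xpow n \<beta>" for \<beta>
  proof -
    have sh: "(shift (gK i) ^^ t) \<beta> = \<beta>" for t
      by (induction t) auto
    have "q powi (2 * int l) = 1"
      using qint_0_iff[of "int l"] qint_eq_0_iff[OF q] by simp
    then have "(q powi (\<beta> i - \<beta> (Suc i))) ^ (2 * l) = 1"
      by (metis (no_types, lifting) mult.commute of_nat_mult of_nat_numeral power_int_1_left power_int_mult power_int_of_nat)
    then show ?thesis
      using assms(1) by (subst gact_pow_xpow) (auto simp: sh)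
  qed
  then show ?thesis
    using gact_pow_zero_on_AA[of "gK i" v "2 * l" 1] assms by auto
qed

abbreviation "I2 \<equiv> Idl\<^bsub>Uq q n\<^esub> (uq_relations q n l)"

lemma uq_relations_carrier: "uq_relations q n l \<subseteq> carrier (Uq q n)"
proof -
  have "Uq_gen q n (gE i) \<in> carrier (Uq q n)" "Uq_gen q n (gF i) \<in> carrier (Uq q n)"
    "Uq_gen q n (gK i) \<in> carrier (Uq q n)" if "i \<in> {1..n - 1}" for i
    using that by (auto intro!: Uq_gen_carrier)
  then show ?thesis
    unfolding uq_relations_def by auto
qed

lemma uq_relations_act:
  assumes "r \<in> uq_relations q n l" "v \<in> AA"
  shows "coset_act (free_act q n) r v = 0"
proof -
  from assms obtain i where i: "i \<in> {1..n - 1}" and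
    "r = Uq_gen q n (gE i) [^]\<^bsub>Uq q n\<^esub> l \<or> r = Uq_gen q n (gF i) [^]\<^bsub>Uq q n\<^esub> l \<or>
     r = (Uq_gen q n (gK i) [^]\<^bsub>Uq q n\<^esub> (2 * l)) \<ominus>\<^bsub>Uq q n\<^esub> \<one>\<^bsub>Uq q n\<^esub>"
    unfolding uq_relations_def by blast
  then consider "r = Uq_gen q n (gE i) [^]\<^bsub>Uq q n\<^esub> l" | "r = Uq_gen q n (gF i) [^]\<^bsub>Uq q n\<^esub> l"
    | "r = (Uq_gen q n (gK i) [^]\<^bsub>Uq q n\<^esub> (2 * l)) \<ominus>\<^bsub>Uq q n\<^esub> \<one>\<^bsub>Uq q n\<^esub>"
    by blast
  then show ?thesis
  proof cases
    case 1
    then show ?thesis using i assms(2) by (simp add: Uq_gen_pow_act EF_pow_act[of _ i])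
  next
    case 2
    then show ?thesis using i assms(2) by (simp add: Uq_gen_pow_act EF_pow_act[of _ i])
  next
    case 3
    have "Uq_gen q n (gK i) [^]\<^bsub>Uq q n\<^esub> (2 * l) \<in> carrier (Uq q n)"
      using i by (intro U.nat_pow_closed Uq_gen_carrier) simp
    then show ?thesis
      using 3 i assms(2) K_pow_act[OF i assms(2)]
      by (simp add: U.act_diff U.act_one Uq_gen_pow_act)
  qed
qed

lemmas uq_relations_ok = uq_relations_carrier uq_relations_act

definition uq_class :: "(gen word \<Rightarrow>\<^sub>0 'k) \<Rightarrow> (gen word \<Rightarrow>\<^sub>0 'k) set set" where
  "uq_class a = I2 +>\<^bsub>Uq q n\<^esub> (I1 +>\<^bsub>free_alg n\<^esub> a)"

lemma uq_carrier: "carrier (uq q n) = uq_class ` carrier (free_alg n)"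
proof -
  have "carrier (uq q n) = (\<lambda>b. I2 +>\<^bsub>Uq q n\<^esub> b) ` carrier (Uq q n)"
    unfolding uq_def l_def by (intro U.carrier_quot uq_relations_ok)
  then show ?thesis
    by (simp add: Uq_carrier image_image uq_class_def)
qed

lemma uq_class_act:
  assumes "a \<in> carrier (free_alg n)" "v \<in> AA"
  shows "uq_act q n (uq_class a) v = free_act q n a v"
  unfolding uq_class_def uq_act_def
proof (subst U.coset_act_coset[OF uq_relations_ok])
  show "I1 +>\<^bsub>free_alg n\<^esub> a \<in> carrier (Uq q n)"
    unfolding Uq_carrier using assms by (intro imageI)
qed (use assms Uq_act_coset in auto)

lemma uq_gen_act:
  assumes "gen_index g \<in> {1..n - 1}" "v \<in> AA"
  shows "uq_act q n (uq_gen q n g) v = gact q n g v"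
proof -
  have "uq_gen q n g = uq_class (gel g)"
    by (simp add: uq_gen_def uq_class_def Uq_gen_def l_def)
  then show ?thesis
    using assms by (simp add: uq_class_act gel_carrier free_act_gel)
qed

text \<open>Removes the cosets from every later statement about submodules.\<close>

lemma lsubmodule_iff:
  assumes "M \<subseteq> AA"
  shows "lsubmodule (uq q n) (uq_act q n) W M \<longleftrightarrow> W \<subseteq> M \<and> gen_closed q n W"
proof
  assume L: "lsubmodule (uq q n) (uq_act q n) W M"
  then have W: "W \<subseteq> M" "W \<subseteq> AA" using assms by (auto simp: lsubmodule_def)
  have cl: "free_act q n a x \<in> W" if "a \<in> carrier (free_alg n)" "x \<in> W" for a x
  proof -
    have "uq_act q n (uq_class a) x \<in> W"
      using L that by (auto simp: lsubmodule_def uq_carrier)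
    then show ?thesis using that W by (subst (asm) uq_class_act) auto
  qed
  \<comment> \<open>A scalar acts as c times the unit of the free algebra, so closure under the ring
    already makes W a subspace.\<close>
  have "scal c x \<in> W" if "x \<in> W" for c x
    using cl[OF free_alg_closed(5)[OF free_alg_zero_one(2) free_alg_zero_one(2)] that, of c]
    by (simp add: free_act_scal)
  then have "scal.subspace W"
    using L by (auto simp: lsubmodule_def scal.subspace_def)
  moreover have "gact q n g y \<in> W" if "gen_index g \<in> {1..n - 1}" "y \<in> W" for g y
    using cl[of "gel g" y] that by (simp add: free_act_gel gel_carrier)
  ultimately show "W \<subseteq> M \<and> gen_closed q n W"
    using W by (auto simp: gen_closed_def)
next
  assume W: "W \<subseteq> M \<and> gen_closed q n W"
  then have "uq_act q n (uq_class a) x \<in> W" if "a \<in> carrier (free_alg n)" "x \<in> W" for a x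
    using that assms by (subst uq_class_act) (auto intro: free_act_gen_closed)
  then show "lsubmodule (uq q n) (uq_act q n) W M"
    using W by (auto simp: lsubmodule_def uq_carrier gen_closed_def scal.subspace_def)
qed

lemma cyclic_eq:
  assumes "y \<in> AA"
  shows "uq_cyclic q n y = (\<lambda>a. free_act q n a y) ` carrier (free_alg n)"
  unfolding cyclic_submodule_def uq_carrier using uq_class_act[OF _ assms] by force

lemma gen_closed_cyclic:
  assumes "y \<in> AA"
  shows "gen_closed q n (uq_cyclic q n y)"
  unfolding gen_closed_def cyclic_eq[OF assms] scal.subspace_def
proof (intro conjI allI ballI impI)
  show "0 \<in> (\<lambda>a. free_act q n a y) ` carrier (free_alg n)"
    by (rule image_eqI[of _ _ 0]) (auto simp: free_alg_zero_one)
next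
  fix u v assume "u \<in> (\<lambda>a. free_act q n a y) ` carrier (free_alg n)" "v \<in> (\<lambda>a. free_act q n a y) ` carrier (free_alg n)"
  then show "u + v \<in> (\<lambda>a. free_act q n a y) ` carrier (free_alg n)"
    by (auto simp flip: free_act_add intro: free_alg_closed)
next
  fix c u assume "u \<in> (\<lambda>a. free_act q n a y) ` carrier (free_alg n)"
  then show "scal c u \<in> (\<lambda>a. free_act q n a y) ` carrier (free_alg n)"
    by (auto simp flip: free_act_scal intro: free_alg_closed)
next
  fix g u assume g: "gen_index g \<in> {1..n - 1}" and "u \<in> (\<lambda>a. free_act q n a y) ` carrier (free_alg n)"
  then obtain a where "a \<in> carrier (free_alg n)" "u = free_act q n a y" by blast
  with g show "gact q n g u \<in> (\<lambda>a. free_act q n a y) ` carrier (free_alg n)"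
    by (intro image_eqI[of _ _ "gel g * a"] free_alg_closed gel_carrier)
      (simp_all only: free_act_mult free_act_gel)
qed

lemma cyclic_self: "y \<in> AA \<Longrightarrow> y \<in> uq_cyclic q n y"
  unfolding cyclic_eq by (rule image_eqI[of _ _ 1]) (auto simp: free_alg_zero_one)

lemma cyclic_minimal:
  assumes "gen_closed q n W" "y \<in> W" "y \<in> AA"
  shows "uq_cyclic q n y \<subseteq> W"
  unfolding cyclic_eq[OF assms(3)] using assms by (auto intro: free_act_gen_closed)

lemma cyclic_subset_iff:
  assumes "gen_closed q n W" "y \<in> AA"
  shows "uq_cyclic q n y \<subseteq> W \<longleftrightarrow> y \<in> W"
  using assms cyclic_minimal cyclic_self by blast

lemma simple_iff:
  assumes "M \<subseteq> AA"
  shows "uq_simple q n M \<longleftrightarrow> gen_closed q n M \<and> M \<noteq> {0} \<and>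
    (\<forall>W. gen_closed q n W \<longrightarrow> W \<subseteq> M \<longrightarrow> W = {0} \<or> W = M)"
  unfolding simple_module_def lsubmodule_iff[OF assms] by auto

end

section \<open>Multi-indices and residues\<close>

text \<open>Each new entry is taken as small as the upper bounds of the others permit, which keeps
  the remaining sum within their range. This supplies the multi-indices with prescribed extreme
  entries.\<close>

lemma box_sum_exists:
  fixes lo hi :: "'a \<Rightarrow> int"
  assumes "finite I" "\<And>i. i \<in> I \<Longrightarrow> lo i \<le> hi i" "sum lo I \<le> S" "S \<le> sum hi I"
  shows "\<exists>f. (\<forall>i\<in>I. lo i \<le> f i \<and> f i \<le> hi i) \<and> (\<forall>i. i \<notin> I \<longrightarrow> f i = 0) \<and> sum f I = S"
  using assms
proof (induction I arbitrary: S)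
  case empty
  then show ?case by (intro exI[of _ "\<lambda>_. 0"]) auto
next
  case (insert x I)
  define t where "t = max (lo x) (S - sum hi I)"
  have le: "sum lo I \<le> sum hi I" using insert by (intro sum_mono) auto
  have "sum lo I \<le> S - t" "S - t \<le> sum hi I"
    using insert.prems insert.hyps le by (auto simp: t_def)
  then obtain f where f: "\<forall>i\<in>I. lo i \<le> f i \<and> f i \<le> hi i" "\<forall>i. i \<notin> I \<longrightarrow> f i = 0" "sum f I = S - t"
    using insert.IH[of "S - t"] insert.prems by auto
  have "t \<le> hi x" "lo x \<le> t"
    using insert.prems(1)[of x] insert.prems(3) insert.hyps by (auto simp: t_def)
  moreover have "(\<Sum>i\<in>I. if i = x then t else f i) = sum f I"
    using insert.hyps by (intro sum.cong) auto
  ultimately show ?case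
    using f insert.hyps by (intro exI[of _ "f(x := t)"]) auto
qed

section \<open>Moving one unit between neighbouring positions\<close>

definition tr :: "nat \<Rightarrow> nat \<Rightarrow> midx \<Rightarrow> midx" where
  "tr a b \<beta> = \<beta>(a := \<beta> a - 1, b := \<beta> b + 1)"

definition adj :: "nat \<Rightarrow> nat \<Rightarrow> nat \<Rightarrow> bool" where
  "adj n a b \<longleftrightarrow> a \<in> {1..n} \<and> b \<in> {1..n} \<and> (b = Suc a \<or> a = Suc b)"

lemma adj_neq: "adj n a b \<Longrightarrow> a \<noteq> b"
  by (auto simp: adj_def)

lemma adj_sym: "adj n a b \<Longrightarrow> adj n b a"
  by (auto simp: adj_def)

lemma adj_in: "adj n a b \<Longrightarrow> a \<in> {1..n}" "adj n a b \<Longrightarrow> b \<in> {1..n}"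
  by (auto simp: adj_def)

lemma adj_Suc: "i \<in> {1..n - 1} \<Longrightarrow> adj n (Suc i) i"
  by (auto simp: adj_def)

lemma adj_exists:
  assumes "n \<ge> 2" "a \<in> {1..n}"
  shows "\<exists>b. adj n a b"
  using assms by (intro exI[of _ "if a = 1 then 2 else a - 1"]) (auto simp: adj_def)

lemma tr_simps:
  "a \<noteq> b \<Longrightarrow> tr a b \<beta> a = \<beta> a - 1" "tr a b \<beta> b = \<beta> b + 1"
  "i \<noteq> a \<Longrightarrow> i \<noteq> b \<Longrightarrow> tr a b \<beta> i = \<beta> i"
  by (auto simp: tr_def)

lemma tr_tr: "a \<noteq> b \<Longrightarrow> tr b a (tr a b \<beta>) = \<beta>"
  by (auto simp: tr_def)

lemma tr_inj: "a \<noteq> b \<Longrightarrow> tr a b \<beta> = tr a b \<gamma> \<longleftrightarrow> \<beta> = \<gamma>"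
  by (metis tr_tr)

lemma sum_fun_upd:
  fixes f :: "nat \<Rightarrow> int"
  assumes "finite A" "a \<in> A"
  shows "sum (f(a := x)) A = sum f A - f a + x"
  using assms by (simp add: sum.remove[of A a])

lemma mabs_upd: "a \<in> {1..n} \<Longrightarrow> mabs n (\<beta>(a := x)) = mabs n \<beta> - \<beta> a + x"
  unfolding mabs_def by (rule sum_fun_upd) auto

lemma mabs_tr:
  assumes "a \<in> {1..n}" "b \<in> {1..n}" "a \<noteq> b"
  shows "mabs n (tr a b \<beta>) = mabs n \<beta>"
  unfolding tr_def using assms by (simp add: mabs_upd del: atLeastAtMost_iff)

lemma ZplusD: "\<beta> \<in> Zplus n \<Longrightarrow> 0 \<le> \<beta> i"
  by (cases "i \<in> {1..n}") (auto simp: Zplus_def)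

lemma Zplus_outside: "\<beta> \<in> Zplus n \<Longrightarrow> i \<notin> {1..n} \<Longrightarrow> \<beta> i = 0"
  by (auto simp: Zplus_def)

lemma tr_Zplus_iff:
  assumes "\<beta> \<in> Zplus n" "adj n a b"
  shows "tr a b \<beta> \<in> Zplus n \<longleftrightarrow> 0 < \<beta> a"
proof
  assume "tr a b \<beta> \<in> Zplus n"
  then have "0 \<le> tr a b \<beta> a" by (rule ZplusD)
  then show "0 < \<beta> a" using adj_neq[OF assms(2)] by (simp add: tr_simps)
next
  assume "0 < \<beta> a"
  then show "tr a b \<beta> \<in> Zplus n"
    using assms ZplusD[OF assms(1), of b] by (auto simp: Zplus_def tr_def adj_def)
qed

lemma Zplus_mabs_0:
  assumes "\<beta> \<in> Zplus n" "\<not> 0 < mabs n \<beta>" shows "\<beta> = (\<lambda>_. 0)"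
proof -
  have "mabs n \<beta> \<ge> 0" unfolding mabs_def by (intro sum_nonneg ZplusD[OF assms(1)])
  with assms(2) have "mabs n \<beta> = 0" by simp
  then have "\<forall>i\<in>{1..n}. \<beta> i = 0"
    unfolding mabs_def using ZplusD[OF assms(1)] by (subst (asm) sum_nonneg_eq_0_iff) auto
  then show ?thesis using assms(1) by (auto simp: Zplus_def fun_eq_iff)
qed

lemma Zplus_truncD:
  assumes "\<beta> \<in> Zplus_trunc n l m s"
  shows "\<beta> \<in> Zplus n" "mabs n \<beta> = s" "i \<in> {1..n} \<Longrightarrow> \<beta> i \<le> m * int l - 1"
  using assms by (auto simp: Zplus_trunc_def)

lemma Zplus_trunc_subset: "Zplus_trunc n l m s \<subseteq> Zplus n"
  by (auto simp: Zplus_trunc_def)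

lemma finite_Zplus_trunc: "finite (Zplus_trunc n l m s)"
proof (rule finite_subset)
  show "Zplus_trunc n l m s \<subseteq> {f. \<forall>x. (x \<in> {1..n} \<longrightarrow> f x \<in> {0..m * int l - 1}) \<and> (x \<notin> {1..n} \<longrightarrow> f x = 0)}"
    by (auto simp: Zplus_trunc_def Zplus_def)
qed (intro finite_set_of_finite_funs; simp)

text \<open>These are the \<open>\<beta>\<close> for which all \<open>e\<^sub>i\<close> annihilate \<open>x\<^sup>(\<^sup>\<beta>\<^sup>)\<close>.\<close>

definition primitive :: "nat \<Rightarrow> nat \<Rightarrow> midx \<Rightarrow> bool" where
  "primitive n l \<beta> \<longleftrightarrow> (\<forall>i\<in>{1..n - 1}. int l dvd \<beta> i + 1 \<or> \<beta> (Suc i) = 0)"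

text \<open>Termination measure for raising: a move from i + 1 to i lowers it by exactly 1
  (\<open>pot_tr\<close>).\<close>

definition pot :: "nat \<Rightarrow> midx \<Rightarrow> int" where
  "pot n \<beta> = (\<Sum>i=1..n. int i * \<beta> i)"

lemma pot_nonneg: "\<beta> \<in> Zplus n \<Longrightarrow> 0 \<le> pot n \<beta>"
  unfolding pot_def by (intro sum_nonneg mult_nonneg_nonneg ZplusD[of \<beta> n]) auto

lemma pot_tr:
  assumes "i \<in> {1..n - 1}"
  shows "pot n (tr (Suc i) i \<beta>) = pot n \<beta> - 1"
proof -
  have "(\<lambda>j. int j * tr (Suc i) i \<beta> j) =
      ((\<lambda>j. int j * \<beta> j)(Suc i := int (Suc i) * \<beta> (Suc i) - int (Suc i)))(i := int i * \<beta> i + int i)"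
    by (auto simp: tr_def fun_eq_iff algebra_simps)
  then have "pot n (tr (Suc i) i \<beta>) = sum (((\<lambda>j. int j * \<beta> j)(Suc i := int (Suc i) * \<beta> (Suc i) - int (Suc i)))(i := int i * \<beta> i + int i)) {1..n}"
    by (simp only: pot_def)
  also have "\<dots> = pot n \<beta> - 1"
    using assms by (subst sum_fun_upd, simp, force, subst sum_fun_upd) (auto simp: pot_def)
  finally show ?thesis .
qed

text \<open>0 < \<rho> a excludes a borrow and \<rho> b < l - 1 a carry, so such a step fixes the
  quotients; the second condition also makes its coefficient nonzero. Within residues the new
  entries satisfy the same conditions with a and b exchanged, hence
  \<open>rstep_sym\<close>.\<close>

definition rstep :: "nat \<Rightarrow> nat \<Rightarrow> midx \<Rightarrow> midx \<Rightarrow> bool" where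
  "rstep n l \<rho> \<rho>' \<longleftrightarrow> (\<exists>a b. adj n a b \<and> 0 < \<rho> a \<and> \<rho> b < int l - 1 \<and> \<rho>' = tr a b \<rho>)"

abbreviation residues :: "nat \<Rightarrow> nat \<Rightarrow> int \<Rightarrow> midx set" where
  "residues n l S \<equiv> Zplus_trunc n l 1 S"

lemma residuesD:
  assumes "\<rho> \<in> residues n l S"
  shows "0 \<le> \<rho> i" "l > 0 \<Longrightarrow> \<rho> i < int l"
proof -
  show "0 \<le> \<rho> i" using assms by (intro ZplusD) (auto dest: Zplus_truncD)
  show "l > 0 \<Longrightarrow> \<rho> i < int l"
    using Zplus_truncD(3)[OF assms, of i] Zplus_outside[OF Zplus_truncD(1)[OF assms], of i]
    by (cases "i \<in> {1..n}") auto
qed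

lemma rstep_sym:
  assumes "rstep n l \<rho> \<rho>'" "\<rho> \<in> residues n l S"
  shows "rstep n l \<rho>' \<rho>"
proof -
  obtain a b where *: "adj n a b" "0 < \<rho> a" "\<rho> b < int l - 1" "\<rho>' = tr a b \<rho>"
    using assms(1) by (auto simp: rstep_def)
  have "\<rho> a \<le> int l - 1" "0 \<le> \<rho> b"
    using Zplus_truncD(3)[OF assms(2), of a] residuesD(1)[OF assms(2), of b] adj_in[OF *(1)] by auto
  then show ?thesis
    unfolding rstep_def using * adj_neq[OF *(1)] adj_sym[OF *(1)]
    by (intro exI[of _ b] exI[of _ a]) (auto simp: tr_simps tr_tr)
qed

lemma rstep_residues:
  assumes "rstep n l \<rho> \<rho>'" "\<rho> \<in> residues n l S"
  shows "\<rho>' \<in> residues n l S"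
proof -
  obtain a b where *: "adj n a b" "0 < \<rho> a" "\<rho> b < int l - 1" "\<rho>' = tr a b \<rho>"
    using assms(1) by (auto simp: rstep_def)
  have "tr a b \<rho> \<in> Zplus n"
    using * assms(2) by (auto simp: tr_Zplus_iff dest: Zplus_truncD)
  moreover have "tr a b \<rho> i \<le> int l - 1" if "i \<in> {1..n}" for i
    using Zplus_truncD(3)[OF assms(2) that] * by (auto simp: tr_def)
  ultimately show ?thesis
    using * assms(2) mabs_tr[OF adj_in[OF *(1)] adj_neq[OF *(1)], of \<rho>]
    by (auto simp: Zplus_trunc_def)
qed

lemma residue_dvd_iff:
  assumes "\<rho> \<in> residues n l S" "l > 0"
  shows "int l dvd \<rho> i + 1 \<longleftrightarrow> \<rho> i = int l - 1"
proof
  assume "int l dvd \<rho> i + 1"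
  then have "int l \<le> \<rho> i + 1" using residuesD(1)[OF assms(1), of i] by (intro zdvd_imp_le) auto
  then show "\<rho> i = int l - 1" using residuesD(2)[OF assms, of i] by simp
qed auto

text \<open>A residue that is not primitive admits a move from i + 1 to i, which is an
  \<open>rstep\<close>, can be undone, and lowers \<open>pot\<close>.\<close>

lemma reach_primitive:
  assumes "\<rho> \<in> residues n l S" "l > 0"
  shows "\<exists>\<rho>'\<in>residues n l S. primitive n l \<rho>' \<and> (rstep n l)\<^sup>*\<^sup>* \<rho> \<rho>' \<and> (rstep n l)\<^sup>*\<^sup>* \<rho>' \<rho>"
  using assms(1)
proof (induction "nat (pot n \<rho>)" arbitrary: \<rho> rule: less_induct)
  case less
  show ?case
  proof (cases "primitive n l \<rho>")
    case True
    then show ?thesis using less.prems by auto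
  next
    case False
    then obtain i where i: "i \<in> {1..n - 1}" "\<not> int l dvd \<rho> i + 1" "\<rho> (Suc i) \<noteq> 0"
      unfolding primitive_def by blast
    let ?\<rho> = "tr (Suc i) i \<rho>"
    have st: "rstep n l \<rho> ?\<rho>"
      unfolding rstep_def using i adj_Suc[OF i(1)] residuesD[OF less.prems, of i] residuesD[OF less.prems, of "Suc i"]
        assms(2) residue_dvd_iff[OF less.prems assms(2), of i]
      by (intro exI[of _ "Suc i"] exI[of _ i]) auto
    have R: "?\<rho> \<in> residues n l S"
      by (rule rstep_residues[OF st less.prems])
    have "nat (pot n ?\<rho>) < nat (pot n \<rho>)"
      using pot_tr[OF i(1), of \<rho>] pot_nonneg[OF Zplus_truncD(1)[OF R]] by linarith
    from less.hyps[OF this R] obtain \<rho>' where "\<rho>' \<in> residues n l S" "primitive n l \<rho>'"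
      "(rstep n l)\<^sup>*\<^sup>* ?\<rho> \<rho>'" "(rstep n l)\<^sup>*\<^sup>* \<rho>' ?\<rho>" by blast
    then show ?thesis
      using st rstep_sym[OF st less.prems]
      by (meson converse_rtranclp_into_rtranclp rtranclp.rtrancl_into_rtrancl)
  qed
qed

text \<open>After an entry below l - 1 primitivity forces a 0, which is again below l - 1 because l
  > 1, and so on to the end.\<close>

lemma primitive_tail:
  assumes "primitive n l \<rho>" "\<rho> \<in> residues n l S" "l > 1" "1 \<le> p" "p < i" "i \<le> n" "\<rho> p < int l - 1"
  shows "\<rho> i = 0"
  using assms(5,6)
proof (induction i)
  case (Suc i)
  have "\<rho> i \<noteq> int l - 1"
    using Suc assms(3,7) by (cases "i = p") auto
  then have "\<not> int l dvd \<rho> i + 1"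
    using residue_dvd_iff[OF assms(2), of i] assms(3) by simp
  moreover have "i \<in> {1..n - 1}"
    using Suc.prems assms(4) by auto
  ultimately show ?case
    using assms(1) by (auto simp: primitive_def)
qed simp

text \<open>The residue that is smaller at the first difference p is below l - 1 there, hence 0
  afterwards. It is then dominated entry by entry, and the sums differ. The roles are asymmetric, so
  \<open>primitive_unique\<close> uses it in both orders.\<close>

lemma primitive_unique_aux:
  assumes "primitive n l \<rho>" "\<rho> \<in> residues n l S" "\<rho>' \<in> residues n l S" "l > 1"
    "1 \<le> p" "p \<le> n" "\<And>i. i < p \<Longrightarrow> \<rho> i = \<rho>' i" "\<rho> p < \<rho>' p"
  shows False
proof -
  have "\<rho> p < int l - 1"
    using assms(8) residuesD(2)[OF assms(3), of p] assms(4) by auto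
  then have "\<rho> i \<le> \<rho>' i" if "i \<in> {1..n}" for i
    using primitive_tail[OF assms(1,2,4,5), of i] assms(7)[of i] assms(8) residuesD(1)[OF assms(3), of i] that
    by (cases i p rule: linorder_cases) auto
  then have "mabs n \<rho> < mabs n \<rho>'"
    unfolding mabs_def using assms by (intro sum_strict_mono_ex1) auto
  then show False
    using Zplus_truncD(2)[OF assms(2)] Zplus_truncD(2)[OF assms(3)] by simp
qed

lemma primitive_unique:
  assumes "primitive n l \<rho>" "\<rho> \<in> residues n l S" "primitive n l \<rho>'" "\<rho>' \<in> residues n l S" "l > 1"
  shows "\<rho> = \<rho>'"
proof (rule ccontr)
  assume "\<rho> \<noteq> \<rho>'"
  then have ex: "\<exists>i. \<rho> i \<noteq> \<rho>' i" by auto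
  define p where "p = (LEAST i. \<rho> i \<noteq> \<rho>' i)"
  have p: "\<rho> p \<noteq> \<rho>' p" unfolding p_def by (rule LeastI_ex[OF ex])
  have less: "\<rho> i = \<rho>' i" if "i < p" for i using not_less_Least that p_def by blast
  have "p \<in> {1..n}"
    using p Zplus_outside[OF Zplus_truncD(1)[OF assms(2)]] Zplus_outside[OF Zplus_truncD(1)[OF assms(4)]] by metis
  then show False
    using primitive_unique_aux[OF assms(1,2,4,5), of p] primitive_unique_aux[OF assms(3,4,2,5), of p] p less
    by (cases "\<rho> p < \<rho>' p") auto
qed

lemma residues_connected:
  assumes "\<rho> \<in> residues n l S" "\<rho>' \<in> residues n l S" "l > 1"
  shows "(rstep n l)\<^sup>*\<^sup>* \<rho> \<rho>'"
proof -
  obtain \<sigma> where \<sigma>: "\<sigma> \<in> residues n l S" "primitive n l \<sigma>" "(rstep n l)\<^sup>*\<^sup>* \<rho> \<sigma>"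
    using reach_primitive[OF assms(1)] assms(3) by auto
  obtain \<sigma>' where \<sigma>': "\<sigma>' \<in> residues n l S" "primitive n l \<sigma>'" "(rstep n l)\<^sup>*\<^sup>* \<sigma>' \<rho>'"
    using reach_primitive[OF assms(2)] assms(3) by auto
  have "\<sigma> = \<sigma>'" using primitive_unique \<sigma> \<sigma>' assms(3) by blast
  then show ?thesis using \<sigma>(3) \<sigma>'(3) by simp
qed

section \<open>Quotients and residues modulo l\<close>

definition comb :: "nat \<Rightarrow> midx \<Rightarrow> midx \<Rightarrow> midx" where
  "comb l \<kappa> \<rho> = (\<lambda>i. int l * \<kappa> i + \<rho> i)"

definition quo :: "nat \<Rightarrow> midx \<Rightarrow> midx" where "quo l \<beta> = (\<lambda>i. \<beta> i div int l)"
definition rem :: "nat \<Rightarrow> midx \<Rightarrow> midx" where "rem l \<beta> = (\<lambda>i. \<beta> i mod int l)"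

lemma comb_quo_rem: "comb l (quo l \<beta>) (rem l \<beta>) = \<beta>"
  by (simp add: comb_def quo_def rem_def)

lemma quo_comb: "\<rho> \<in> residues n l S \<Longrightarrow> l > 0 \<Longrightarrow> quo l (comb l \<kappa> \<rho>) = \<kappa>"
  using residuesD[of \<rho> n l S] by (auto simp: quo_def comb_def fun_eq_iff)

lemma rem_comb: "\<rho> \<in> residues n l S \<Longrightarrow> l > 0 \<Longrightarrow> rem l (comb l \<kappa> \<rho>) = \<rho>"
  using residuesD[of \<rho> n l S] by (auto simp: rem_def comb_def fun_eq_iff)

lemma mabs_comb: "mabs n (comb l \<kappa> \<rho>) = int l * mabs n \<kappa> + mabs n \<rho>"
  by (simp add: mabs_def comb_def sum.distrib sum_distrib_left)

lemma Edeg_idx_eq: "Edeg_idx n l \<beta> = mabs n (quo l \<beta>)"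
  by (simp add: Edeg_idx_def mabs_def quo_def)

lemma tr_comb: "tr a b (comb l \<kappa> \<rho>) = comb l \<kappa> (tr a b \<rho>)"
  by (auto simp: tr_def comb_def fun_eq_iff)

text \<open>The same truncated set serves twice: m = 1 turns its bound m l - 1 into the residue
  bound l - 1, and l = 1 turns it into the energy bound m - 1.\<close>

abbreviation energies :: "nat \<Rightarrow> int \<Rightarrow> int \<Rightarrow> midx set" where
  "energies n m E \<equiv> Zplus_trunc n 1 m E"

lemma comb_mem:
  assumes "\<kappa> \<in> energies n m E" "\<rho> \<in> residues n l S" "l > 0"
  shows "comb l \<kappa> \<rho> \<in> Zplus_trunc n l m (int l * E + S)"
proof -
  have "comb l \<kappa> \<rho> \<in> Zplus n"
    using Zplus_truncD(1)[OF assms(1)] Zplus_truncD(1)[OF assms(2)] by (auto simp: Zplus_def comb_def)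
  moreover have "comb l \<kappa> \<rho> i \<le> m * int l - 1" if "i \<in> {1..n}" for i
  proof -
    have "\<kappa> i \<le> m - 1" "\<rho> i \<le> int l - 1"
      using Zplus_truncD(3)[OF assms(1) that] Zplus_truncD(3)[OF assms(2) that] by auto
    moreover from this(1) have "int l * \<kappa> i \<le> int l * (m - 1)" by (intro mult_left_mono) auto
    ultimately show ?thesis by (simp add: comb_def algebra_simps)
  qed
  ultimately show ?thesis
    using assms by (auto simp: Zplus_trunc_def mabs_comb)
qed

lemma quo_rem_mem:
  assumes "\<beta> \<in> Zplus_trunc n l m s" "l > 0"
  shows "quo l \<beta> \<in> energies n m (Edeg_idx n l \<beta>)" "rem l \<beta> \<in> residues n l (s - int l * Edeg_idx n l \<beta>)"
proof -
  note b = Zplus_truncD[OF assms(1)]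
  have "\<beta> i div int l \<le> m - 1" if "i \<in> {1..n}" for i
  proof -
    have "\<beta> i < m * int l" using b(3)[OF that] by simp
    moreover have "\<beta> i div int l * int l \<le> \<beta> i"
      using assms(2) by (simp add: minus_mod_eq_div_mult[symmetric])
    ultimately have "\<beta> i div int l * int l < m * int l" by linarith
    then show ?thesis using assms(2) by (simp add: mult_less_cancel_right)
  qed
  then show "quo l \<beta> \<in> energies n m (Edeg_idx n l \<beta>)"
    using b(1) assms(2) by (auto simp: Zplus_trunc_def Edeg_idx_eq Zplus_def quo_def pos_imp_zdiv_nonneg_iff)
  have "s = int l * Edeg_idx n l \<beta> + mabs n (rem l \<beta>)"
    using b(2) mabs_comb[of n l "quo l \<beta>" "rem l \<beta>"] by (simp add: comb_quo_rem Edeg_idx_eq)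
  then show "rem l \<beta> \<in> residues n l (s - int l * Edeg_idx n l \<beta>)"
    using b(1) assms(2) by (auto simp: Zplus_trunc_def Zplus_def rem_def)
qed

lemma mabs_const_bound:
  assumes "\<rho> \<in> Zplus_trunc n l m S"
  shows "S \<le> int n * (m * int l - 1)" "0 \<le> S"
proof -
  have "mabs n \<rho> \<le> (\<Sum>i=1..n. m * int l - 1)"
    unfolding mabs_def by (intro sum_mono Zplus_truncD(3)[OF assms]) auto
  then show "S \<le> int n * (m * int l - 1)" using Zplus_truncD(2)[OF assms] by simp
  show "0 \<le> S" unfolding Zplus_truncD(2)[OF assms, symmetric] mabs_def
    by (intro sum_nonneg ZplusD[OF Zplus_truncD(1)[OF assms]])
qed

lemma Zplus_trunc_exists:
  assumes "0 \<le> m * int l - 1" "0 \<le> S" "S \<le> int n * (m * int l - 1)"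
  shows "Zplus_trunc n l m S \<noteq> {}"
proof -
  obtain f where "\<forall>i\<in>{1..n}. 0 \<le> f i \<and> f i \<le> m * int l - 1" "\<forall>i. i \<notin> {1..n} \<longrightarrow> f i = 0" "sum f {1..n} = S"
    using box_sum_exists[of "{1..n}" "\<lambda>_. 0" "\<lambda>_. m * int l - 1" S] assms by auto
  then have "f \<in> Zplus_trunc n l m S"
    by (auto simp: Zplus_trunc_def Zplus_def mabs_def)
  then show ?thesis by auto
qed

text \<open>n (l - 1) - l is the sum of the upper bounds 0 at a, l - 2 at b and l - 1 elsewhere.
  From such a residue the move from a to b borrows from the energy at a.\<close>

lemma residues_exists_low:
  assumes "a \<in> {1..n}" "b \<in> {1..n}" "a \<noteq> b" "l > 1" "0 \<le> S" "S \<le> int n * (int l - 1) - int l"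
  shows "\<exists>\<rho>\<in>residues n l S. \<rho> a = 0 \<and> \<rho> b < int l - 1"
proof -
  define hi where "hi = ((\<lambda>i::nat. int l - 1)(a := 0))(b := int l - 2)"
  have "sum hi {1..n} = int n * (int l - 1) - int l"
    unfolding hi_def using assms by (subst sum_fun_upd, simp, simp, subst sum_fun_upd) auto
  moreover have "0 \<le> hi i" for i
    using assms(4) by (simp add: hi_def)
  ultimately obtain f where f: "\<forall>i\<in>{1..n}. 0 \<le> f i \<and> f i \<le> hi i" "\<forall>i. i \<notin> {1..n} \<longrightarrow> f i = 0" "sum f {1..n} = S"
    using box_sum_exists[of "{1..n}" "\<lambda>_. 0" hi S] assms(5,6) by auto
  have "f i \<le> int l - 1" if "i \<in> {1..n}" for i
    using f(1)[rule_format, OF that] assms(4) by (auto simp: hi_def split: if_splits)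
  then have "f \<in> residues n l S"
    using f by (auto simp: Zplus_trunc_def Zplus_def mabs_def)
  moreover have "f a = 0" "f b < int l - 1"
    using f(1)[rule_format, OF assms(1)] f(1)[rule_format, OF assms(2)] assms(3) by (auto simp: hi_def)
  ultimately show ?thesis by blast
qed

text \<open>l = (l - 1) + 1 is the sum of the lower bounds. Such a residue is the endpoint of an
  energy drop from a to b, so the drop can be traced back from it.\<close>

lemma residues_exists_high:
  assumes "a \<in> {1..n}" "b \<in> {1..n}" "a \<noteq> b" "l > 1" "int l \<le> S" "S \<le> int n * (int l - 1)"
  shows "\<exists>\<rho>\<in>residues n l S. \<rho> a = int l - 1 \<and> 0 < \<rho> b"
proof -
  define lo where "lo = ((\<lambda>i::nat. 0::int)(a := int l - 1))(b := 1)"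
  have "sum lo {1..n} = int l"
    unfolding lo_def using assms by (subst sum_fun_upd, simp, simp, subst sum_fun_upd) auto
  moreover have "lo i \<le> int l - 1" for i
    using assms(4) by (simp add: lo_def)
  ultimately obtain f where f: "\<forall>i\<in>{1..n}. lo i \<le> f i \<and> f i \<le> int l - 1" "\<forall>i. i \<notin> {1..n} \<longrightarrow> f i = 0" "sum f {1..n} = S"
    using box_sum_exists[of "{1..n}" lo "\<lambda>_. int l - 1" S] assms(5,6) by auto
  have "0 \<le> f i" if "i \<in> {1..n}" for i
    using f(1)[rule_format, OF that] assms(4) by (auto simp: lo_def split: if_splits)
  then have "f \<in> residues n l S"
    using f by (auto simp: Zplus_trunc_def Zplus_def mabs_def)
  moreover have "f a = int l - 1" "0 < f b"
    using f(1)[rule_format, OF assms(1)] f(1)[rule_format, OF assms(2)] assms(3) by (auto simp: lo_def)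
  ultimately show ?thesis by blast
qed

section \<open>Transfer operators\<close>

text \<open>With this naming \<open>e\<^sub>i\<close> and \<open>f\<^sub>i\<close> obey one formula: the move from \<open>a\<close> to its neighbour \<open>b\<close> has
  coefficient \<open>[\<beta> b + 1]\<close>.\<close>

definition trgen :: "nat \<Rightarrow> nat \<Rightarrow> gen" where
  "trgen a b = (if b < a then gE b else gF a)"

lemma trgen_index: "adj n a b \<Longrightarrow> gen_index (trgen a b) \<in> {1..n - 1}"
  by (auto simp: trgen_def adj_def)

lemma trgen_shift: "adj n a b \<Longrightarrow> shift (trgen a b) \<beta> = tr a b \<beta>"
  by (auto simp: trgen_def adj_def tr_def fun_upd_twist)

lemma trgen_coef: "adj n a b \<Longrightarrow> coef q (trgen a b) \<beta> = qint q (\<beta> b + 1)"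
  by (auto simp: trgen_def adj_def)

abbreviation tact :: "'k::field \<Rightarrow> nat \<Rightarrow> nat \<Rightarrow> nat \<Rightarrow> (midx \<Rightarrow>\<^sub>0 'k) \<Rightarrow> (midx \<Rightarrow>\<^sub>0 'k)" where
  "tact q n a b \<equiv> gact q n (trgen a b)"

text \<open>Injectivity of \<open>tr a b\<close> lets at most one term contribute to each
  coefficient of the image, so terms never cancel. Hence a vector killed by a move has each of its
  terms killed.\<close>

lemma lookup_tact:
  assumes "adj n a b"
  shows "Poly_Mapping.lookup (tact q n a b y) (tr a b \<beta>) =
    (if tr a b \<beta> \<in> Zplus n then qint q (\<beta> b + 1) * Poly_Mapping.lookup y \<beta> else 0)"
proof -
  have "Poly_Mapping.lookup (tact q n a b y) (tr a b \<beta>) =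
    (\<Sum>\<gamma>\<in>Poly_Mapping.keys y. if \<gamma> = \<beta> then
       (if tr a b \<beta> \<in> Zplus n then qint q (\<beta> b + 1) * Poly_Mapping.lookup y \<beta> else 0) else 0)"
    unfolding lin_ext_def lookup_sum
    by (intro sum.cong refl)
      (auto simp: basis_act_eq trgen_shift[OF assms] trgen_coef[OF assms] xpow_def lookup_single when_def
        tr_inj[OF adj_neq[OF assms]])
  then show ?thesis
    by (auto simp: in_keys_iff)
qed

lemma keys_gact:
  assumes "\<gamma> \<in> Poly_Mapping.keys (gact q n g y)"
  obtains \<beta> where "\<beta> \<in> Poly_Mapping.keys y" "\<gamma> = shift g \<beta>" "coef q g \<beta> \<noteq> 0" "shift g \<beta> \<in> Zplus n"
proof -
  have "\<gamma> \<in> (\<Union>\<beta>\<in>Poly_Mapping.keys y. Poly_Mapping.keys (scal (Poly_Mapping.lookup y \<beta>) (basis_act q n g \<beta>)))"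
    by (rule subsetD[OF keys_sum assms[unfolded lin_ext_def]])
  then obtain \<beta> where b: "\<beta> \<in> Poly_Mapping.keys y"
    "\<gamma> \<in> Poly_Mapping.keys (scal (Poly_Mapping.lookup y \<beta>) (basis_act q n g \<beta>))"
    by blast
  then have "coef q g \<beta> \<noteq> 0" "\<gamma> = shift g \<beta>" "shift g \<beta> \<in> Zplus n"
    by (auto simp: basis_act_eq xpow_def in_keys_iff lookup_single when_def split: if_splits)
  then show ?thesis using that b(1) by blast
qed

lemma keys_tact:
  assumes "\<gamma> \<in> Poly_Mapping.keys (tact q n a b y)" "adj n a b"
  obtains \<beta> where "\<beta> \<in> Poly_Mapping.keys y" "\<gamma> = tr a b \<beta>" "qint q (\<beta> b + 1) \<noteq> 0" "tr a b \<beta> \<in> Zplus n"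
  using keys_gact[OF assms(1)] trgen_shift[OF assms(2)] trgen_coef[OF assms(2)] by metis

lemma keys_tact_iff:
  assumes "adj n a b"
  shows "tr a b \<beta> \<in> Poly_Mapping.keys (tact q n a b y) \<longleftrightarrow>
    tr a b \<beta> \<in> Zplus n \<and> qint q (\<beta> b + 1) \<noteq> 0 \<and> \<beta> \<in> Poly_Mapping.keys y"
  using lookup_tact[OF assms, of q y \<beta>] by (auto simp: in_keys_iff)

lemma trgen_cases:
  assumes "gen_index g \<in> {1..n - 1}"
  obtains a b where "g = trgen a b" "adj n a b" | "\<And>\<beta>. shift g \<beta> = \<beta>"
proof (cases g)
  case (gE i)
  then have "g = trgen (Suc i) i" "adj n (Suc i) i" using assms by (auto simp: trgen_def adj_def)
  then show ?thesis using that by blast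
next
  case (gF i)
  then have "g = trgen i (Suc i)" "adj n i (Suc i)" using assms by (auto simp: trgen_def adj_def)
  then show ?thesis using that by blast
qed (use that(2) in simp_all)

text \<open>\<open>K\<close> and its inverse fix every index, which leaves the moves between
  neighbours.\<close>

lemma gen_closed_keyspan:
  fixes q :: "'k::field"
  assumes "\<And>\<beta> a b. \<beta> \<in> B \<Longrightarrow> adj n a b \<Longrightarrow> tr a b \<beta> \<in> Zplus n \<Longrightarrow> qint q (\<beta> b + 1) \<noteq> 0 \<Longrightarrow> tr a b \<beta> \<in> B"
  shows "gen_closed q n (keyspan B)"
  unfolding gen_closed_def
proof (intro conjI keyspan_subspace allI impI ballI)
  fix g and y :: "midx \<Rightarrow>\<^sub>0 'k" assume g: "gen_index g \<in> {1..n - 1}" and y: "y \<in> keyspan B"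
  show "gact q n g y \<in> keyspan B"
    unfolding keyspan_def
  proof (intro CollectI subsetI)
    fix \<gamma> assume \<gamma>: "\<gamma> \<in> Poly_Mapping.keys (gact q n g y)"
    from g show "\<gamma> \<in> B"
    proof (cases rule: trgen_cases)
      case (1 a b)
      with \<gamma> obtain \<beta> where "\<beta> \<in> Poly_Mapping.keys y" "\<gamma> = tr a b \<beta>" "qint q (\<beta> b + 1) \<noteq> 0" "tr a b \<beta> \<in> Zplus n"
        by (auto elim: keys_tact)
      then show ?thesis using assms[of \<beta> a b] y 1 by (auto simp: keyspan_def)
    next
      case 2
      from \<gamma> obtain \<beta> where "\<beta> \<in> Poly_Mapping.keys y" "\<gamma> = shift g \<beta>"
        by (rule keys_gact)
      then show ?thesis using y 2 by (auto simp: keyspan_def)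
    qed
  qed
qed

section \<open>Sums of subspaces\<close>

lemma module_sum_subspace:
  assumes "\<And>i. i \<in> I \<Longrightarrow> scal.subspace (V i)"
  shows "scal.subspace (module_sum I V)"
  unfolding scal.subspace_def
proof (intro conjI ballI allI)
  show "0 \<in> module_sum I V"
    unfolding module_sum_def by (intro CollectI exI[of _ "{}"]) auto
next
  fix x y assume "x \<in> module_sum I V" "y \<in> module_sum I V"
  then obtain J f K g where J: "x = sum f J" "finite J" "J \<subseteq> I" "\<forall>i\<in>J. f i \<in> V i"
    and K: "y = sum g K" "finite K" "K \<subseteq> I" "\<forall>i\<in>K. g i \<in> V i"
    unfolding module_sum_def by blast
  let ?f = "\<lambda>i. if i \<in> J then f i else 0" and ?g = "\<lambda>i. if i \<in> K then g i else 0"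
  have "x = sum ?f (J \<union> K)" "y = sum ?g (J \<union> K)"
    unfolding J(1) K(1) using J(2) K(2) by (auto intro!: sum.mono_neutral_cong_left)
  then have "x + y = (\<Sum>i\<in>J \<union> K. ?f i + ?g i)" by (simp only: sum.distrib)
  moreover have "?f i + ?g i \<in> V i" if "i \<in> J \<union> K" for i
    using assms[of i] that J K by (intro scal.subspace_add) (auto intro: scal.subspace_0)
  ultimately show "x + y \<in> module_sum I V"
    unfolding module_sum_def using J K by (intro CollectI exI[of _ "J \<union> K"] exI[of _ "\<lambda>i. ?f i + ?g i"]) blast
next
  fix c x assume "x \<in> module_sum I V"
  then obtain J f where J: "x = sum f J" "finite J" "J \<subseteq> I" "\<forall>i\<in>J. f i \<in> V i"
    unfolding module_sum_def by blast
  then have "scal c x = (\<Sum>i\<in>J. scal c (f i))" by (simp add: scal.scale_sum_right)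
  then show "scal c x \<in> module_sum I V"
    unfolding module_sum_def using J assms
    by (intro CollectI exI[of _ J] exI[of _ "\<lambda>i. scal c (f i)"]) (auto intro: scal.subspace_scale)
qed

lemma module_sum_member: "i \<in> I \<Longrightarrow> x \<in> V i \<Longrightarrow> x \<in> module_sum I V"
  unfolding module_sum_def by (intro CollectI exI[of _ "{i}"] exI[of _ "\<lambda>_. x"]) auto

lemma module_sum_least:
  assumes "scal.subspace W" "\<And>i. i \<in> I \<Longrightarrow> V i \<subseteq> W"
  shows "module_sum I V \<subseteq> W"
  using assms unfolding module_sum_def by (auto intro!: scal.subspace_sum)

lemma keyspan_mono: "B \<subseteq> C \<Longrightarrow> keyspan B \<subseteq> keyspan C"
  by (auto simp: keyspan_def)

lemma keyspan_disjoint: "B \<inter> C = {} \<Longrightarrow> keyspan B \<inter> keyspan C = {0}"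
  unfolding keyspan_def by (auto simp flip: keys_eq_empty) blast

context quantum_param
begin

lemma l_pos: "l > 0" "l > 1" using l3 by auto

text \<open>Take a nonzero vector of W whose largest \<open>pot\<close> is least. A move from i + 1
  to i lowers \<open>pot\<close> on every term, so its result must be 0; since terms do not cancel,
  it kills each term separately, which is primitivity.\<close>

lemma primitive_vector_exists:
  assumes W: "gen_closed q n W" "W \<subseteq> AA" and y: "y \<in> W" "y \<noteq> 0"
  shows "\<exists>y\<in>W. y \<noteq> 0 \<and> (\<forall>\<beta>\<in>Poly_Mapping.keys y. primitive n l \<beta>)"
proof -
  define P where "P = (\<lambda>k::nat. \<exists>y\<in>W. y \<noteq> 0 \<and> (\<forall>\<beta>\<in>Poly_Mapping.keys y. pot n \<beta> \<le> int k))"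
  have "pot n \<beta> \<le> Max (pot n ` Poly_Mapping.keys y)" if "\<beta> \<in> Poly_Mapping.keys y" for \<beta>
    using that by (intro Max_ge) auto
  then have "pot n \<beta> \<le> int (nat (Max (pot n ` Poly_Mapping.keys y)))" if "\<beta> \<in> Poly_Mapping.keys y" for \<beta>
    using that by (smt (verit) int_nat_eq)
  then have "P (nat (Max (pot n ` Poly_Mapping.keys y)))"
    unfolding P_def using y by blast
  then have Pk: "P (LEAST k. P k)" by (rule LeastI)
  define k where "k = (LEAST k. P k)"
  obtain z where z: "z \<in> W" "z \<noteq> 0" "\<forall>\<beta>\<in>Poly_Mapping.keys z. pot n \<beta> \<le> int k"
    using Pk unfolding P_def k_def by blast
  have "primitive n l \<beta>" if b: "\<beta> \<in> Poly_Mapping.keys z" for \<beta>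
    unfolding primitive_def
  proof (intro ballI, rule ccontr)
    fix i assume i: "i \<in> {1..n - 1}" and "\<not> (int l dvd \<beta> i + 1 \<or> \<beta> (Suc i) = 0)"
    then have nd: "qint q (\<beta> i + 1) \<noteq> 0" "\<beta> (Suc i) \<noteq> 0" by (auto simp: qint_0_iff)
    have bZ: "\<beta> \<in> Zplus n" using b z(1) W(2) by (auto simp: keyspan_def)
    have ad: "adj n (Suc i) i" using i by (rule adj_Suc)
    have trZ: "tr (Suc i) i \<beta> \<in> Zplus n"
      using tr_Zplus_iff[OF bZ ad] ZplusD[OF bZ, of "Suc i"] nd(2) by simp
    let ?z = "tact q n (Suc i) i z"
    have key: "tr (Suc i) i \<beta> \<in> Poly_Mapping.keys ?z"
      using keys_tact_iff[OF ad] trZ nd b by blast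
    have less: "pot n \<gamma> \<le> int k - 1" if "\<gamma> \<in> Poly_Mapping.keys ?z" for \<gamma>
      using keys_tact[OF that ad] pot_tr[OF i] z(3) by (metis diff_mono order_refl)
    have "0 \<le> pot n (tr (Suc i) i \<beta>)" by (rule pot_nonneg[OF trZ])
    with less[OF key] have "k \<ge> 1" by simp
    then have "P (k - 1)"
      unfolding P_def using key less gen_closed_gact[OF W(1) trgen_index[OF ad] z(1)]
      by (intro bexI[of _ ?z]) auto
    then have "k \<le> k - 1" unfolding k_def by (rule Least_le)
    with \<open>k \<ge> 1\<close> show False by simp
  qed
  then show ?thesis using z by blast
qed

text \<open>Entry b does not carry, because its residue is not l - 1, and entry a can at most
  borrow.\<close>

lemma step_quo_le:
  assumes "\<not> int l dvd \<beta> b + 1" "a \<noteq> b"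
  shows "quo l (tr a b \<beta>) i \<le> quo l \<beta> i"
proof -
  have "(\<beta> b + 1) div int l = \<beta> b div int l"
  proof (rule int_div_pos_eq)
    show eq: "\<beta> b + 1 = int l * (\<beta> b div int l) + (\<beta> b mod int l + 1)"
      by (simp add: mult_div_mod_eq)
    have "\<beta> b mod int l + 1 \<noteq> int l"
    proof
      assume "\<beta> b mod int l + 1 = int l"
      then have "\<beta> b + 1 = int l * (\<beta> b div int l + 1)" using eq by (simp add: distrib_left)
      then show False using assms(1) by simp
    qed
    moreover have "\<beta> b mod int l < int l" "0 \<le> \<beta> b mod int l" using l_pos by auto
    ultimately show "\<beta> b mod int l + 1 < int l" "0 \<le> \<beta> b mod int l + 1" by linarith+
  qed
  then show ?thesis
    using assms(2) l_pos by (cases "i = a"; cases "i = b") (auto simp: quo_def tr_simps intro!: zdiv_mono1)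
qed

end

section \<open>Blocks of minimal energy\<close>

locale truncated = quantum_param q n l
    for q :: "'k::field" and n l :: nat +
  fixes m s :: int
  assumes m1: "m \<ge> 1" and s0: "0 \<le> s" and sN: "s \<le> int n * (m * int l - 1)"
begin

abbreviation "T \<equiv> Zplus_trunc n l m s"
abbreviation "E0 \<equiv> Emin n l m s"
abbreviation "B0 \<equiv> {\<beta>\<in>T. Edeg_idx n l \<beta> = E0}"
abbreviation "Blk \<beta> \<equiv> {\<gamma>\<in>T. quo l \<gamma> = quo l \<beta>}"

lemma T_nonempty: "T \<noteq> {}"
  using Zplus_trunc_exists[of m l s n] m1 l3 s0 sN mult_mono[of 1 m 1 "int l"] by fastforce

lemma E0_attained: obtains \<beta> where "\<beta> \<in> T" "Edeg_idx n l \<beta> = E0"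
proof -
  have "Emin n l m s \<in> Edeg_idx n l ` T"
    unfolding Emin_def using T_nonempty by (intro Min_in) (auto simp: finite_Zplus_trunc)
  then show ?thesis using that by auto
qed

lemma E0_le: "\<beta> \<in> T \<Longrightarrow> E0 \<le> Edeg_idx n l \<beta>"
  unfolding Emin_def by (intro Min_le) (auto simp: finite_Zplus_trunc)

lemma T_AA: "keyspan T \<subseteq> AA"
  by (intro keyspan_mono Zplus_trunc_subset)

lemma Aq_eq: "Aq q n m s = keyspan T"
  unfolding Aq_def l_def by (rule span_xpow[OF Zplus_trunc_subset])

text \<open>The bound m l - 1 is congruent to -1 modulo l: growth beyond it would have the
  coefficient [m l] = 0. This is why the truncation is a submodule.\<close>

lemma step_T:
  assumes "\<beta> \<in> T" "adj n a b" "tr a b \<beta> \<in> Zplus n" "qint q (\<beta> b + 1) \<noteq> 0"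
  shows "tr a b \<beta> \<in> T"
proof -
  note b = Zplus_truncD[OF assms(1)]
  have "\<not> int l dvd \<beta> b + 1" using assms(4) by (simp add: qint_0_iff)
  then have "\<beta> b + 1 \<noteq> m * int l" by auto
  moreover have "\<beta> b \<le> m * int l - 1" using b(3)[OF adj_in(2)[OF assms(2)]] .
  ultimately have "\<beta> b + 1 \<le> m * int l - 1" by linarith
  then have "tr a b \<beta> i \<le> m * int l - 1" if "i \<in> {1..n}" for i
    using b(3)[OF that] by (auto simp: tr_def)
  then show ?thesis
    using assms(3) b(2) mabs_tr[OF adj_in[OF assms(2)] adj_neq[OF assms(2)], of \<beta>] by (auto simp: Zplus_trunc_def)
qed

lemma step_Edeg_le:
  assumes "qint q (\<beta> b + 1) \<noteq> 0" "adj n a b"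
  shows "Edeg_idx n l (tr a b \<beta>) \<le> Edeg_idx n l \<beta>"
  unfolding Edeg_idx_eq mabs_def
  using assms by (intro sum_mono step_quo_le) (auto simp: qint_0_iff adj_neq)

lemma gen_closed_T: "gen_closed q n (keyspan T)"
  by (intro gen_closed_keyspan step_T)

lemma gen_closed_le: "gen_closed q n (keyspan {\<beta>\<in>T. Edeg_idx n l \<beta> \<le> E})"
  using step_T step_Edeg_le by (intro gen_closed_keyspan) fastforce

lemma gen_closed_B0: "gen_closed q n (keyspan B0)"
proof -
  have "B0 = {\<beta>\<in>T. Edeg_idx n l \<beta> \<le> E0}" using E0_le by force
  then show ?thesis using gen_closed_le by simp
qed

text \<open>No entry of the quotient can rise, and their sum cannot fall below E0, so none of them
  changes.\<close>

lemma step_B0: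
  assumes "\<beta> \<in> B0" "adj n a b" "tr a b \<beta> \<in> Zplus n" "qint q (\<beta> b + 1) \<noteq> 0"
  shows "tr a b \<beta> \<in> B0" "quo l (tr a b \<beta>) = quo l \<beta>"
proof -
  have T: "tr a b \<beta> \<in> T" using assms by (intro step_T) auto
  then have e: "Edeg_idx n l (tr a b \<beta>) = Edeg_idx n l \<beta>"
    using E0_le[OF T] step_Edeg_le[of \<beta> b a, OF assms(4,2)] assms(1) by auto
  then show "tr a b \<beta> \<in> B0" using T assms(1) by auto
  have le: "quo l (tr a b \<beta>) i \<le> quo l \<beta> i" for i
    using assms by (intro step_quo_le) (auto simp: qint_0_iff adj_neq)
  have "quo l (tr a b \<beta>) i = quo l \<beta> i" if "i \<in> {1..n}" for i
    using sum_mono_inv[of "quo l (tr a b \<beta>)" "{1..n}" "quo l \<beta>" i] e le that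
    unfolding Edeg_idx_eq mabs_def by auto
  moreover have "quo l (tr a b \<beta>) i = quo l \<beta> i" if "i \<notin> {1..n}" for i
    using that assms(2) by (auto simp: quo_def tr_def adj_def)
  ultimately show "quo l (tr a b \<beta>) = quo l \<beta>" by blast
qed

lemma gen_closed_Blk: "\<beta> \<in> B0 \<Longrightarrow> gen_closed q n (keyspan (Blk \<beta>))"
  using step_B0 by (intro gen_closed_keyspan) (auto simp: Edeg_idx_eq)

lemma rem_residues: "\<beta> \<in> T \<Longrightarrow> rem l \<beta> \<in> residues n l (s - int l * Edeg_idx n l \<beta>)"
  using l_pos by (intro quo_rem_mem)

lemma quo_energies: "\<beta> \<in> T \<Longrightarrow> quo l \<beta> \<in> energies n m (Edeg_idx n l \<beta>)"
  using l_pos by (intro quo_rem_mem)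

lemma comb_T:
  assumes "\<kappa> \<in> energies n m E" "\<rho> \<in> residues n l (s - int l * E)"
  shows "comb l \<kappa> \<rho> \<in> T"
  using comb_mem[OF assms l_pos(1)] by simp

lemma Edeg_comb: "\<kappa> \<in> energies n m E \<Longrightarrow> \<rho> \<in> residues n l S \<Longrightarrow> Edeg_idx n l (comb l \<kappa> \<rho>) = E"
  using l_pos by (simp add: Edeg_idx_eq quo_comb Zplus_truncD(2))

text \<open>The condition involves the residue alone. Later this permits one and the same step in
  two indices with different \<kappa>.\<close>

lemma rstep_coef:
  assumes "\<rho> \<in> residues n l S" "\<rho> b < int l - 1"
  shows "qint q (comb l \<kappa> \<rho> b + 1) \<noteq> 0"
  using residue_dvd_iff[OF assms(1) l_pos(1), of b] assms(2)
  by (simp add: qint_0_iff comb_def add.assoc dvd_add_right_iff)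

lemma reach_step:
  assumes W: "gen_closed q n W" and x: "xpow n (comb l \<kappa> \<rho>) \<in> W" and \<kappa>: "\<kappa> \<in> energies n m E"
    and \<rho>: "\<rho> \<in> residues n l S" and st: "rstep n l \<rho> \<rho>'"
  shows "xpow n (comb l \<kappa> \<rho>') \<in> W"
proof -
  obtain a b where ab: "adj n a b" "0 < \<rho> a" "\<rho> b < int l - 1" "\<rho>' = tr a b \<rho>"
    using st by (auto simp: rstep_def)
  have "tact q n a b (xpow n (comb l \<kappa> \<rho>)) = scal (qint q (comb l \<kappa> \<rho> b + 1)) (xpow n (comb l \<kappa> \<rho>'))"
    unfolding gact_xpow[OF trgen_index[OF ab(1)]] trgen_shift[OF ab(1)] trgen_coef[OF ab(1)] tr_comb ab(4) ..
  then have "scal (qint q (comb l \<kappa> \<rho> b + 1)) (xpow n (comb l \<kappa> \<rho>')) \<in> W"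
    using gen_closed_gact[OF W trgen_index[OF ab(1)] x] by simp
  then show ?thesis
    using rstep_coef[OF \<rho> ab(3)] scal.subspace_scale[OF gen_closed_subspace[OF W], of _ "inverse (qint q (comb l \<kappa> \<rho> b + 1))"]
    by force
qed

text \<open>Holds at every energy: the walk given by \<open>residues_connected\<close> consists of
  moves with nonzero coefficients that leave the quotient fixed.\<close>

lemma block_reach:
  assumes W: "gen_closed q n W" and x: "xpow n \<beta> \<in> W" and "\<beta> \<in> T" "\<gamma> \<in> T" "quo l \<gamma> = quo l \<beta>"
  shows "xpow n \<gamma> \<in> W"
proof -
  let ?\<kappa> = "quo l \<beta>" and ?S = "s - int l * Edeg_idx n l \<beta>"
  have e: "Edeg_idx n l \<gamma> = Edeg_idx n l \<beta>" using assms(5) by (simp add: Edeg_idx_eq)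
  have r: "rem l \<beta> \<in> residues n l ?S" "rem l \<gamma> \<in> residues n l ?S"
    using rem_residues[OF assms(3)] rem_residues[OF assms(4)] e by simp_all
  have "(rstep n l)\<^sup>*\<^sup>* (rem l \<beta>) (rem l \<gamma>)"
    by (rule residues_connected[OF r l_pos(2)])
  then have "xpow n (comb l ?\<kappa> (rem l \<gamma>)) \<in> W \<and> rem l \<gamma> \<in> residues n l ?S"
  proof (induction rule: rtranclp_induct)
    case base
    then show ?case using x r by (simp add: comb_quo_rem)
  next
    case (step \<rho> \<rho>')
    then show ?case
      using reach_step[OF W _ quo_energies[OF assms(3)]] rstep_residues by blast
  qed
  then show ?thesis using comb_quo_rem[of l \<gamma>] assms(5) by simp
qed

lemma primitive_rem:
  assumes "primitive n l \<beta>"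
  shows "primitive n l (rem l \<beta>)"
  using assms l_pos unfolding primitive_def rem_def
  by (auto simp: dvd_eq_mod_eq_0 mod_add_left_eq)

text \<open>Equal energy means equal residue sum, so \<open>primitive_unique\<close> applies even to
  indices of different blocks.\<close>

lemma primitive_rem_unique:
  assumes "primitive n l \<beta>" "primitive n l \<gamma>" "\<beta> \<in> T" "\<gamma> \<in> T" "Edeg_idx n l \<beta> = Edeg_idx n l \<gamma>"
  shows "rem l \<beta> = rem l \<gamma>"
  using primitive_unique[OF primitive_rem[OF assms(1)] _ primitive_rem[OF assms(2)] _ l_pos(2)]
    rem_residues[OF assms(3)] rem_residues[OF assms(4)] assms(5) by simp

lemma primitive_block_unique:
  assumes "primitive n l \<beta>" "primitive n l \<gamma>" "\<beta> \<in> T" "\<gamma> \<in> T" "quo l \<beta> = quo l \<gamma>"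
  shows "\<beta> = \<gamma>"
  using primitive_rem_unique[OF assms(1-4)] assms(5) by (metis Edeg_idx_eq comb_quo_rem)

lemma Vmod_subset_iff:
  assumes "gen_closed q n W" "\<beta> \<in> T"
  shows "Vmod q n \<beta> \<subseteq> W \<longleftrightarrow> xpow n \<beta> \<in> W"
  unfolding Vmod_def using assms T_AA by (intro cyclic_subset_iff) (auto intro: xpow_in_keyspan)

lemma xpow_AA: "\<beta> \<in> T \<Longrightarrow> xpow n \<beta> \<in> AA"
  using T_AA by (auto intro: xpow_in_keyspan)

lemma gen_closed_Vmod: "\<beta> \<in> T \<Longrightarrow> gen_closed q n (Vmod q n \<beta>)"
  unfolding Vmod_def by (intro gen_closed_cyclic xpow_AA)

lemma Vmod_self: "\<beta> \<in> T \<Longrightarrow> xpow n \<beta> \<in> Vmod q n \<beta>"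
  unfolding Vmod_def by (intro cyclic_self xpow_AA)

lemma Blk_subset_Vmod:
  assumes "\<beta> \<in> T" shows "keyspan (Blk \<beta>) \<subseteq> Vmod q n \<beta>"
proof (rule keyspan_subset)
  show "Blk \<beta> \<subseteq> Zplus n" by (auto dest: Zplus_truncD)
  show "scal.subspace (Vmod q n \<beta>)" by (rule gen_closed_subspace[OF gen_closed_Vmod[OF assms]])
  show "xpow n \<gamma> \<in> Vmod q n \<beta>" if "\<gamma> \<in> Blk \<beta>" for \<gamma>
    using block_reach[OF gen_closed_Vmod[OF assms] Vmod_self[OF assms] assms, of \<gamma>] that by auto
qed

lemma xpow_nonzero: "\<beta> \<in> T \<Longrightarrow> xpow n \<beta> \<noteq> (0 :: midx \<Rightarrow>\<^sub>0 'k)"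
  by (auto simp: xpow_def Zplus_trunc_def simp flip: keys_eq_empty)

lemma Vmod_eq_Blk:
  assumes "\<beta> \<in> B0" shows "Vmod q n \<beta> = keyspan (Blk \<beta>)"
proof
  show "Vmod q n \<beta> \<subseteq> keyspan (Blk \<beta>)"
    using assms by (subst Vmod_subset_iff[OF gen_closed_Blk]) (auto intro: xpow_in_keyspan)
qed (use assms Blk_subset_Vmod in auto)

text \<open>A nonzero submodule contains a vector all of whose terms are primitive. A block has only
  one primitive index, so this vector is a multiple of one monomial, and \<open>block_reach\<close>
  recovers the whole block from it.\<close>

lemma Blk_simple:
  assumes "\<beta> \<in> B0" shows "uq_simple q n (keyspan (Blk \<beta>))"
proof -
  have T: "keyspan (Blk \<beta>) \<subseteq> AA" using T_AA keyspan_mono[of "Blk \<beta>" T] by blast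
  show ?thesis
    unfolding simple_iff[OF T]
  proof (intro conjI allI impI)
    show "gen_closed q n (keyspan (Blk \<beta>))" using assms by (rule gen_closed_Blk)
    have "xpow n \<beta> \<in> keyspan (Blk \<beta>)" using assms by (intro xpow_in_keyspan) auto
    then show "keyspan (Blk \<beta>) \<noteq> {0 :: midx \<Rightarrow>\<^sub>0 'k}"
      using xpow_nonzero[of \<beta>] assms by fastforce
    fix W assume W: "gen_closed q n W" "W \<subseteq> keyspan (Blk \<beta>)"
    show "W = {0} \<or> W = keyspan (Blk \<beta>)"
    proof (cases "W = {0}")
      case False
      then obtain y where "y \<in> W" "y \<noteq> 0"
        using scal.subspace_0[OF gen_closed_subspace[OF W(1)]] by blast
      then obtain z where z: "z \<in> W" "z \<noteq> 0" "\<forall>\<beta>\<in>Poly_Mapping.keys z. primitive n l \<beta>"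
        using primitive_vector_exists[OF W(1) order.trans[OF W(2) T]] by blast
      then obtain \<gamma> where \<gamma>: "\<gamma> \<in> Poly_Mapping.keys z" by fastforce
      have sub: "Poly_Mapping.keys z \<subseteq> Blk \<beta>" using z(1) W(2) by (auto simp: keyspan_def)
      have "\<gamma>' = \<gamma>" if "\<gamma>' \<in> Poly_Mapping.keys z" for \<gamma>'
      proof (rule primitive_block_unique)
        show "primitive n l \<gamma>'" "primitive n l \<gamma>" using z(3) that \<gamma> by blast+
        show "\<gamma>' \<in> T" "\<gamma> \<in> T" using sub that \<gamma> by blast+
        have "\<gamma>' \<in> Blk \<beta>" "\<gamma> \<in> Blk \<beta>" using sub that \<gamma> by blast+
        then show "quo l \<gamma>' = quo l \<gamma>" by simp
      qed
      then have z0: "Poly_Mapping.lookup z \<gamma>' = 0" if "\<gamma>' \<noteq> \<gamma>" for \<gamma>'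
        using that by (meson in_keys_iff)
      have "\<gamma> \<in> Zplus n" using \<gamma> sub by (auto dest: Zplus_truncD)
      then have "z = scal (Poly_Mapping.lookup z \<gamma>) (xpow n \<gamma>)"
        by (intro poly_mapping_eqI) (simp add: xpow_def lookup_single when_def z0)
      then have "scal (inverse (Poly_Mapping.lookup z \<gamma>)) z = xpow n \<gamma>"
        using \<gamma> by (metis in_keys_iff left_inverse scal.scale_one scal.scale_scale)
      then have "xpow n \<gamma> \<in> W"
        using scal.subspace_scale[OF gen_closed_subspace[OF W(1)] z(1)] by metis
      then have "xpow n \<gamma>' \<in> W" if "\<gamma>' \<in> Blk \<beta>" for \<gamma>'
        using block_reach[OF W(1), of \<gamma> \<gamma>'] that \<gamma> sub by auto
      then have "keyspan (Blk \<beta>) \<subseteq> W"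
        using W(1) by (intro keyspan_subset[of _ n]) (auto intro: gen_closed_subspace dest: Zplus_truncD)
      then show ?thesis using W(2) by auto
    qed simp
  qed
qed

end

section \<open>Socle and generators\<close>

context truncated
begin

lemma Edeg_nonneg: "\<beta> \<in> T \<Longrightarrow> 0 \<le> Edeg_idx n l \<beta>"
  using mabs_const_bound(2)[OF quo_energies] by blast

lemma E0_nonneg: "0 \<le> E0"
  using E0_attained Edeg_nonneg by metis

lemma nonzero_exists: "gen_closed q n W \<Longrightarrow> W \<noteq> {0} \<Longrightarrow> \<exists>y\<in>W. y \<noteq> 0"
  using scal.subspace_0[OF gen_closed_subspace] by blast

text \<open>In a vector of least top energy, walk the common residue of the top terms to one with a
  zero at some \<open>a\<close> where a top term still has energy, and move one unit out of \<open>a\<close>: all top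
  terms drop or vanish, but not all vanish.\<close>

lemma min_energy_vector:
  assumes W: "gen_closed q n W" "W \<subseteq> keyspan T" "W \<noteq> {0}"
  shows "\<exists>y\<in>W. y \<noteq> 0 \<and> y \<in> keyspan B0"
proof -
  define P where "P = (\<lambda>k::nat. \<exists>y\<in>W. y \<noteq> 0 \<and> (\<forall>\<beta>\<in>Poly_Mapping.keys y. Edeg_idx n l \<beta> \<le> E0 + int k))"
  obtain y0 where y0: "y0 \<in> W" "y0 \<noteq> 0" using nonzero_exists W by blast
  have "Edeg_idx n l \<beta> \<le> Max (Edeg_idx n l ` Poly_Mapping.keys y0)" if "\<beta> \<in> Poly_Mapping.keys y0" for \<beta>
    using that by (intro Max_ge) auto
  then have "Edeg_idx n l \<beta> \<le> E0 + int (nat (Max (Edeg_idx n l ` Poly_Mapping.keys y0)))"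
    if "\<beta> \<in> Poly_Mapping.keys y0" for \<beta>
    using that E0_nonneg by (smt (verit) int_nat_eq)
  then have "P (nat (Max (Edeg_idx n l ` Poly_Mapping.keys y0)))"
    unfolding P_def using y0 by blast
  then have Pk: "P (LEAST k. P k)" by (rule LeastI)
  define k where "k = (LEAST k. P k)"
  define E where "E = E0 + int k"
  obtain y1 where y1: "y1 \<in> W" "y1 \<noteq> 0" "\<forall>\<beta>\<in>Poly_Mapping.keys y1. Edeg_idx n l \<beta> \<le> E"
    using Pk unfolding P_def k_def E_def by blast
  have "k = 0"
  proof (rule ccontr)
    assume k0: "k \<noteq> 0"
    define W' where "W' = W \<inter> keyspan {\<beta>\<in>T. Edeg_idx n l \<beta> \<le> E}"
    have W': "gen_closed q n W'"
      unfolding W'_def by (intro gen_closed_Int W gen_closed_le)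
    have keysT: "\<beta> \<in> T \<and> Edeg_idx n l \<beta> \<le> E" if "z \<in> W'" "\<beta> \<in> Poly_Mapping.keys z" for z \<beta>
      using that by (auto simp: W'_def keyspan_def)
    have W'_AA: "W' \<subseteq> AA" using W(2) T_AA by (auto simp: W'_def)
    \<comment> \<open>Minimality of k: no nonzero vector of W' has all its terms below energy
      E.\<close>
    have top: "\<exists>\<beta>\<in>Poly_Mapping.keys z. Edeg_idx n l \<beta> = E" if "z \<in> W'" "z \<noteq> 0" for z
    proof (rule ccontr)
      assume "\<not> ?thesis"
      then have "\<forall>\<beta>\<in>Poly_Mapping.keys z. Edeg_idx n l \<beta> \<le> E0 + int (k - 1)"
        using keysT[OF that(1)] k0 unfolding E_def by force
      then have "P (k - 1)" unfolding P_def using that by (auto simp: W'_def)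
      then have "k \<le> k - 1" unfolding k_def by (rule Least_le)
      with k0 show False by simp
    qed
    have "y1 \<in> W'" using y1 W(2) by (auto simp: W'_def keyspan_def)
    then obtain y where y: "y \<in> W'" "y \<noteq> 0" "\<forall>\<beta>\<in>Poly_Mapping.keys y. primitive n l \<beta>"
      using primitive_vector_exists[OF W' W'_AA] y1(2) by blast
    obtain \<beta>0 where \<beta>0: "\<beta>0 \<in> Poly_Mapping.keys y" "Edeg_idx n l \<beta>0 = E" using top y by blast
    have \<beta>0T: "\<beta>0 \<in> T" using keysT y(1) \<beta>0(1) by blast
    define S where "S = s - int l * E"
    have "E > 0" using k0 E0_nonneg by (simp add: E_def)
    then obtain a where a: "a \<in> {1..n}" "0 < quo l \<beta>0 a"
      using \<beta>0(2) sum_nonpos[of "{1..n}" "quo l \<beta>0"] unfolding Edeg_idx_eq mabs_def by fastforce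
    obtain b where ab: "adj n a b" using adj_exists[of n a] a(1) n3 by auto
    \<comment> \<open>E0 is attained, so s - l E0 \<le> n (l - 1); as E \<ge> E0 + 1, the residue
      sum at E is smaller by at least l. This is the bound in
      \<open>residues_exists_low\<close>.\<close>
    have S: "0 \<le> S" "S \<le> int n * (int l - 1) - int l"
    proof -
      show "0 \<le> S" using mabs_const_bound(2)[OF rem_residues[OF \<beta>0T]] \<beta>0(2) by (simp add: S_def)
      obtain \<gamma> where "\<gamma> \<in> T" "Edeg_idx n l \<gamma> = E0" by (rule E0_attained)
      then have "s - int l * E0 \<le> int n * (int l - 1)"
        using mabs_const_bound(1)[OF rem_residues[of \<gamma>]] by simp
      moreover have "int l * 1 \<le> int l * int k" using k0 by (intro mult_left_mono) auto
      ultimately show "S \<le> int n * (int l - 1) - int l"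
        by (simp add: S_def E_def distrib_left)
    qed
    obtain \<rho>' where \<rho>': "\<rho>' \<in> residues n l S" "\<rho>' a = 0" "\<rho>' b < int l - 1"
      using residues_exists_low[OF adj_in[OF ab] adj_neq[OF ab] l_pos(2) S] by blast
    \<comment> \<open>Only terms of energy E are constrained: within W' they can arise only from
      terms of energy E, because moves never raise the energy. The last clause keeps a top term with
      energy at a alive.\<close>
    define Q where "Q = (\<lambda>\<rho>. \<rho> \<in> residues n l S \<and> (\<exists>z\<in>W'. (\<forall>\<beta>\<in>Poly_Mapping.keys z. Edeg_idx n l \<beta> = E \<longrightarrow> rem l \<beta> = \<rho>)
        \<and> (\<exists>\<beta>\<in>Poly_Mapping.keys z. Edeg_idx n l \<beta> = E \<and> 0 < quo l \<beta> a)))"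
    have rem0: "rem l \<beta>0 \<in> residues n l S" using rem_residues[OF \<beta>0T] \<beta>0(2) by (simp add: S_def)
    \<comment> \<open>Primitivity gives the top terms a common residue to start the walk
      from.\<close>
    have "rem l \<beta> = rem l \<beta>0" if "\<beta> \<in> Poly_Mapping.keys y" "Edeg_idx n l \<beta> = E" for \<beta>
      using primitive_rem_unique[of \<beta> \<beta>0] y(3) that \<beta>0 keysT[OF y(1)] by simp
    then have Q0: "Q (rem l \<beta>0)"
      unfolding Q_def using rem0 y(1) \<beta>0 a(2) by blast
    have Qstep: "Q \<sigma>" if "Q \<rho>" "rstep n l \<rho> \<sigma>" for \<rho> \<sigma>
    proof -
      from that(1) obtain z \<beta>1 where \<rho>: "\<rho> \<in> residues n l S" and z: "z \<in> W'"
        "\<And>\<beta>. \<beta> \<in> Poly_Mapping.keys z \<Longrightarrow> Edeg_idx n l \<beta> = E \<Longrightarrow> rem l \<beta> = \<rho>"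
        and \<beta>1: "\<beta>1 \<in> Poly_Mapping.keys z" "Edeg_idx n l \<beta>1 = E" "0 < quo l \<beta>1 a"
        unfolding Q_def by blast
      from that(2) obtain c d where cd: "adj n c d" "0 < \<rho> c" "\<rho> d < int l - 1" "\<sigma> = tr c d \<rho>"
        unfolding rstep_def by blast
      have \<sigma>: "\<sigma> \<in> residues n l S" by (rule rstep_residues[OF that(2) \<rho>])
      let ?z = "tact q n c d z"
      have "?z \<in> W'" by (rule gen_closed_gact[OF W' trgen_index[OF cd(1)] z(1)])
      moreover have "rem l \<gamma> = \<sigma>" if \<gamma>: "\<gamma> \<in> Poly_Mapping.keys ?z" "Edeg_idx n l \<gamma> = E" for \<gamma>
      proof -
        obtain \<beta> where \<beta>: "\<beta> \<in> Poly_Mapping.keys z" "\<gamma> = tr c d \<beta>" "qint q (\<beta> d + 1) \<noteq> 0"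
          using \<gamma>(1) cd(1) by (rule keys_tact)
        have "Edeg_idx n l \<beta> = E"
          using keysT[OF z(1) \<beta>(1)] step_Edeg_le[of \<beta> d c, OF \<beta>(3) cd(1)] \<gamma>(2) \<beta>(2) by simp
        then have "\<beta> = comb l (quo l \<beta>) \<rho>" using z(2)[OF \<beta>(1)] comb_quo_rem[of l \<beta>] by simp
        then have "\<gamma> = comb l (quo l \<beta>) \<sigma>" using \<beta>(2) tr_comb cd(4) by metis
        then show ?thesis using rem_comb[OF \<sigma> l_pos(1)] by simp
      qed
      moreover have "\<exists>\<gamma>\<in>Poly_Mapping.keys ?z. Edeg_idx n l \<gamma> = E \<and> 0 < quo l \<gamma> a"
      proof
        have eq: "\<beta>1 = comb l (quo l \<beta>1) \<rho>" using z(2)[OF \<beta>1(1,2)] comb_quo_rem[of l \<beta>1] by simp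
        have tr: "tr c d \<beta>1 = comb l (quo l \<beta>1) \<sigma>" using eq tr_comb cd(4) by metis
        have q1: "quo l (tr c d \<beta>1) = quo l \<beta>1" unfolding tr by (rule quo_comb[OF \<sigma> l_pos(1)])
        have "\<beta>1 \<in> Zplus n" using keysT[OF z(1) \<beta>1(1)] by (auto dest: Zplus_truncD)
        moreover have "0 < \<beta>1 c"
          using cd(2) arg_cong[OF eq, of "\<lambda>f. f c"] ZplusD[OF Zplus_truncD(1)[OF quo_energies], of \<beta>1 c]
            keysT[OF z(1) \<beta>1(1)] by (auto simp: comb_def intro!: add_nonneg_pos mult_nonneg_nonneg)
        ultimately have "tr c d \<beta>1 \<in> Zplus n" using tr_Zplus_iff cd(1) by blast
        moreover have "qint q (\<beta>1 d + 1) \<noteq> 0"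
          using rstep_coef[OF \<rho> cd(3), of "quo l \<beta>1"] eq by simp
        ultimately show "tr c d \<beta>1 \<in> Poly_Mapping.keys ?z"
          using keys_tact_iff[OF cd(1)] \<beta>1(1) by blast
        show "Edeg_idx n l (tr c d \<beta>1) = E \<and> 0 < quo l (tr c d \<beta>1) a"
          using q1 \<beta>1 by (simp add: Edeg_idx_eq)
      qed
      ultimately show ?thesis unfolding Q_def using \<sigma> by blast
    qed
    have "(rstep n l)\<^sup>*\<^sup>* (rem l \<beta>0) \<rho>'" by (rule residues_connected[OF rem0 \<rho>'(1) l_pos(2)])
    then have "Q \<rho>'" by (induction rule: rtranclp_induct) (use Q0 Qstep in auto)
    then obtain z \<beta>1 where z: "z \<in> W'"
        "\<And>\<beta>. \<beta> \<in> Poly_Mapping.keys z \<Longrightarrow> Edeg_idx n l \<beta> = E \<Longrightarrow> rem l \<beta> = \<rho>'"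
        and \<beta>1: "\<beta>1 \<in> Poly_Mapping.keys z" "Edeg_idx n l \<beta>1 = E" "0 < quo l \<beta>1 a"
        unfolding Q_def by blast
    let ?z = "tact q n a b z"
    have zW: "?z \<in> W'" by (rule gen_closed_gact[OF W' trgen_index[OF ab] z(1)])
    have eq: "\<beta>1 = comb l (quo l \<beta>1) \<rho>'" using z(2)[OF \<beta>1(1,2)] comb_quo_rem[of l \<beta>1] by simp
    have "0 < \<beta>1 a" using arg_cong[OF eq, of "\<lambda>f. f a"] \<rho>'(2) \<beta>1(3) l_pos by (simp add: comb_def)
    moreover have "\<beta>1 \<in> Zplus n" using keysT[OF z(1) \<beta>1(1)] by (auto dest: Zplus_truncD)
    ultimately have "tr a b \<beta>1 \<in> Zplus n" using tr_Zplus_iff ab by blast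
    moreover have "qint q (\<beta>1 b + 1) \<noteq> 0"
      using rstep_coef[OF \<rho>'(1,3), of "quo l \<beta>1"] eq by simp
    ultimately have "tr a b \<beta>1 \<in> Poly_Mapping.keys ?z"
      using keys_tact_iff[OF ab] \<beta>1(1) by blast
    then have "?z \<noteq> 0" by auto
    \<comment> \<open>A term of energy E must come from one of energy E. That one has residue 0 at
      a, so moving out of a has cost a unit of energy: a contradiction.\<close>
    then obtain \<gamma> where \<gamma>: "\<gamma> \<in> Poly_Mapping.keys ?z" "Edeg_idx n l \<gamma> = E" using top[OF zW] by blast
    obtain \<beta> where \<beta>: "\<beta> \<in> Poly_Mapping.keys z" "\<gamma> = tr a b \<beta>" "qint q (\<beta> b + 1) \<noteq> 0"
      using \<gamma>(1) ab by (rule keys_tact)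
    have "Edeg_idx n l \<beta> = E"
      using keysT[OF z(1) \<beta>(1)] step_Edeg_le[of \<beta> b a, OF \<beta>(3) ab] \<gamma>(2) \<beta>(2) by simp
    then have "rem l \<beta> = \<rho>'" using z(2)[OF \<beta>(1)] by blast
    then have "\<beta> a mod int l = 0" using \<rho>'(2) by (auto simp: rem_def)
    then obtain t where t: "\<beta> a = int l * t" by auto
    have "quo l \<gamma> a < quo l \<beta> a"
    proof -
      have "(int l * t - 1) div int l = t - 1"
        using l_pos by (intro int_div_pos_eq[of _ _ _ "int l - 1"]) (auto simp: algebra_simps)
      then show ?thesis using t \<beta>(2) adj_neq[OF ab] l_pos by (simp add: quo_def tr_simps)
    qed
    moreover have "quo l \<gamma> i \<le> quo l \<beta> i" for i
      unfolding \<beta>(2) using \<beta>(3) adj_neq[OF ab] by (intro step_quo_le) (simp_all add: qint_0_iff)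
    ultimately have "Edeg_idx n l \<gamma> < Edeg_idx n l \<beta>"
      unfolding Edeg_idx_eq mabs_def using a(1) by (intro sum_strict_mono_ex1) auto
    then show False using \<gamma>(2) \<open>Edeg_idx n l \<beta> = E\<close> by simp
  qed
  then have "y1 \<in> keyspan B0"
    using y1 W(2) E0_le by (force simp: E_def keyspan_def)
  then show ?thesis using y1 by blast
qed

text \<open>By \<open>min_energy_vector\<close> the submodule cut out of W by
  \<open>keyspan B0\<close> is nonzero, so simplicity makes it all of W.\<close>

lemma simple_in_B0:
  assumes "gen_closed q n W" "W \<subseteq> keyspan T" "uq_simple q n W"
  shows "W \<subseteq> keyspan B0"
proof -
  have AA: "W \<subseteq> AA" using assms(2) T_AA by blast
  have ne: "W \<noteq> {0}" using assms(3) simple_iff[OF AA] by blast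
  obtain y where "y \<in> W" "y \<noteq> 0" "y \<in> keyspan B0"
    using min_energy_vector[OF assms(1,2) ne] by blast
  moreover have "gen_closed q n (W \<inter> keyspan B0)"
    by (intro gen_closed_Int assms(1) gen_closed_B0)
  ultimately show ?thesis
    using assms(3) unfolding simple_iff[OF AA] by blast
qed

lemma simple_cyclic_Edeg:
  assumes "y \<in> keyspan T" "y \<noteq> 0" "uq_simple q n (uq_cyclic q n y)"
  shows "Edeg n l y = E0"
proof -
  have yA: "y \<in> AA" using assms(1) T_AA by blast
  have "uq_cyclic q n y \<subseteq> keyspan B0"
    by (intro simple_in_B0 gen_closed_cyclic yA cyclic_minimal gen_closed_T assms)
  then have "y \<in> keyspan B0" using cyclic_self[OF yA] by blast
  then have "\<And>\<beta>. \<beta> \<in> Poly_Mapping.keys y \<Longrightarrow> Edeg_idx n l \<beta> = E0" by (auto simp: keyspan_def)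
  moreover have "Poly_Mapping.keys y \<noteq> {}" using assms(2) by simp
  ultimately have "Edeg_idx n l ` Poly_Mapping.keys y = {E0}" by (simp add: image_constant_conv cong: image_cong)
  then show ?thesis by (simp add: Edeg_def)
qed

lemma Soc_eq: "Soc q n (keyspan T) = keyspan B0"
proof
  let ?I = "{W. lsubmodule (uq q n) (uq_act q n) W (keyspan T) \<and> uq_simple q n W}"
  have I: "gen_closed q n W \<and> W \<subseteq> keyspan T" if "W \<in> ?I" for W
    using that lsubmodule_iff[OF T_AA] by blast
  show "Soc q n (keyspan T) \<subseteq> keyspan B0"
    unfolding socle_def using I simple_in_B0 by (intro module_sum_least keyspan_subspace) blast
  have sub: "scal.subspace (module_sum ?I (\<lambda>W. W))"
    using I by (intro module_sum_subspace) (auto intro: gen_closed_subspace)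
  show "keyspan B0 \<subseteq> Soc q n (keyspan T)"
    unfolding socle_def
  proof (rule keyspan_subset[OF _ sub])
    show "B0 \<subseteq> Zplus n" by (auto dest: Zplus_truncD)
    fix \<beta> assume \<beta>: "\<beta> \<in> B0"
    have "keyspan (Blk \<beta>) \<in> ?I"
      using Blk_simple[OF \<beta>] gen_closed_Blk[OF \<beta>] lsubmodule_iff[OF T_AA, of "keyspan (Blk \<beta>)"] keyspan_mono[of "Blk \<beta>" T] by blast
    moreover have "xpow n \<beta> \<in> keyspan (Blk \<beta>)" using \<beta> by (intro xpow_in_keyspan) auto
    ultimately show "xpow n \<beta> \<in> module_sum ?I (\<lambda>W. W)" by (rule module_sum_member)
  qed
qed

section \<open>Generation by the monomials of maximal energy\<close>

abbreviation "E1 \<equiv> Emax n l m s"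

lemma E1_ge: "\<beta> \<in> T \<Longrightarrow> Edeg_idx n l \<beta> \<le> E1"
  unfolding Emax_def by (intro Max_ge) (auto simp: finite_Zplus_trunc)

lemma E1_attained: obtains \<beta> where "\<beta> \<in> T" "Edeg_idx n l \<beta> = E1"
proof -
  have "Emax n l m s \<in> Edeg_idx n l ` T"
    unfolding Emax_def using T_nonempty by (intro Max_in) (auto simp: finite_Zplus_trunc)
  then show ?thesis using that by auto
qed

text \<open>A carry at a, that is, an energy drop from a to b read backwards. The move from b to a
  itself has coefficient 0 here; the generator that is applied later is the one from a to b, at the
  raised index.\<close>

lemma raise_energy:
  assumes "\<kappa> \<in> energies n m E" "\<rho> \<in> residues n l S" "adj n a b" "\<kappa> a < m - 1" "\<rho> a = int l - 1" "0 < \<rho> b"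
  shows "tr b a (comb l \<kappa> \<rho>) = comb l (\<kappa>(a := \<kappa> a + 1)) (\<rho>(a := 0, b := \<rho> b - 1))"
    "\<kappa>(a := \<kappa> a + 1) \<in> energies n m (E + 1)"
    "\<rho>(a := 0, b := \<rho> b - 1) \<in> residues n l (S - int l)"
proof -
  have ab: "a \<in> {1..n}" "b \<in> {1..n}" "a \<noteq> b" using adj_in[OF assms(3)] adj_neq[OF assms(3)] by auto
  note k = Zplus_truncD[OF assms(1)] and r = Zplus_truncD[OF assms(2)]
  show "tr b a (comb l \<kappa> \<rho>) = comb l (\<kappa>(a := \<kappa> a + 1)) (\<rho>(a := 0, b := \<rho> b - 1))"
    using ab(3) assms(5) by (auto simp: tr_def comb_def fun_eq_iff algebra_simps)
  show "\<kappa>(a := \<kappa> a + 1) \<in> energies n m (E + 1)"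
    using k(1,2) k(3) ab assms(4) ZplusD[OF k(1), of a]
    by (auto simp: Zplus_trunc_def Zplus_def mabs_upd simp del: One_nat_def)
  have "\<rho> b - 1 < int l" using residuesD(2)[OF assms(2), of b] l_pos by simp
  then show "\<rho>(a := 0, b := \<rho> b - 1) \<in> residues n l (S - int l)"
    using r(1,2) r(3) ab assms(5,6) l_pos
    by (auto simp: Zplus_trunc_def Zplus_def mabs_upd simp del: One_nat_def)
qed

lemma raise_exists:
  assumes "\<kappa> \<in> energies n m E" "a \<in> {1..n}" "\<kappa> a < m - 1"
    and S: "int l \<le> s - int l * E" "s - int l * E \<le> int n * (int l - 1)"
  obtains b \<rho> where "adj n a b" "\<rho> \<in> residues n l (s - int l * E)" "\<rho> a = int l - 1" "0 < \<rho> b"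
    "qint q (tr b a (comb l \<kappa> \<rho>) b + 1) \<noteq> 0" "tr a b (tr b a (comb l \<kappa> \<rho>)) = comb l \<kappa> \<rho>"
    "comb l \<kappa> \<rho> \<in> T" "tr b a (comb l \<kappa> \<rho>) \<in> T" "Edeg_idx n l (tr b a (comb l \<kappa> \<rho>)) = E + 1"
proof -
  obtain b where ab: "adj n a b" using adj_exists[of n a] assms(2) n3 by auto
  obtain \<rho> where \<rho>: "\<rho> \<in> residues n l (s - int l * E)" "\<rho> a = int l - 1" "0 < \<rho> b"
    using residues_exists_high[OF adj_in[OF ab] adj_neq[OF ab] l_pos(2) S] by blast
  note raise = raise_energy[OF assms(1) \<rho>(1) ab assms(3) \<rho>(2,3)]
  have S': "s - int l * E - int l = s - int l * (E + 1)" by (simp add: algebra_simps)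
  have "tr b a (comb l \<kappa> \<rho>) b + 1 = comb l \<kappa> \<rho> b" using adj_neq[OF ab] by (simp add: tr_simps)
  moreover have "\<not> int l dvd \<rho> b"
    using \<rho>(3) residuesD(2)[OF \<rho>(1) l_pos(1), of b] zdvd_imp_le by fastforce
  ultimately have "qint q (tr b a (comb l \<kappa> \<rho>) b + 1) \<noteq> 0"
    by (simp add: qint_0_iff comb_def dvd_add_right_iff)
  moreover have "tr b a (comb l \<kappa> \<rho>) \<in> T"
    unfolding raise(1) by (rule comb_T[OF raise(2)]) (use raise(3) S' in simp)
  moreover have "Edeg_idx n l (tr b a (comb l \<kappa> \<rho>)) = E + 1"
    unfolding raise(1) by (rule Edeg_comb[OF raise(2,3)])
  ultimately show ?thesis
    using that[OF ab \<rho>] comb_T[OF assms(1) \<rho>(1)] tr_tr adj_neq[OF ab] by metis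
qed

text \<open>Induction on the missing energy. From the block of \<beta> an index can be raised by one
  unit; its monomial lies in W by induction, one drop leads back into the block, and
  \<open>block_reach\<close> ends at \<beta>.\<close>

lemma xpow_in_top:
  assumes "\<beta> \<in> T" and W: "gen_closed q n W"
    and top: "\<And>\<alpha>. \<alpha> \<in> T \<Longrightarrow> Edeg_idx n l \<alpha> = E1 \<Longrightarrow> xpow n \<alpha> \<in> W"
  shows "xpow n \<beta> \<in> W"
  using assms(1)
proof (induction "nat (E1 - Edeg_idx n l \<beta>)" arbitrary: \<beta> rule: less_induct)
  case less
  let ?E = "Edeg_idx n l \<beta>"
  show ?case
  proof (cases "?E = E1")
    case False
    then have lt: "?E < E1" using E1_ge[OF less.prems] by simp
    obtain \<gamma> where \<gamma>: "\<gamma> \<in> T" "Edeg_idx n l \<gamma> = E1" by (rule E1_attained)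
    \<comment> \<open>Comparison with an index of maximal energy yields a position where energy can
      still grow inside the box.\<close>
    have "\<exists>a\<in>{1..n}. quo l \<beta> a < quo l \<gamma> a"
    proof (rule ccontr)
      assume "\<not> ?thesis"
      then have "Edeg_idx n l \<gamma> \<le> ?E" unfolding Edeg_idx_eq mabs_def by (intro sum_mono) (auto simp: not_less)
      then show False using lt \<gamma>(2) by simp
    qed
    then obtain a where a: "a \<in> {1..n}" "quo l \<beta> a < quo l \<gamma> a" by blast
    then have am: "quo l \<beta> a < m - 1" using Zplus_truncD(3)[OF quo_energies[OF \<gamma>(1)] a(1)] by simp
    have "0 \<le> s - int l * E1" using mabs_const_bound(2)[OF rem_residues[OF \<gamma>(1)]] \<gamma>(2) by simp
    moreover have "int l * (?E + 1) \<le> int l * E1" using lt by (intro mult_left_mono) auto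
    ultimately have S: "int l \<le> s - int l * ?E" by (simp add: algebra_simps)
    have S2: "s - int l * ?E \<le> int n * (int l - 1)"
      using mabs_const_bound(1)[OF rem_residues[OF less.prems]] by simp
    obtain b \<rho> where b: "adj n a b" "\<rho> \<in> residues n l (s - int l * ?E)"
      "qint q (tr b a (comb l (quo l \<beta>) \<rho>) b + 1) \<noteq> 0"
      "tr a b (tr b a (comb l (quo l \<beta>) \<rho>)) = comb l (quo l \<beta>) \<rho>"
      "comb l (quo l \<beta>) \<rho> \<in> T" "tr b a (comb l (quo l \<beta>) \<rho>) \<in> T"
      "Edeg_idx n l (tr b a (comb l (quo l \<beta>) \<rho>)) = ?E + 1"
      using raise_exists[OF quo_energies[OF less.prems] a(1) am S S2] by metis
    let ?\<alpha> = "tr b a (comb l (quo l \<beta>) \<rho>)"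
    have "xpow n ?\<alpha> \<in> W" using less.hyps[OF _ b(6)] lt b(7) by simp
    then have "tact q n a b (xpow n ?\<alpha>) \<in> W" by (rule gen_closed_gact[OF W trgen_index[OF b(1)]])
    then have "scal (qint q (?\<alpha> b + 1)) (xpow n (comb l (quo l \<beta>) \<rho>)) \<in> W"
      unfolding gact_xpow[OF trgen_index[OF b(1)]] trgen_shift[OF b(1)] trgen_coef[OF b(1)] b(4) .
    then have "xpow n (comb l (quo l \<beta>) \<rho>) \<in> W"
      using scal.subspace_scale[OF gen_closed_subspace[OF W], of _ "inverse (qint q (?\<alpha> b + 1))"] b(3) by force
    then show ?thesis
      by (rule block_reach[OF W _ b(5) less.prems]) (simp add: quo_comb[OF b(2) l_pos(1)])
  qed (use top less.prems in blast)
qed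

lemma generated_by_top: "keyspan T = module_sum {\<alpha>\<in>T. Edeg_idx n l \<alpha> = E1} (Vmod q n)"
proof
  let ?I = "{\<alpha>\<in>T. Edeg_idx n l \<alpha> = E1}"
  have V: "gen_closed q n (Vmod q n \<alpha>)" if "\<alpha> \<in> ?I" for \<alpha> using that gen_closed_Vmod by auto
  have sub: "scal.subspace (module_sum ?I (Vmod q n))"
    using V by (intro module_sum_subspace) (auto intro: gen_closed_subspace)
  have "gact q n g x \<in> module_sum ?I (Vmod q n)" if "gen_index g \<in> {1..n - 1}" "x \<in> module_sum ?I (Vmod q n)" for g x
  proof -
    have "module_sum ?I (Vmod q n) \<subseteq> {x. gact q n g x \<in> module_sum ?I (Vmod q n)}"
    proof (rule module_sum_least)
      show "scal.subspace {x. gact q n g x \<in> module_sum ?I (Vmod q n)}"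
        using sub by (auto simp: scal.subspace_def lin_ext_add lin_ext_scal)
      show "Vmod q n \<alpha> \<subseteq> {x. gact q n g x \<in> module_sum ?I (Vmod q n)}" if "\<alpha> \<in> ?I" for \<alpha>
        using gen_closed_gact[OF V[OF that] \<open>gen_index g \<in> {1..n - 1}\<close>] module_sum_member[OF that] by blast
    qed
    then show ?thesis using that(2) by blast
  qed
  then have W: "gen_closed q n (module_sum ?I (Vmod q n))" using sub by (auto simp: gen_closed_def)
  have top: "xpow n \<alpha> \<in> module_sum ?I (Vmod q n)" if "\<alpha> \<in> T" "Edeg_idx n l \<alpha> = E1" for \<alpha>
    using that by (intro module_sum_member[of \<alpha>] Vmod_self) simp_all
  have "xpow n \<beta> \<in> module_sum ?I (Vmod q n)" if "\<beta> \<in> T" for \<beta>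
    by (rule xpow_in_top[OF that W top])
  then show "keyspan T \<subseteq> module_sum ?I (Vmod q n)"
    by (rule keyspan_subset[OF Zplus_trunc_subset sub])
  show "module_sum ?I (Vmod q n) \<subseteq> keyspan T"
  proof (intro module_sum_least keyspan_subspace)
    show "Vmod q n \<alpha> \<subseteq> keyspan T" if "\<alpha> \<in> ?I" for \<alpha>
      using that Vmod_subset_iff[OF gen_closed_T, of \<alpha>] xpow_in_keyspan[of \<alpha> T n] by blast
  qed
qed

end

section \<open>Indecomposability\<close>

context truncated
begin

lemma primitive_in_block:
  assumes "\<beta> \<in> B0"
  obtains \<gamma> where "\<gamma> \<in> T" "quo l \<gamma> = quo l \<beta>" "primitive n l \<gamma>"
proof -
  have T: "keyspan (Blk \<beta>) \<subseteq> AA" using T_AA keyspan_mono[of "Blk \<beta>" T] by blast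
  have x: "xpow n \<beta> \<in> keyspan (Blk \<beta>)" "xpow n \<beta> \<noteq> (0 :: midx \<Rightarrow>\<^sub>0 'k)"
    using assms xpow_nonzero by (auto intro!: xpow_in_keyspan)
  obtain z :: "midx \<Rightarrow>\<^sub>0 'k" where z: "z \<in> keyspan (Blk \<beta>)" "z \<noteq> 0" "\<forall>\<gamma>\<in>Poly_Mapping.keys z. primitive n l \<gamma>"
    using primitive_vector_exists[OF gen_closed_Blk[OF assms] T x] by blast
  have "Poly_Mapping.keys z \<noteq> {}" using z(2) by simp
  then obtain \<gamma> where \<gamma>: "\<gamma> \<in> Poly_Mapping.keys z" by blast
  then have "\<gamma> \<in> Blk \<beta>" using z(1) by (auto simp: keyspan_def)
  then show ?thesis using that[of \<gamma>] z(3) \<gamma> by blast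
qed

end

text \<open>\<open>S0\<close> provides residues at the minimal level from which the energy can be
  raised, so that level E0 + 1 can serve as an intermediate stop.\<close>

locale split_module = truncated q n l m s
  for q :: "'k::field" and n l :: nat and m s :: int +
  fixes U W :: "(midx \<Rightarrow>\<^sub>0 'k) set"
  assumes U: "gen_closed q n U" "U \<subseteq> keyspan T" and W: "gen_closed q n W" "W \<subseteq> keyspan T"
    and UW: "U \<inter> W = {0}" and sum: "keyspan T = {u + w | u w. u \<in> U \<and> w \<in> W}"
    and S0: "int l \<le> s - int l * E0"
begin

text \<open>Projection onto U along W, unspecified outside \<open>keyspan T\<close>.\<close>

definition pr :: "(midx \<Rightarrow>\<^sub>0 'k) \<Rightarrow> (midx \<Rightarrow>\<^sub>0 'k)" where
  "pr y = (THE u. u \<in> U \<and> y - u \<in> W)"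

lemma pr_unique:
  assumes "u \<in> U" "y - u \<in> W" shows "pr y = u"
  unfolding pr_def
proof (rule the_equality)
  fix u' assume u': "u' \<in> U \<and> y - u' \<in> W"
  have "u' - u \<in> U" using u' assms scal.subspace_diff[OF gen_closed_subspace[OF U(1)]] by blast
  moreover have "(y - u) - (y - u') \<in> W"
    using u' assms scal.subspace_diff[OF gen_closed_subspace[OF W(1)]] by blast
  ultimately have "u' - u \<in> U \<inter> W" by simp
  then show "u' = u" using UW by simp
qed (use assms in simp)

lemma pr_mem:
  assumes "y \<in> keyspan T" shows "pr y \<in> U" "y - pr y \<in> W"
proof -
  obtain u w where "y = u + w" "u \<in> U" "w \<in> W" using assms sum by auto
  then have "u \<in> U" "y - u \<in> W" by auto
  then show "pr y \<in> U" "y - pr y \<in> W" using pr_unique by auto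
qed

lemma pr_0: "pr 0 = 0"
  using scal.subspace_0[OF gen_closed_subspace[OF U(1)]] scal.subspace_0[OF gen_closed_subspace[OF W(1)]]
  by (intro pr_unique) auto

lemma pr_scal: "y \<in> keyspan T \<Longrightarrow> pr (scal c y) = scal c (pr y)"
  using pr_mem[of y] U(1) W(1)
  by (intro pr_unique) (auto simp flip: scal.scale_right_diff_distrib intro: scal.subspace_scale gen_closed_subspace)

lemma pr_add: "x \<in> keyspan T \<Longrightarrow> y \<in> keyspan T \<Longrightarrow> pr (x + y) = pr x + pr y"
  using pr_mem[of x] pr_mem[of y] scal.subspace_add[OF gen_closed_subspace[OF U(1)], of "pr x" "pr y"]
    scal.subspace_add[OF gen_closed_subspace[OF W(1)], of "x - pr x" "y - pr y"]
  by (intro pr_unique) (simp_all add: algebra_simps)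

lemma pr_gact: "y \<in> keyspan T \<Longrightarrow> gen_index g \<in> {1..n - 1} \<Longrightarrow> pr (gact q n g y) = gact q n g (pr y)"
  using pr_mem[of y] gen_closed_gact[OF U(1), of g "pr y"] gen_closed_gact[OF W(1), of g "y - pr y"]
  by (intro pr_unique) (simp_all add: lin_ext_diff)

lemma xpow_T: "\<alpha> \<in> T \<Longrightarrow> xpow n \<alpha> \<in> keyspan T"
  by (rule xpow_in_keyspan)

text \<open>The default 0 fits the action: a move out of T leaves \<open>Zplus n\<close> or has
  coefficient 0. So \<open>P_step\<close> holds without a condition on the moved \<alpha>.\<close>

definition P :: "midx \<Rightarrow> midx \<Rightarrow> 'k" where
  "P \<alpha> \<beta> = (if \<alpha> \<in> T then Poly_Mapping.lookup (pr (xpow n \<alpha>)) \<beta> else 0)"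

lemma P_outside: "\<beta> \<notin> T \<Longrightarrow> P \<alpha> \<beta> = 0"
  using subsetD[OF U(2) pr_mem(1)[OF xpow_T, of \<alpha>]] unfolding P_def keyspan_def
  by (auto simp: in_keys_iff subset_iff)

text \<open>Both sides are the coefficient at \<open>tr a b \<beta>\<close> of the projected image
  of the monomial at \<alpha>, once applying the generator after \<open>pr\<close> and once
  before.\<close>

lemma P_step:
  assumes "\<alpha> \<in> T" "adj n a b" "tr a b \<beta> \<in> Zplus n"
  shows "qint q (\<beta> b + 1) * P \<alpha> \<beta> = qint q (\<alpha> b + 1) * P (tr a b \<alpha>) (tr a b \<beta>)"
proof -
  let ?c = "qint q (\<alpha> b + 1)"
  have "qint q (\<beta> b + 1) * P \<alpha> \<beta> = Poly_Mapping.lookup (tact q n a b (pr (xpow n \<alpha>))) (tr a b \<beta>)"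
    using assms(1,3) lookup_tact[OF assms(2), of q "pr (xpow n \<alpha>)" \<beta>] by (simp add: P_def)
  also have "tact q n a b (pr (xpow n \<alpha>)) = pr (scal ?c (xpow n (tr a b \<alpha>)))"
    using pr_gact[OF xpow_T[OF assms(1)] trgen_index[OF assms(2)]]
    unfolding gact_xpow[OF trgen_index[OF assms(2)]] trgen_shift[OF assms(2)] trgen_coef[OF assms(2)] by simp
  also have "Poly_Mapping.lookup \<dots> (tr a b \<beta>) = ?c * P (tr a b \<alpha>) (tr a b \<beta>)"
  proof (cases "tr a b \<alpha> \<in> T")
    case True
    then show ?thesis by (simp add: pr_scal[OF xpow_T] P_def)
  next
    case False
    then have "tr a b \<alpha> \<notin> Zplus n \<or> ?c = 0" using step_T[OF assms(1,2)] by blast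
    then have "scal ?c (xpow n (tr a b \<alpha>)) = (0 :: midx \<Rightarrow>\<^sub>0 'k)" by (auto simp: xpow_def)
    then show ?thesis using False by (simp only: pr_0 lookup_zero P_def if_False mult_zero_right)
  qed
  finally show ?thesis .
qed

text \<open>Off the diagonal the quantum integers at \<open>\<alpha>\<close> and \<open>\<beta>\<close> may differ by a sign, because
  \<open>[l k + r] = (q powi l) ^ k * [r]\<close>. So only the vanishing of \<open>P \<alpha> \<beta>\<close> is transported there.\<close>

definition linked :: "midx \<Rightarrow> midx \<Rightarrow> midx \<Rightarrow> midx \<Rightarrow> bool" where
  "linked \<alpha> \<beta> \<alpha>' \<beta>' \<longleftrightarrow> (P \<alpha> \<beta> = 0 \<longleftrightarrow> P \<alpha>' \<beta>' = 0) \<and> (\<alpha> = \<beta> \<longleftrightarrow> \<alpha>' = \<beta>') \<and> (\<alpha> = \<beta> \<longrightarrow> P \<alpha> \<beta> = P \<alpha>' \<beta>')"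

lemma linked_refl: "linked \<alpha> \<beta> \<alpha> \<beta>"
  by (simp add: linked_def)

lemma linked_sym: "linked \<alpha> \<beta> \<alpha>' \<beta>' \<Longrightarrow> linked \<alpha>' \<beta>' \<alpha> \<beta>"
  by (auto simp: linked_def)

lemma linked_trans: "linked \<alpha> \<beta> \<alpha>' \<beta>' \<Longrightarrow> linked \<alpha>' \<beta>' \<alpha>'' \<beta>'' \<Longrightarrow> linked \<alpha> \<beta> \<alpha>'' \<beta>''"
  unfolding linked_def by metis

lemma linked_step:
  assumes "\<alpha> \<in> T" "adj n a b" "tr a b \<beta> \<in> Zplus n" "qint q (\<alpha> b + 1) \<noteq> 0" "qint q (\<beta> b + 1) \<noteq> 0"
  shows "linked \<alpha> \<beta> (tr a b \<alpha>) (tr a b \<beta>)"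
  using P_step[OF assms(1-3)] assms(4,5) tr_inj[OF adj_neq[OF assms(2)]]
  by (auto simp: linked_def)

text \<open>By \<open>rstep_coef\<close> a residue step has nonzero coefficient for both \<kappa>
  and \<kappa>', so the two indices are walked simultaneously.\<close>

lemma linked_block:
  assumes "\<kappa> \<in> energies n m E" "\<kappa>' \<in> energies n m E" "\<rho> \<in> residues n l (s - int l * E)" "\<rho>' \<in> residues n l (s - int l * E)"
  shows "linked (comb l \<kappa> \<rho>) (comb l \<kappa>' \<rho>) (comb l \<kappa> \<rho>') (comb l \<kappa>' \<rho>')"
proof -
  have "(rstep n l)\<^sup>*\<^sup>* \<rho> \<rho>'"
    by (rule residues_connected[OF assms(3,4) l_pos(2)])
  then have "linked (comb l \<kappa> \<rho>) (comb l \<kappa>' \<rho>) (comb l \<kappa> \<rho>') (comb l \<kappa>' \<rho>') \<and> \<rho>' \<in> residues n l (s - int l * E)"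
  proof (induction rule: rtranclp_induct)
    case base
    then show ?case using linked_refl assms(3) by blast
  next
    case (step \<sigma> \<sigma>')
    then have \<sigma>: "\<sigma> \<in> residues n l (s - int l * E)" and \<sigma>': "\<sigma>' \<in> residues n l (s - int l * E)"
      using rstep_residues by blast+
    obtain a b where ab: "adj n a b" "0 < \<sigma> a" "\<sigma> b < int l - 1" "\<sigma>' = tr a b \<sigma>"
      using step(2) unfolding rstep_def by blast
    have "tr a b (comb l \<kappa>' \<sigma>) \<in> Zplus n"
      using comb_T[OF assms(2) \<sigma>'] unfolding tr_comb ab(4) by (auto dest: Zplus_truncD)
    then have "linked (comb l \<kappa> \<sigma>) (comb l \<kappa>' \<sigma>) (tr a b (comb l \<kappa> \<sigma>)) (tr a b (comb l \<kappa>' \<sigma>))"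
      by (intro linked_step comb_T[OF assms(1) \<sigma>] ab(1) rstep_coef[OF \<sigma> ab(3)])
    then have "linked (comb l \<kappa> \<sigma>) (comb l \<kappa>' \<sigma>) (comb l \<kappa> \<sigma>') (comb l \<kappa>' \<sigma>')"
      unfolding tr_comb ab(4) .
    then show ?case using step linked_trans \<sigma>' by blast
  qed
  then show ?thesis by blast
qed

section \<open>Exchanging energy at a fixed level\<close>

abbreviation "bump \<kappa> a \<equiv> \<kappa>(a := \<kappa> a + 1 :: int)"

context
  fixes E :: int
  assumes S: "int l \<le> s - int l * E" "s - int l * E \<le> int n * (int l - 1)"
begin

text \<open>In contrast to \<open>raise_exists\<close>, b and \<rho> are chosen before \<kappa>, so
  one choice serves both indices of P.\<close>

lemma raise_setup:
  assumes "a \<in> {1..n}"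
  obtains b \<rho> where "adj n a b" "\<rho> \<in> residues n l (s - int l * E)" "\<rho> a = int l - 1" "0 < \<rho> b"
    "\<And>\<kappa>. qint q (tr b a (comb l \<kappa> \<rho>) b + 1) \<noteq> 0" "\<And>\<kappa>. tr a b (tr b a (comb l \<kappa> \<rho>)) = comb l \<kappa> \<rho>"
proof -
  obtain b where ab: "adj n a b" using adj_exists[of n a] assms n3 by auto
  obtain \<rho> where \<rho>: "\<rho> \<in> residues n l (s - int l * E)" "\<rho> a = int l - 1" "0 < \<rho> b"
    using residues_exists_high[OF adj_in[OF ab] adj_neq[OF ab] l_pos(2) S] by blast
  have "\<not> int l dvd \<rho> b"
    using \<rho>(3) residuesD(2)[OF \<rho>(1) l_pos(1), of b] zdvd_imp_le by fastforce
  then have "qint q (tr b a (comb l \<kappa> \<rho>) b + 1) \<noteq> 0" for \<kappa>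
    using adj_neq[OF ab] by (simp add: qint_0_iff comb_def dvd_add_right_iff tr_simps)
  then show ?thesis using that[OF ab \<rho>] tr_tr adj_neq[OF ab] by metis
qed

lemma bump_energies:
  assumes "\<kappa> \<in> energies n m E'" "a \<in> {1..n}" "\<kappa> a < m - 1"
  shows "bump \<kappa> a \<in> energies n m (E' + 1)"
  using Zplus_truncD[OF assms(1)] assms(2,3)
  by (auto simp: Zplus_trunc_def Zplus_def mabs_upd simp del: One_nat_def)

text \<open>One drop takes a pair at level E + 1 to a pair at level E with nonzero coefficients on
  both sides; \<open>linked_block\<close> on either level makes the residues arbitrary.\<close>

lemma linked_bump:
  assumes \<kappa>: "\<kappa> \<in> energies n m E" "\<kappa>' \<in> energies n m E" and a: "a \<in> {1..n}" "\<kappa> a < m - 1" "\<kappa>' a < m - 1"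
    and \<rho>: "\<rho> \<in> residues n l (s - int l * E)" and \<sigma>: "\<sigma> \<in> residues n l (s - int l * (E + 1))"
  shows "linked (comb l \<kappa> \<rho>) (comb l \<kappa>' \<rho>) (comb l (bump \<kappa> a) \<sigma>) (comb l (bump \<kappa>' a) \<sigma>)"
proof -
  obtain b \<rho>1 where b: "adj n a b" "\<rho>1 \<in> residues n l (s - int l * E)" "\<rho>1 a = int l - 1" "0 < \<rho>1 b"
    "\<And>\<kappa>. qint q (tr b a (comb l \<kappa> \<rho>1) b + 1) \<noteq> 0" "\<And>\<kappa>. tr a b (tr b a (comb l \<kappa> \<rho>1)) = comb l \<kappa> \<rho>1"
    using raise_setup[OF a(1)] by metis
  note r = raise_energy[OF \<kappa>(1) b(2,1) a(2) b(3,4)] and r' = raise_energy[OF \<kappa>(2) b(2,1) a(3) b(3,4)]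
  let ?\<sigma>1 = "\<rho>1(a := 0, b := \<rho>1 b - 1)"
  have \<sigma>1: "?\<sigma>1 \<in> residues n l (s - int l * (E + 1))" using r(3) by (simp add: algebra_simps)
  have "linked (comb l (bump \<kappa> a) ?\<sigma>1) (comb l (bump \<kappa>' a) ?\<sigma>1) (comb l \<kappa> \<rho>1) (comb l \<kappa>' \<rho>1)"
  proof -
    have "linked (tr b a (comb l \<kappa> \<rho>1)) (tr b a (comb l \<kappa>' \<rho>1))
        (tr a b (tr b a (comb l \<kappa> \<rho>1))) (tr a b (tr b a (comb l \<kappa>' \<rho>1)))"
    proof (intro linked_step b(1,5))
      show "tr b a (comb l \<kappa> \<rho>1) \<in> T" unfolding r(1) by (rule comb_T[OF r(2) \<sigma>1])
      show "tr a b (tr b a (comb l \<kappa>' \<rho>1)) \<in> Zplus n"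
        unfolding b(6) by (rule Zplus_truncD(1)[OF comb_T[OF \<kappa>(2) b(2)]])
    qed
    then show ?thesis unfolding b(6) unfolding r(1) r'(1) .
  qed
  then show ?thesis
    using linked_block[OF \<kappa> \<rho> b(2)] linked_block[OF r(2) r'(2) \<sigma>1 \<sigma>] linked_sym linked_trans by blast
qed

lemma higher_residue: obtains \<sigma> where "\<sigma> \<in> residues n l (s - int l * (E + 1))"
proof -
  have "0 \<le> s - int l * (E + 1)" "s - int l * (E + 1) \<le> int n * (1 * int l - 1)"
    using S l_pos by (auto simp: algebra_simps)
  then have "residues n l (s - int l * (E + 1)) \<noteq> {}"
    using l_pos by (intro Zplus_trunc_exists) auto
  then show ?thesis using that by blast
qed

text \<open>Lowering j is a bump at j read backwards: bumping the old pair at i and the new pair at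
  j gives the same pair at level E + 1.\<close>

lemma linked_exchange:
  assumes \<kappa>: "\<kappa> \<in> energies n m E" "\<kappa>' \<in> energies n m E" and ij: "i \<in> {1..n}" "j \<in> {1..n}" "i \<noteq> j"
    and i: "\<kappa> i < m - 1" "\<kappa>' i < m - 1" and j: "0 < \<kappa> j" "0 < \<kappa>' j"
    and \<rho>: "\<rho> \<in> residues n l (s - int l * E)"
  shows "linked (comb l \<kappa> \<rho>) (comb l \<kappa>' \<rho>)
      (comb l (\<kappa>(i := \<kappa> i + 1, j := \<kappa> j - 1)) \<rho>) (comb l (\<kappa>'(i := \<kappa>' i + 1, j := \<kappa>' j - 1)) \<rho>)"
    and "\<kappa>(i := \<kappa> i + 1, j := \<kappa> j - 1) \<in> energies n m E"
    and "\<kappa>'(i := \<kappa>' i + 1, j := \<kappa>' j - 1) \<in> energies n m E"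
proof -
  have down: "\<mu>(i := \<mu> i + 1, j := \<mu> j - 1) \<in> energies n m E" if "\<mu> \<in> energies n m E" "\<mu> i < m - 1" "0 < \<mu> j" for \<mu>
  proof -
    have "\<mu> j - 1 < m" using Zplus_truncD(3)[OF that(1) ij(2)] by simp
    then show ?thesis
      using Zplus_truncD[OF that(1)] that(2,3) ij
      by (auto simp: Zplus_trunc_def Zplus_def mabs_upd simp del: One_nat_def)
  qed
  let ?\<kappa> = "\<kappa>(i := \<kappa> i + 1, j := \<kappa> j - 1)" and ?\<kappa>' = "\<kappa>'(i := \<kappa>' i + 1, j := \<kappa>' j - 1)"
  show k: "?\<kappa> \<in> energies n m E" "?\<kappa>' \<in> energies n m E" using down \<kappa> i j by blast+
  obtain \<sigma> where \<sigma>: "\<sigma> \<in> residues n l (s - int l * (E + 1))" by (rule higher_residue)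
  have "\<kappa> j \<le> m - 1" "\<kappa>' j \<le> m - 1" using Zplus_truncD(3)[OF \<kappa>(1) ij(2)] Zplus_truncD(3)[OF \<kappa>(2) ij(2)] by simp_all
  then have "linked (comb l ?\<kappa> \<rho>) (comb l ?\<kappa>' \<rho>) (comb l (bump ?\<kappa> j) \<sigma>) (comb l (bump ?\<kappa>' j) \<sigma>)"
    using ij by (intro linked_bump k \<rho> \<sigma>) auto
  moreover have "bump ?\<kappa> j = bump \<kappa> i" "bump ?\<kappa>' j = bump \<kappa>' i"
    using ij(3) by (auto simp: fun_eq_iff)
  ultimately show "linked (comb l \<kappa> \<rho>) (comb l \<kappa>' \<rho>) (comb l ?\<kappa> \<rho>) (comb l ?\<kappa>' \<rho>)"
    using linked_bump[OF \<kappa> ij(1) i \<rho> \<sigma>] linked_sym linked_trans by metis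
qed

text \<open>After a bump at i the residue sum is small enough for a residue \<sigma> with \<sigma> j
  = 0. Moving out of j then takes the first index out of \<open>Zplus n\<close>, since its entry at
  j is 0, while the second index moves with nonzero coefficient; \<open>P_step\<close> forces P to
  vanish.\<close>

lemma P_zero_low:
  assumes \<kappa>: "\<kappa> \<in> energies n m E" "\<kappa>' \<in> energies n m E" and ij: "i \<in> {1..n}" "j \<in> {1..n}" "i \<noteq> j"
    and i: "\<kappa> i < m - 1" "\<kappa>' i < m - 1" and j: "\<kappa> j = 0" "0 < \<kappa>' j"
    and \<rho>: "\<rho> \<in> residues n l (s - int l * E)"
  shows "P (comb l \<kappa> \<rho>) (comb l \<kappa>' \<rho>) = 0"
proof -
  obtain b where b: "adj n j b" using adj_exists[of n j] ij(2) n3 by auto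
  have S': "0 \<le> s - int l * (E + 1)" "s - int l * (E + 1) \<le> int n * (int l - 1) - int l"
    using S by (auto simp: algebra_simps)
  obtain \<sigma> where \<sigma>: "\<sigma> \<in> residues n l (s - int l * (E + 1))" "\<sigma> j = 0" "\<sigma> b < int l - 1"
    using residues_exists_low[OF adj_in[OF b] adj_neq[OF b] l_pos(2) S'] by blast
  let ?\<alpha> = "comb l (bump \<kappa> i) \<sigma>" and ?\<beta> = "comb l (bump \<kappa>' i) \<sigma>"
  have \<alpha>: "?\<alpha> \<in> T" and \<beta>: "?\<beta> \<in> T" by (intro comb_T[OF _ \<sigma>(1)] bump_energies \<kappa> ij i)+
  have "tr j b ?\<alpha> \<notin> Zplus n"
    using tr_Zplus_iff[OF Zplus_truncD(1)[OF \<alpha>] b] ij(3) j(1) \<sigma>(2) by (simp add: comb_def)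
  then have "P (tr j b ?\<alpha>) (tr j b ?\<beta>) = 0" by (auto simp: P_def dest: Zplus_truncD)
  moreover have "tr j b ?\<beta> \<in> Zplus n"
    using tr_Zplus_iff[OF Zplus_truncD(1)[OF \<beta>] b] ij(3) j(2) \<sigma>(2) l_pos by (simp add: comb_def)
  ultimately have "P ?\<alpha> ?\<beta> = 0"
    using P_step[OF \<alpha> b, of ?\<beta>] rstep_coef[OF \<sigma>(1,3), of "bump \<kappa>' i"] by simp
  then show ?thesis using linked_bump[OF \<kappa> ij(1) i \<rho> \<sigma>(1)] by (simp add: linked_def)
qed

text \<open>Raised at i, the second index gets the entry m l and leaves T, so P is 0 on the raised
  pair; the drop back, with nonzero coefficient at the first index, transports this to the given
  pair.\<close>

lemma P_zero_high:
  assumes \<kappa>: "\<kappa> \<in> energies n m E" "\<kappa>' \<in> energies n m E" and i: "i \<in> {1..n}" "\<kappa> i < m - 1" "\<kappa>' i = m - 1"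
    and \<rho>: "\<rho> \<in> residues n l (s - int l * E)"
  shows "P (comb l \<kappa> \<rho>) (comb l \<kappa>' \<rho>) = 0"
proof -
  obtain b \<rho>1 where b: "adj n i b" "\<rho>1 \<in> residues n l (s - int l * E)" "\<rho>1 i = int l - 1" "0 < \<rho>1 b"
    "\<And>\<kappa>. qint q (tr b i (comb l \<kappa> \<rho>1) b + 1) \<noteq> 0" "\<And>\<kappa>. tr i b (tr b i (comb l \<kappa> \<rho>1)) = comb l \<kappa> \<rho>1"
    using raise_setup[OF i(1)] by metis
  note r = raise_energy[OF \<kappa>(1) b(2,1) i(2) b(3,4)]
  let ?\<alpha> = "tr b i (comb l \<kappa> \<rho>1)" and ?\<beta> = "tr b i (comb l \<kappa>' \<rho>1)"
  have "?\<alpha> \<in> T"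
    unfolding r(1) using r(3) by (intro comb_T[OF r(2)]) (simp add: algebra_simps)
  moreover have "?\<beta> i = m * int l"
    by (simp add: tr_simps comb_def b(3) i(3)) (simp add: algebra_simps)
  then have "?\<beta> \<notin> T" using Zplus_truncD(3)[of ?\<beta> n l m s i] i(1) by auto
  moreover have "tr i b ?\<beta> \<in> Zplus n" unfolding b(6) using comb_T[OF \<kappa>(2) b(2)] by (auto dest: Zplus_truncD)
  ultimately have "P (comb l \<kappa> \<rho>1) (comb l \<kappa>' \<rho>1) = 0"
    using P_step[of ?\<alpha> i b ?\<beta>] b(1,5,6) P_outside by simp
  then show ?thesis using linked_block[OF \<kappa> \<rho> b(2)] by (simp add: linked_def)
qed

lemma energies_le:
  assumes "\<kappa> \<in> energies n m E" "i \<in> {1..n}" shows "0 \<le> \<kappa> i" "\<kappa> i \<le> E" "\<kappa> i \<le> m - 1"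
proof -
  note z = Zplus_truncD[OF assms(1)]
  show "0 \<le> \<kappa> i" "\<kappa> i \<le> m - 1" using ZplusD[OF z(1)] z(3)[OF assms(2)] by auto
  have "\<kappa> i \<le> sum \<kappa> {1..n}" using ZplusD[OF z(1)] assms(2) by (intro member_le_sum) auto
  then show "\<kappa> i \<le> E" using z(2) by (simp add: mabs_def)
qed

text \<open>With E < m - 1 no entry can be full. Energy is shifted from j to a neighbour in both
  indices until \<kappa> j = 0 < \<kappa>' j, where \<open>P_zero_low\<close> applies.\<close>

lemma P_zero_small:
  assumes "E < m - 1" "\<kappa> \<in> energies n m E" "\<kappa>' \<in> energies n m E" "j \<in> {1..n}" "\<kappa> j < \<kappa>' j"
    and \<rho>: "\<rho> \<in> residues n l (s - int l * E)"
  shows "P (comb l \<kappa> \<rho>) (comb l \<kappa>' \<rho>) = 0"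
  using assms(2,3,5)
proof (induction "nat (\<kappa> j)" arbitrary: \<kappa> \<kappa>' rule: less_induct)
  case less
  obtain i where "adj n j i" using adj_exists[of n j] assms(4) n3 by auto
  then have i: "i \<in> {1..n}" "i \<noteq> j" by (auto simp: adj_def)
  have lt: "\<kappa> i < m - 1" "\<kappa>' i < m - 1"
    using energies_le(2)[OF less.prems(1) i(1)] energies_le(2)[OF less.prems(2) i(1)] assms(1) by auto
  show ?case
  proof (cases "\<kappa> j = 0")
    case True
    then show ?thesis using less.prems(3) by (intro P_zero_low[OF less.prems(1,2) i(1) assms(4) i(2) lt _ _ \<rho>]) auto
  next
    case False
    then have pos: "0 < \<kappa> j" "0 < \<kappa>' j" using energies_le(1)[OF less.prems(1) assms(4)] less.prems(3) by auto
    note ex = linked_exchange[OF less.prems(1,2) i(1) assms(4) i(2) lt pos \<rho>]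
    have "P (comb l (\<kappa>(i := \<kappa> i + 1, j := \<kappa> j - 1)) \<rho>) (comb l (\<kappa>'(i := \<kappa>' i + 1, j := \<kappa>' j - 1)) \<rho>) = 0"
      using pos less.prems(3) by (intro less.hyps ex(2,3)) auto
    then show ?thesis using ex(1) by (simp add: linked_def)
  qed
qed

text \<open>Shift energy onto \<open>j\<close> in both indices until \<open>\<kappa>' j\<close> hits the upper wall, or
  some other entry of \<open>\<kappa>\<close> alone is 0, or all of \<open>\<kappa>'\<close> sits at \<open>j\<close>, which forces \<open>E < m - 1\<close>.\<close>

lemma P_zero_less:
  assumes "\<kappa> \<in> energies n m E" "\<kappa>' \<in> energies n m E" "j \<in> {1..n}" "\<kappa> j < \<kappa>' j"
    and \<rho>: "\<rho> \<in> residues n l (s - int l * E)"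
  shows "P (comb l \<kappa> \<rho>) (comb l \<kappa>' \<rho>) = 0"
  using assms(1,2,4)
proof (induction "nat (m - 1 - \<kappa>' j)" arbitrary: \<kappa> \<kappa>' rule: less_induct)
  case less
  note le = energies_le[OF less.prems(1)] and le' = energies_le[OF less.prems(2)]
  consider "\<kappa>' j = m - 1"
    | i where "\<kappa>' j < m - 1" "i \<in> {1..n}" "i \<noteq> j" "0 < \<kappa> i" "0 < \<kappa>' i"
    | i where "\<kappa>' j < m - 1" "i \<in> {1..n}" "i \<noteq> j" "\<kappa> i = 0" "0 < \<kappa>' i"
    | "\<kappa>' j < m - 1" "\<forall>i\<in>{1..n}. i \<noteq> j \<longrightarrow> \<kappa>' i = 0"
    using le(1) le'(1) le'(3)[OF assms(3)] by (metis order_le_less)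
  then show ?case
  proof cases
    case 1
    then show ?thesis using less.prems(3) by (intro P_zero_high[OF less.prems(1,2) assms(3) _ _ \<rho>]) auto
  next
    case 2
    note ex = linked_exchange[OF less.prems(1,2) assms(3) 2(2) 2(3)[symmetric] _ 2(1) 2(4,5) \<rho>]
    have "P (comb l (\<kappa>(j := \<kappa> j + 1, i := \<kappa> i - 1)) \<rho>) (comb l (\<kappa>'(j := \<kappa>' j + 1, i := \<kappa>' i - 1)) \<rho>) = 0"
      using 2 less.prems(3) by (intro less.hyps ex(2,3)) auto
    then show ?thesis using ex(1) 2(1) less.prems(3) by (simp add: linked_def)
  next
    case 3
    then show ?thesis
      using less.prems(3) by (intro P_zero_low[OF less.prems(1,2) assms(3) 3(2) 3(3)[symmetric] _ _ _ _ \<rho>]) auto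
  next
    case 4
    have "E = sum \<kappa>' {1..n}" using Zplus_truncD(2)[OF less.prems(2)] by (simp add: mabs_def)
    also have "\<dots> = \<kappa>' j + sum \<kappa>' ({1..n} - {j})" using assms(3) by (intro sum.remove) auto
    also have "sum \<kappa>' ({1..n} - {j}) = 0" using 4(2) by (intro sum.neutral) auto
    finally have "E < m - 1" using 4(1) by simp
    then show ?thesis by (intro P_zero_small[OF _ less.prems(1,2) assms(3) less.prems(3) \<rho>])
  qed
qed

lemma energies_less_exists:
  assumes "\<kappa> \<in> energies n m E" "\<kappa>' \<in> energies n m E" "\<kappa> \<noteq> \<kappa>'"
  shows "\<exists>j\<in>{1..n}. \<kappa> j < \<kappa>' j"
proof (rule ccontr)
  assume "\<not> ?thesis"
  then have le: "\<kappa>' j \<le> \<kappa> j" if "j \<in> {1..n}" for j using that by (auto simp: not_less)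
  have "sum \<kappa>' {1..n} = sum \<kappa> {1..n}"
    using Zplus_truncD(2)[OF assms(1)] Zplus_truncD(2)[OF assms(2)] by (simp add: mabs_def)
  then have "\<kappa>' j = \<kappa> j" if "j \<in> {1..n}" for j
    using sum_mono_inv[of \<kappa>' "{1..n}" \<kappa> j] le that by auto
  moreover have "\<kappa>' j = \<kappa> j" if "j \<notin> {1..n}" for j
    using Zplus_outside[OF Zplus_truncD(1)[OF assms(1)] that] Zplus_outside[OF Zplus_truncD(1)[OF assms(2)] that] by simp
  ultimately have "\<kappa>' j = \<kappa> j" for j by (cases "j \<in> {1..n}")
  then show False using assms(3) by (simp add: fun_eq_iff)
qed

text \<open>An exchange towards \<kappa>' shortens the entrywise distance; on the diagonal both
  quantum integers in \<open>P_step\<close> agree, so \<open>linked\<close> preserves the value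
  itself.\<close>

lemma P_diagonal_const:
  assumes "\<kappa> \<in> energies n m E" "\<kappa>' \<in> energies n m E" and \<rho>: "\<rho> \<in> residues n l (s - int l * E)"
  shows "P (comb l \<kappa> \<rho>) (comb l \<kappa> \<rho>) = P (comb l \<kappa>' \<rho>) (comb l \<kappa>' \<rho>)"
  using assms(1)
proof (induction "nat (\<Sum>i=1..n. \<bar>\<kappa> i - \<kappa>' i\<bar>)" arbitrary: \<kappa> rule: less_induct)
  case less
  show ?case
  proof (cases "\<kappa> = \<kappa>'")
    case False
    obtain i where i: "i \<in> {1..n}" "\<kappa> i < \<kappa>' i" using energies_less_exists[OF less.prems assms(2) False] by blast
    obtain j where j: "j \<in> {1..n}" "\<kappa>' j < \<kappa> j" using energies_less_exists[OF assms(2) less.prems] False by metis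
    have ij: "i \<noteq> j" using i j by auto
    have lt: "\<kappa> i < m - 1" "0 < \<kappa> j" using i j energies_le[OF assms(2) i(1)] energies_le[OF assms(2) j(1)] by auto
    let ?\<kappa> = "\<kappa>(i := \<kappa> i + 1, j := \<kappa> j - 1)"
    note ex = linked_exchange[OF less.prems less.prems i(1) j(1) ij lt(1) lt(1) lt(2) lt(2) \<rho>]
    have "(\<Sum>t=1..n. \<bar>?\<kappa> t - \<kappa>' t\<bar>) < (\<Sum>t=1..n. \<bar>\<kappa> t - \<kappa>' t\<bar>)"
      using i j ij by (intro sum_strict_mono_ex1 ballI) (auto intro: bexI[of _ i])
    moreover have "0 \<le> (\<Sum>t=1..n. \<bar>?\<kappa> t - \<kappa>' t\<bar>)" by (intro sum_nonneg) auto
    ultimately have "P (comb l ?\<kappa> \<rho>) (comb l ?\<kappa> \<rho>) = P (comb l \<kappa>' \<rho>) (comb l \<kappa>' \<rho>)"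
      by (intro less.hyps ex(2)) linarith
    then show ?thesis using ex(1) by (simp add: linked_def)
  qed simp
qed

end

text \<open>The v in the simple block with \<open>pr v\<close> in the bottom level form a submodule,
  so they are all or nothing. If nothing, the image of the block meets the bottom level in 0 only,
  and \<open>min_energy_vector\<close> makes the image 0.\<close>

lemma pr_B0:
  assumes "\<beta> \<in> B0" shows "pr (xpow n \<beta>) \<in> keyspan B0"
proof -
  let ?V = "keyspan (Blk \<beta>) :: (midx \<Rightarrow>\<^sub>0 'k) set"
  have VT: "?V \<subseteq> keyspan T" by (intro keyspan_mono) auto
  have VA: "?V \<subseteq> AA" using VT T_AA by blast
  have Vc: "gen_closed q n ?V" by (rule gen_closed_Blk[OF assms])
  have simple: "X = {0} \<or> X = ?V" if "gen_closed q n X" "X \<subseteq> ?V" for X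
    using Blk_simple[OF assms] that unfolding simple_iff[OF VA] by blast
  let ?V' = "{v \<in> ?V. pr v \<in> keyspan B0}"
  have sub: "?V' \<subseteq> ?V" by (rule Collect_restrict)
  have "gen_closed q n ?V'"
    unfolding gen_closed_def scal.subspace_def
  proof (intro conjI allI ballI impI CollectI)
    fix x y assume "x \<in> ?V'" "y \<in> ?V'"
    moreover from this have "x \<in> keyspan T" "y \<in> keyspan T" using VT by blast+
    ultimately show "x + y \<in> ?V" "pr (x + y) \<in> keyspan B0"
      by (auto simp: pr_add intro!: scal.subspace_add keyspan_subspace)
  next
    fix c x assume "x \<in> ?V'"
    moreover from this have "x \<in> keyspan T" using VT by blast
    ultimately show "scal c x \<in> ?V" "pr (scal c x) \<in> keyspan B0"
      by (auto simp: pr_scal intro!: scal.subspace_scale keyspan_subspace)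
  next
    fix g x assume "x \<in> ?V'" and g: "gen_index g \<in> {1..n - 1}"
    moreover from this have "x \<in> keyspan T" using VT by blast
    ultimately show "gact q n g x \<in> ?V" "pr (gact q n g x) \<in> keyspan B0"
      using gen_closed_gact[OF Vc g] gen_closed_gact[OF gen_closed_B0 g] by (auto simp only: pr_gact)
  qed (auto simp: pr_0 intro: scal.subspace_0 keyspan_subspace)
  then have "?V' = {0} \<or> ?V' = ?V" using sub by (rule simple)
  then show ?thesis
  proof
    assume V'0: "?V' = {0}"
    have "gen_closed q n (pr ` ?V)"
      unfolding gen_closed_def scal.subspace_def
    proof (intro conjI allI ballI impI)
      show "0 \<in> pr ` ?V"
        by (rule image_eqI[of _ _ 0]) (simp_all add: pr_0 scal.subspace_0[OF keyspan_subspace])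
    next
      fix x y assume "x \<in> pr ` ?V" "y \<in> pr ` ?V"
      then obtain u v where "x = pr u" "y = pr v" "u \<in> ?V" "v \<in> ?V" by blast
      moreover from this have "u \<in> keyspan T" "v \<in> keyspan T" using VT by blast+
      ultimately show "x + y \<in> pr ` ?V"
        by (intro image_eqI[of _ _ "u + v"]) (simp_all add: pr_add scal.subspace_add[OF keyspan_subspace])
    next
      fix c x assume "x \<in> pr ` ?V"
      then obtain u where "x = pr u" "u \<in> ?V" by blast
      moreover from this have "u \<in> keyspan T" using VT by blast
      ultimately show "scal c x \<in> pr ` ?V"
        by (intro image_eqI[of _ _ "scal c u"]) (simp_all add: pr_scal scal.subspace_scale[OF keyspan_subspace])
    next
      fix g x assume g: "gen_index g \<in> {1..n - 1}" and "x \<in> pr ` ?V"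
      then obtain u where "x = pr u" "u \<in> ?V" by blast
      moreover from this have "u \<in> keyspan T" using VT by blast
      ultimately show "gact q n g x \<in> pr ` ?V"
        by (intro image_eqI[of _ _ "gact q n g u"]) (simp_all only: pr_gact[OF _ g] gen_closed_gact[OF Vc g])
    qed
    note c1 = this
    have c2: "pr ` ?V \<subseteq> keyspan T" using pr_mem(1) U(2) VT by blast
    have "z = 0" if z: "z \<in> pr ` ?V" "z \<in> keyspan B0" for z
    proof -
      obtain v where v: "v \<in> ?V" "z = pr v" using z(1) by blast
      then have "v \<in> ?V'" using z(2) by simp
      then have "v = 0" unfolding V'0 by simp
      then show ?thesis using v(2) pr_0 by simp
    qed
    then have img: "pr ` ?V = {0}"
      using min_energy_vector[OF c1 c2] by blast
    have "xpow n \<beta> \<in> ?V" using assms by (intro xpow_in_keyspan) auto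
    then have "pr (xpow n \<beta>) \<in> pr ` ?V" by (rule imageI)
    then have "pr (xpow n \<beta>) = 0" unfolding img by simp
    then show ?thesis by (simp add: scal.subspace_0[OF keyspan_subspace])
  next
    assume "?V' = ?V"
    moreover have "xpow n \<beta> \<in> ?V" using assms by (intro xpow_in_keyspan) auto
    ultimately have "xpow n \<beta> \<in> ?V'" by simp
    then show ?thesis by simp
  qed
qed

text \<open>\<open>pr\<close> commutes with \<open>e\<close>, so the image is killed by all
  \<open>e\<close>; as terms do not cancel, all its terms are primitive. Having minimal energy they
  share the residue of \<beta>, and \<open>P_zero_less\<close> removes those with another
  quotient.\<close>

lemma pr_primitive:
  assumes \<beta>: "\<beta> \<in> B0" "primitive n l \<beta>"
  shows "pr (xpow n \<beta>) = scal (P \<beta> \<beta>) (xpow n \<beta>)"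
proof -
  have \<beta>T: "\<beta> \<in> T" and \<beta>E: "Edeg_idx n l \<beta> = E0" using \<beta>(1) by auto
  have "Poly_Mapping.lookup (pr (xpow n \<beta>)) \<gamma> = 0" if "\<gamma> \<noteq> \<beta>" for \<gamma>
  proof (rule ccontr)
    assume nz: "Poly_Mapping.lookup (pr (xpow n \<beta>)) \<gamma> \<noteq> 0"
    then have key: "\<gamma> \<in> Poly_Mapping.keys (pr (xpow n \<beta>))" by (simp add: in_keys_iff)
    then have "\<gamma> \<in> B0" using pr_B0[OF \<beta>(1)] by (auto simp: keyspan_def)
    then have \<gamma>: "\<gamma> \<in> T" "Edeg_idx n l \<gamma> = E0" by auto
    have "primitive n l \<gamma>"
      unfolding primitive_def
    proof
      fix i assume i: "i \<in> {1..n - 1}"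
      note ad = adj_Suc[OF i]
      have "int l dvd \<beta> i + 1 \<or> \<beta> (Suc i) = 0" using \<beta>(2) i unfolding primitive_def by blast
      then have "scal (qint q (\<beta> i + 1)) (xpow n (tr (Suc i) i \<beta>)) = (0 :: midx \<Rightarrow>\<^sub>0 'k)"
        using tr_Zplus_iff[OF Zplus_truncD(1)[OF \<beta>T] ad] by (auto simp: qint_0_iff xpow_def)
      then have "tact q n (Suc i) i (pr (xpow n \<beta>)) = pr 0"
        unfolding pr_gact[OF xpow_T[OF \<beta>T] trgen_index[OF ad], symmetric]
          gact_xpow[OF trgen_index[OF ad]] trgen_shift[OF ad] trgen_coef[OF ad] by (rule arg_cong)
      then have "tr (Suc i) i \<gamma> \<notin> Poly_Mapping.keys (tact q n (Suc i) i (pr (xpow n \<beta>)))" by (simp add: pr_0)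
      then have "\<not> 0 < \<gamma> (Suc i) \<or> int l dvd \<gamma> i + 1"
        using keys_tact_iff[OF ad] key tr_Zplus_iff[OF Zplus_truncD(1)[OF \<gamma>(1)] ad] qint_0_iff by blast
      then show "int l dvd \<gamma> i + 1 \<or> \<gamma> (Suc i) = 0"
        using ZplusD[OF Zplus_truncD(1)[OF \<gamma>(1)], of "Suc i"] by auto
    qed
    then have rem: "rem l \<gamma> = rem l \<beta>"
      using primitive_rem_unique[OF _ \<beta>(2) \<gamma>(1) \<beta>T] \<gamma>(2) \<beta>E by simp
    let ?\<rho> = "rem l \<beta>"
    have eq: "\<beta> = comb l (quo l \<beta>) ?\<rho>" "\<gamma> = comb l (quo l \<gamma>) ?\<rho>"
      using comb_quo_rem[of l \<beta>] comb_quo_rem[of l \<gamma>] rem by simp_all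
    have k: "quo l \<beta> \<in> energies n m E0" "quo l \<gamma> \<in> energies n m E0"
      using quo_energies[OF \<beta>T] quo_energies[OF \<gamma>(1)] \<beta>E \<gamma>(2) by simp_all
    have \<rho>: "?\<rho> \<in> residues n l (s - int l * E0)" using rem_residues[OF \<beta>T] \<beta>E by simp
    have S2: "s - int l * E0 \<le> int n * (int l - 1)" using mabs_const_bound(1)[OF \<rho>] by simp
    have "quo l \<beta> \<noteq> quo l \<gamma>" using eq that by metis
    then obtain j where "j \<in> {1..n}" "quo l \<beta> j < quo l \<gamma> j"
      using energies_less_exists[OF S0 S2 k] by blast
    then have "P \<beta> \<gamma> = 0" using P_zero_less[OF S0 S2 k _ _ \<rho>] eq by metis
    then show False using nz \<beta>T by (simp add: P_def)
  qed
  moreover have "\<beta> \<in> Zplus n" using \<beta>T by (auto dest: Zplus_truncD)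
  ultimately show ?thesis
    using \<beta>T by (intro poly_mapping_eqI) (simp add: xpow_def lookup_single when_def P_def)
qed

lemma P_primitive_const:
  assumes "\<beta> \<in> B0" "primitive n l \<beta>" "\<gamma> \<in> B0" "primitive n l \<gamma>"
  shows "P \<beta> \<beta> = P \<gamma> \<gamma>"
proof -
  have T: "\<beta> \<in> T" "\<gamma> \<in> T" and E: "Edeg_idx n l \<beta> = E0" "Edeg_idx n l \<gamma> = E0" using assms by auto
  have rem: "rem l \<gamma> = rem l \<beta>"
    using primitive_rem_unique[OF assms(4,2) T(2,1)] E by simp
  have \<rho>: "rem l \<beta> \<in> residues n l (s - int l * E0)" using rem_residues[OF T(1)] E by simp
  have S2: "s - int l * E0 \<le> int n * (int l - 1)" using mabs_const_bound(1)[OF \<rho>] by simp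
  have "P (comb l (quo l \<beta>) (rem l \<beta>)) (comb l (quo l \<beta>) (rem l \<beta>)) =
      P (comb l (quo l \<gamma>) (rem l \<beta>)) (comb l (quo l \<gamma>) (rem l \<beta>))"
    using quo_energies[OF T(1)] quo_energies[OF T(2)] E by (intro P_diagonal_const[OF S0 S2 _ _ \<rho>]) simp_all
  then show ?thesis using comb_quo_rem[of l \<beta>] comb_quo_rem[of l \<gamma>] rem by simp
qed

lemma B0_subset_if_primitive:
  assumes X: "gen_closed q n X" and "\<And>\<beta>. \<beta> \<in> B0 \<Longrightarrow> primitive n l \<beta> \<Longrightarrow> xpow n \<beta> \<in> X"
  shows "keyspan B0 \<subseteq> X"
proof (rule keyspan_subset)
  show "B0 \<subseteq> Zplus n" by (auto dest: Zplus_truncD)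
  fix \<gamma> assume \<gamma>: "\<gamma> \<in> B0"
  then obtain \<beta> where \<beta>: "\<beta> \<in> T" "quo l \<beta> = quo l \<gamma>" "primitive n l \<beta>"
    using primitive_in_block[of \<gamma>] by blast
  then have "\<beta> \<in> B0" using \<gamma> by (simp add: Edeg_idx_eq)
  then show "xpow n \<gamma> \<in> X"
    using block_reach[OF X assms(2) \<beta>(1)] \<beta> \<gamma> by simp
qed (rule gen_closed_subspace[OF X])

text \<open>On primitive monomials of minimal energy \<open>pr\<close> is one scalar c, which puts
  them into W if c = 0 and into U otherwise. They generate \<open>keyspan B0\<close>, which every
  nonzero submodule meets nontrivially.\<close>

lemma trivial_summand: "U = {0} \<or> W = {0}"
proof (rule ccontr)
  assume "\<not> ?thesis"
  then have ne: "U \<noteq> {0}" "W \<noteq> {0}" by blast+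
  obtain u where u: "u \<in> U" "u \<noteq> 0" "u \<in> keyspan B0"
    using min_energy_vector[OF U ne(1)] by blast
  obtain w where w: "w \<in> W" "w \<noteq> 0" "w \<in> keyspan B0"
    using min_energy_vector[OF W ne(2)] by blast
  obtain \<beta>' where "\<beta>' \<in> T" "Edeg_idx n l \<beta>' = E0" by (rule E0_attained)
  then obtain \<beta> where "\<beta> \<in> T" "quo l \<beta> = quo l \<beta>'" "primitive n l \<beta>"
    using primitive_in_block[of \<beta>'] by blast
  then have \<beta>: "\<beta> \<in> B0" "primitive n l \<beta>" using \<open>Edeg_idx n l \<beta>' = E0\<close> by (simp_all add: Edeg_idx_eq)
  define c where "c = P \<beta> \<beta>"
  have pr: "pr (xpow n \<gamma>) = scal c (xpow n \<gamma>)" if "\<gamma> \<in> B0" "primitive n l \<gamma>" for \<gamma>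
    unfolding c_def using pr_primitive[OF that] P_primitive_const[OF \<beta> that] by simp
  show False
  proof (cases "c = 0")
    case True
    have "keyspan B0 \<subseteq> W"
    proof (rule B0_subset_if_primitive[OF W(1)])
      fix \<gamma> assume \<gamma>: "\<gamma> \<in> B0" "primitive n l \<gamma>"
      then have "xpow n \<gamma> \<in> keyspan T" by (intro xpow_T) simp
      then have "xpow n \<gamma> - scal c (xpow n \<gamma>) \<in> W" unfolding pr[OF \<gamma>, symmetric] by (rule pr_mem(2))
      then show "xpow n \<gamma> \<in> W" using True by simp
    qed
    then show False using u UW by blast
  next
    case False
    have "keyspan B0 \<subseteq> U"
    proof (rule B0_subset_if_primitive[OF U(1)])
      fix \<gamma> assume \<gamma>: "\<gamma> \<in> B0" "primitive n l \<gamma>"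
      then have "xpow n \<gamma> \<in> keyspan T" by (intro xpow_T) simp
      then have "scal c (xpow n \<gamma>) \<in> U" unfolding pr[OF \<gamma>, symmetric] by (rule pr_mem(1))
      then show "xpow n \<gamma> \<in> U"
        using scal.subspace_scale[OF gen_closed_subspace[OF U(1)], of _ "inverse c"] False by force
    qed
    then show False using w UW by blast
  qed
qed

end

section \<open>The explicit highest weight vectors\<close>

lemma eta_mid_residue:
  assumes "j < n" "0 \<le> h" "h \<le> int l - 1"
  shows "eta_mid l j h \<in> residues n l (int j * (int l - 1) + h)"
proof -
  have "mabs n (eta_mid l j h) = sum (eta_mid l j h) {1..Suc j}"
    unfolding mabs_def using assms(1) by (intro sum.mono_neutral_right) (auto simp: eta_mid_def)
  also have "\<dots> = sum (eta_mid l j h) {1..j} + h"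
    by (simp add: eta_mid_def)
  also have "sum (eta_mid l j h) {1..j} = (\<Sum>i=1..j. int l - 1)"
    by (intro sum.cong) (auto simp: eta_mid_def)
  finally show ?thesis
    using assms by (auto simp: Zplus_trunc_def Zplus_def eta_mid_def)
qed

lemma primitive_eta_mid: "primitive n l (eta_mid l j h)"
  by (auto simp: primitive_def eta_mid_def)

text \<open>The first n - 1 residues are all l - 1, so the divisibility alternative holds at every i
  for any \<kappa>; zero entries would in general not survive adding multiples of l.\<close>

lemma primitive_comb_eta_mid: "primitive n l (comb l \<kappa> (eta_mid l (n - 1) h))"
  by (auto simp: primitive_def comb_def eta_mid_def)

lemma eta_low_eq: "eta_low s = eta_mid l 0 s"
  by (auto simp: eta_low_def eta_mid_def)

lemma eta_kappa_eq:
  assumes "n \<ge> 1" "\<And>i. i \<notin> {1..n} \<Longrightarrow> k i = 0"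
  shows "eta_kappa n l h k = comb l k (eta_mid l (n - 1) h)"
  using assms by (auto simp: eta_kappa_def comb_def eta_mid_def fun_eq_iff)

lemma eta_high_eq:
  assumes "n \<ge> 1"
  shows "eta_high n l m h = comb l (\<lambda>i. if i \<in> {1..n} then m - 1 else 0) (eta_mid l (n - 1) h)"
  using assms by (auto simp: eta_high_def comb_def eta_mid_def fun_eq_iff algebra_simps)

lemma wp_eq:
  assumes "n \<ge> 1"
  shows "wp n l m kap h = (\<lambda>\<kappa>. comb l \<kappa> (eta_mid l (n - 1) h)) ` energies n m kap"
proof (intro equalityI subsetI)
  fix \<eta> assume "\<eta> \<in> wp n l m kap h"
  then obtain k where k: "\<eta> = eta_kappa n l h k" "(\<Sum>i=1..n. k i) = kap" "\<forall>i\<in>{1..n}. 0 \<le> k i \<and> k i \<le> m - 1"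
    unfolding wp_def by blast
  \<comment> \<open>In \<open>wp\<close> the values of k outside {1..n} are arbitrary, whereas an
    energy vanishes there.\<close>
  let ?k = "\<lambda>i. if i \<in> {1..n} then k i else 0"
  have "eta_kappa n l h k = eta_kappa n l h ?k"
    using assms by (auto simp: eta_kappa_def fun_eq_iff)
  also have "\<dots> = comb l ?k (eta_mid l (n - 1) h)"
    using assms by (intro eta_kappa_eq) auto
  moreover have "?k \<in> energies n m kap"
    using k by (auto simp: Zplus_trunc_def Zplus_def mabs_def)
  ultimately show "\<eta> \<in> (\<lambda>\<kappa>. comb l \<kappa> (eta_mid l (n - 1) h)) ` energies n m kap" using k(1) by auto
next
  fix \<eta> assume "\<eta> \<in> (\<lambda>\<kappa>. comb l \<kappa> (eta_mid l (n - 1) h)) ` energies n m kap"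
  then obtain k where k: "k \<in> energies n m kap" "\<eta> = comb l k (eta_mid l (n - 1) h)" by blast
  note z = Zplus_truncD[OF k(1)]
  have "\<eta> = eta_kappa n l h k" using k(2) eta_kappa_eq[OF assms] Zplus_outside[OF z(1)] by simp
  then show "\<eta> \<in> wp n l m kap h"
    unfolding wp_def using z(2) z(3) ZplusD[OF z(1)] by (intro CollectI exI[of _ k]) (auto simp: mabs_def)
qed

context truncated
begin

lemma indecomposable:
  assumes "int l \<le> s - int l * E0"
  shows "uq_indecomposable q n (keyspan T)"
  unfolding indecomposable_module_def lsubmodule_iff[OF T_AA]
proof (intro conjI subset_refl gen_closed_T notI)
  obtain \<beta> where "\<beta> \<in> T" by (rule E0_attained)
  then have "xpow n \<beta> \<in> keyspan T" "xpow n \<beta> \<noteq> (0 :: midx \<Rightarrow>\<^sub>0 'k)"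
    by (auto intro!: xpow_in_keyspan dest: xpow_nonzero)
  then show False if "keyspan T = {0 :: midx \<Rightarrow>\<^sub>0 'k}" using that by blast
next
  assume "\<exists>U W. (U \<subseteq> keyspan T \<and> gen_closed q n U) \<and> (W \<subseteq> keyspan T \<and> gen_closed q n W) \<and> U \<noteq> {0} \<and> W \<noteq> {0} \<and>
          U \<inter> W = {0} \<and> keyspan T = {u + w |u w. u \<in> U \<and> w \<in> W}"
  then obtain U W where *: "U \<subseteq> keyspan T" "gen_closed q n U" "W \<subseteq> keyspan T" "gen_closed q n W"
    "U \<noteq> {0}" "W \<noteq> {0}" "U \<inter> W = {0}" "keyspan T = {u + w |u w. u \<in> U \<and> w \<in> W}"
    by blast
  interpret split_module q n l m s U W
    by unfold_locales (fact * assms)+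
  show False using trivial_summand *(5,6) by blast
qed

lemma highest_weight:
  assumes "\<beta> \<in> T" "primitive n l \<beta>"
  shows "highest_weight_vector q n (Vmod q n \<beta>) (xpow n \<beta>)"
  unfolding highest_weight_vector_def
proof (intro conjI ballI)
  show "xpow n \<beta> \<in> Vmod q n \<beta>" by (rule Vmod_self[OF assms(1)])
  show "xpow n \<beta> \<noteq> (0 :: midx \<Rightarrow>\<^sub>0 'k)" by (rule xpow_nonzero[OF assms(1)])
  show "Vmod q n \<beta> = uq_cyclic q n (xpow n \<beta>)" by (rule Vmod_def)
  fix i assume i: "i \<in> {1..n - 1}"
  then have g: "gen_index (gK i) \<in> {1..n - 1}" "gen_index (gE i) \<in> {1..n - 1}" by simp_all
  show "\<exists>c. uq_act q n (uq_gen q n (gK i)) (xpow n \<beta>) = scal c (xpow n \<beta>)"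
    unfolding uq_gen_act[OF g(1) xpow_AA[OF assms(1)]] gact_xpow[OF g(1)] by auto
  have "int l dvd \<beta> i + 1 \<or> \<beta> (Suc i) = 0" using assms(2) i unfolding primitive_def by blast
  moreover have "shift (gE i) \<beta> (Suc i) = \<beta> (Suc i) - 1" by simp
  ultimately have "coef q (gE i) \<beta> = 0 \<or> shift (gE i) \<beta> \<notin> Zplus n"
    using ZplusD[of "shift (gE i) \<beta>" n "Suc i"] by (auto simp: qint_0_iff)
  then show "uq_act q n (uq_gen q n (gE i)) (xpow n \<beta>) = 0"
    unfolding uq_gen_act[OF g(2) xpow_AA[OF assms(1)]] gact_xpow[OF g(2)] by (auto simp: xpow_def)
qed

lemma E0_eqI:
  assumes "\<beta> \<in> T" "Edeg_idx n l \<beta> = E" "\<And>\<gamma>. \<gamma> \<in> T \<Longrightarrow> E \<le> Edeg_idx n l \<gamma>"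
  shows "E0 = E"
  using assms E0_le E0_attained by (metis order.antisym)

lemma Blk_subset_B0: "\<beta> \<in> B0 \<Longrightarrow> Blk \<beta> \<subseteq> B0"
  by (auto simp: Edeg_idx_eq)

lemma zero_energies: "(\<lambda>_. 0) \<in> energies n m 0"
  using m1 by (auto simp: Zplus_trunc_def Zplus_def mabs_def)

lemma E0_low:
  assumes "s \<le> int n * (int l - 1)"
  shows "E0 = 0"
proof -
  obtain \<rho> where "\<rho> \<in> residues n l (s - int l * 0)"
    using Zplus_trunc_exists[of 1 l s n] s0 assms l_pos by auto
  then show ?thesis
    using comb_T[OF zero_energies, of \<rho>] Edeg_comb[OF zero_energies, of \<rho>] Edeg_nonneg by (intro E0_eqI) auto
qed

lemma top_residue_mem:
  assumes "s = kap * int l + h + (int n - 1) * (int l - 1)" "0 \<le> h" "h \<le> int l - 1"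
  shows "eta_mid l (n - 1) h \<in> residues n l (s - int l * kap)"
proof -
  have "int (n - 1) * (int l - 1) + h = s - int l * kap"
    using assms(1) n3 by (simp add: of_nat_diff mult.commute)
  then show ?thesis using eta_mid_residue[of "n - 1" n h l] assms(2,3) n3 by simp
qed

text \<open>The residue sum h + (n - 1) (l - 1) falls short of its maximum n (l - 1) by less than l,
  so lowering the energy by 1 would overshoot.\<close>

lemma E0_high:
  assumes "s = kap * int l + h + (int n - 1) * (int l - 1)" "0 \<le> h" "h \<le> int l - 1" "0 \<le> kap" "kap \<le> int n * (m - 1)"
  shows "E0 = kap"
proof -
  obtain \<kappa> where \<kappa>: "\<kappa> \<in> energies n m kap"
    using Zplus_trunc_exists[of m 1 kap n] m1 assms(4,5) by auto
  note \<rho> = top_residue_mem[OF assms(1-3)]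
  show ?thesis
  proof (rule E0_eqI)
    show "comb l \<kappa> (eta_mid l (n - 1) h) \<in> T" by (rule comb_T[OF \<kappa> \<rho>])
    show "Edeg_idx n l (comb l \<kappa> (eta_mid l (n - 1) h)) = kap" by (rule Edeg_comb[OF \<kappa> \<rho>])
    fix \<gamma> assume "\<gamma> \<in> T"
    then have "s - int l * Edeg_idx n l \<gamma> \<le> int n * (int l - 1)"
      using mabs_const_bound(1)[OF rem_residues] by simp
    then have "int l * (kap - 1) < int l * Edeg_idx n l \<gamma>"
      using assms(1,2) l_pos by (simp add: algebra_simps)
    then show "kap \<le> Edeg_idx n l \<gamma>" using l_pos by (simp add: mult_less_cancel_left)
  qed
qed

text \<open>With only one quotient, every energy is minimal and T is a single simple block.\<close>

lemma single_block:
  assumes "\<eta> \<in> T" "primitive n l \<eta>" "\<And>\<beta>. \<beta> \<in> T \<Longrightarrow> quo l \<beta> = quo l \<eta>"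
  shows "keyspan T = Vmod q n \<eta>" "uq_simple q n (keyspan T)"
    "highest_weight_vector q n (keyspan T) (xpow n \<eta>)"
proof -
  have "E0 = Edeg_idx n l \<eta>"
    by (rule E0_eqI[OF assms(1) refl]) (simp add: Edeg_idx_eq assms(3))
  then have \<eta>: "\<eta> \<in> B0" using assms(1) by simp
  have "Blk \<eta> = T" using assms(3) by blast
  then show eq: "keyspan T = Vmod q n \<eta>" using Vmod_eq_Blk[OF \<eta>] by simp
  show "uq_simple q n (keyspan T)" using Blk_simple[OF \<eta>] \<open>Blk \<eta> = T\<close> by simp
  show "highest_weight_vector q n (keyspan T) (xpow n \<eta>)"
    unfolding eq by (rule highest_weight[OF assms(1,2)])
qed

lemma quo_zero:
  assumes "\<beta> \<in> T" "Edeg_idx n l \<beta> = 0"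
  shows "quo l \<beta> = (\<lambda>_. 0)"
  using Zplus_mabs_0[OF Zplus_truncD(1)[OF quo_energies[OF assms(1)]]] assms(2) by (simp add: Edeg_idx_eq)

lemma eta_mid_T:
  assumes "s = int j * (int l - 1) + h" "j < n" "0 \<le> h" "h \<le> int l - 1"
  shows "eta_mid l j h \<in> T" "quo l (eta_mid l j h) = (\<lambda>_. 0)"
proof -
  have \<rho>: "eta_mid l j h \<in> residues n l (s - int l * 0)" using eta_mid_residue[OF assms(2-4)] assms(1) by simp
  have eq: "comb l (\<lambda>_. 0) (eta_mid l j h) = eta_mid l j h" by (simp add: comb_def)
  show "eta_mid l j h \<in> T" using comb_T[OF zero_energies \<rho>] eq by simp
  show "quo l (eta_mid l j h) = (\<lambda>_. 0)" using quo_comb[OF \<rho> l_pos(1), of "\<lambda>_. 0"] eq by simp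
qed

lemma low_case:
  assumes "s \<le> int l - 1"
  shows "keyspan T = Vmod q n (eta_low s)" "uq_simple q n (keyspan T)"
    "highest_weight_vector q n (keyspan T) (xpow n (eta_low s))"
proof -
  have \<eta>: "eta_mid l 0 s \<in> T" "quo l (eta_mid l 0 s) = (\<lambda>_. 0)"
    using eta_mid_T[of 0 s] s0 assms n3 by simp_all
  have quo: "quo l \<beta> = quo l (eta_mid l 0 s)" if \<beta>: "\<beta> \<in> T" for \<beta>
  proof -
    have "int l * Edeg_idx n l \<beta> \<le> s"
      using mabs_const_bound(2)[OF rem_residues[OF \<beta>]] by simp
    then have "int l * Edeg_idx n l \<beta> < int l * 1" using assms by linarith
    then have "Edeg_idx n l \<beta> < 1" using l_pos by (subst (asm) mult_less_cancel_left_pos) auto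
    then show ?thesis using quo_zero[OF \<beta>] \<eta>(2) Edeg_nonneg[OF \<beta>] by simp
  qed
  show "keyspan T = Vmod q n (eta_low s)" "uq_simple q n (keyspan T)"
    "highest_weight_vector q n (keyspan T) (xpow n (eta_low s))"
    unfolding eta_low_eq[of s l] using single_block[OF \<eta>(1) primitive_eta_mid quo] by blast+
qed

lemma full_energies: "(\<lambda>i. if i \<in> {1..n} then m - 1 else 0) \<in> energies n m (int n * (m - 1))"
  using m1 by (auto simp: Zplus_trunc_def Zplus_def mabs_def)

text \<open>The minimal energy n (m - 1) is also the largest that the box allows, so every quotient
  is constantly m - 1.\<close>

lemma high_case:
  assumes "s = int n * (m - 1) * int l + (int n - 1) * (int l - 1) + h" "0 \<le> h" "h \<le> int l - 1"
  shows "mabs n (eta_high n l m h) = s" "keyspan T = Vmod q n (eta_high n l m h)" "uq_simple q n (keyspan T)"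
    "highest_weight_vector q n (keyspan T) (xpow n (eta_high n l m h))"
proof -
  let ?\<kappa> = "\<lambda>i. if i \<in> {1..n} then m - 1 else 0" and ?\<rho> = "eta_mid l (n - 1) h"
  have \<rho>: "?\<rho> \<in> residues n l (s - int l * (int n * (m - 1)))"
    using assms by (intro top_residue_mem) (simp_all add: mult_ac)
  have eq: "eta_high n l m h = comb l ?\<kappa> ?\<rho>" using n3 by (intro eta_high_eq) simp
  have \<eta>: "comb l ?\<kappa> ?\<rho> \<in> T" by (rule comb_T[OF full_energies \<rho>])
  have E: "E0 = int n * (m - 1)"
    using assms m1 by (intro E0_high[of _ h]) simp_all
  have quo: "quo l \<beta> = quo l (comb l ?\<kappa> ?\<rho>)" if \<beta>: "\<beta> \<in> T" for \<beta>
  proof -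
    note k = Zplus_truncD[OF quo_energies[OF \<beta>]]
    have le: "quo l \<beta> i \<le> ?\<kappa> i" if "i \<in> {1..n}" for i using k(3)[OF that] that by simp
    have "int n * (m - 1) \<le> mabs n (quo l \<beta>)" using E0_le[OF \<beta>] E by (simp add: Edeg_idx_eq)
    moreover have "mabs n (quo l \<beta>) \<le> sum ?\<kappa> {1..n}" unfolding mabs_def by (intro sum_mono le)
    ultimately have "sum (quo l \<beta>) {1..n} = sum ?\<kappa> {1..n}" by (simp add: mabs_def)
    then have "quo l \<beta> i = ?\<kappa> i" if "i \<in> {1..n}" for i
      using sum_mono_inv[of "quo l \<beta>" "{1..n}" ?\<kappa> i] le that by blast
    moreover have "quo l \<beta> i = ?\<kappa> i" if "i \<notin> {1..n}" for i
      using Zplus_outside[OF k(1) that] that by auto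
    ultimately have "quo l \<beta> i = ?\<kappa> i" for i by blast
    then show ?thesis using quo_comb[OF \<rho> l_pos(1)] by (simp add: fun_eq_iff)
  qed
  show "mabs n (eta_high n l m h) = s" unfolding eq by (rule Zplus_truncD(2)[OF \<eta>])
  show "keyspan T = Vmod q n (eta_high n l m h)" "uq_simple q n (keyspan T)"
    "highest_weight_vector q n (keyspan T) (xpow n (eta_high n l m h))"
    unfolding eq using single_block[OF \<eta> primitive_comb_eta_mid quo] by blast+
qed

text \<open>Minimal energy 0 forces the quotient 0, so the bottom level is one block.\<close>

lemma mid_case:
  assumes "s = int j * (int l - 1) + h" "j < n" "0 \<le> h" "h \<le> int l - 1"
  shows "keyspan B0 = Vmod q n (eta_mid l j h)" "uq_simple q n (keyspan B0)"
    "highest_weight_vector q n (Vmod q n (eta_mid l j h)) (xpow n (eta_mid l j h))"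
proof -
  note \<eta> = eta_mid_T[OF assms]
  have "s \<le> int (Suc j) * (int l - 1)" using assms(1,4) by (simp add: algebra_simps)
  also have "\<dots> \<le> int n * (int l - 1)" using assms(2) l_pos by (intro mult_right_mono) auto
  finally have E: "E0 = 0" by (rule E0_low)
  have "Edeg_idx n l (eta_mid l j h) = 0" using \<eta>(2) by (simp add: Edeg_idx_eq mabs_def)
  then have \<eta>B: "eta_mid l j h \<in> B0" using \<eta>(1) E by simp
  have "Blk (eta_mid l j h) = B0"
  proof (rule equalityI[OF Blk_subset_B0[OF \<eta>B]], rule subsetI)
    fix \<beta> assume "\<beta> \<in> B0"
    then show "\<beta> \<in> Blk (eta_mid l j h)" using quo_zero[of \<beta>] \<eta>(2) E by simp
  qed
  then show "keyspan B0 = Vmod q n (eta_mid l j h)" "uq_simple q n (keyspan B0)"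
    using Vmod_eq_Blk[OF \<eta>B] Blk_simple[OF \<eta>B] by simp_all
  show "highest_weight_vector q n (Vmod q n (eta_mid l j h)) (xpow n (eta_mid l j h))"
    by (rule highest_weight[OF \<eta>(1) primitive_eta_mid])
qed

section \<open>The decomposition of the non-simple socle\<close>

context
  fixes kap h :: int
  assumes s_eq: "s = kap * int l + h + (int n - 1) * (int l - 1)" and h: "0 \<le> h" "h \<le> int l - 1"
    and kap: "1 \<le> kap" "kap \<le> int n * (m - 1) - 1"
begin

abbreviation "top_residue \<equiv> eta_mid l (n - 1) h"

lemma E0_kap: "E0 = kap"
  using s_eq h kap by (intro E0_high[of _ h]) auto

lemma top_residue: "top_residue \<in> residues n l (s - int l * kap)"
  by (rule top_residue_mem[OF s_eq h])

lemma quo_top: "quo l (comb l \<kappa> top_residue) = \<kappa>"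
  by (rule quo_comb[OF top_residue l_pos(1)])

lemma wp_B0: "\<kappa> \<in> energies n m kap \<Longrightarrow> comb l \<kappa> top_residue \<in> B0"
  using comb_T[OF _ top_residue] Edeg_comb[OF _ top_residue] E0_kap by auto

lemma wp_alt: "wp n l m kap h = (\<lambda>\<kappa>. comb l \<kappa> top_residue) ` energies n m kap"
  using n3 by (intro wp_eq) simp

lemma wp_Vmod: "\<eta> \<in> wp n l m kap h \<Longrightarrow> \<eta> \<in> B0 \<and> Vmod q n \<eta> = keyspan (Blk \<eta>)"
  using wp_B0 Vmod_eq_Blk unfolding wp_alt by blast

lemma wp_highest_weight:
  assumes "\<eta> \<in> wp n l m kap h"
  shows "highest_weight_vector q n (Vmod q n \<eta>) (xpow n \<eta>)"
  using assms wp_B0 primitive_comb_eta_mid unfolding wp_alt by (blast intro: highest_weight)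

text \<open>Distinct elements of \<open>wp\<close> have distinct quotients, so their blocks have
  disjoint supports.\<close>

lemma Soc_direct_sum: "is_direct_sum (keyspan B0) (wp n l m kap h) (Vmod q n)"
  unfolding is_direct_sum_def
proof (intro conjI ballI equalityI)
  let ?I = "wp n l m kap h"
  have sub: "scal.subspace (module_sum J (Vmod q n))" if "J \<subseteq> ?I" for J
    using that wp_Vmod by (intro module_sum_subspace) (auto simp: keyspan_subspace subset_iff)
  show "keyspan B0 \<subseteq> module_sum ?I (Vmod q n)"
  proof (rule keyspan_subset[OF _ sub[OF subset_refl]])
    show "B0 \<subseteq> Zplus n" by (auto dest: Zplus_truncD)
    fix \<beta> assume \<beta>: "\<beta> \<in> B0"
    then have "quo l \<beta> \<in> energies n m kap" using quo_energies[of \<beta>] E0_kap by simp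
    then have \<eta>: "comb l (quo l \<beta>) top_residue \<in> ?I" unfolding wp_alt by (rule imageI)
    have "\<beta> \<in> Blk (comb l (quo l \<beta>) top_residue)" using \<beta> quo_top by simp
    then have "xpow n \<beta> \<in> Vmod q n (comb l (quo l \<beta>) top_residue)"
      unfolding conjunct2[OF wp_Vmod[OF \<eta>]] by (rule xpow_in_keyspan)
    then show "xpow n \<beta> \<in> module_sum ?I (Vmod q n)" by (rule module_sum_member[OF \<eta>])
  qed
  have le: "Vmod q n \<eta> \<subseteq> keyspan B0" if "\<eta> \<in> ?I" for \<eta>
    unfolding conjunct2[OF wp_Vmod[OF that]]
    by (rule keyspan_mono[OF Blk_subset_B0[OF conjunct1[OF wp_Vmod[OF that]]]])
  then show "module_sum ?I (Vmod q n) \<subseteq> keyspan B0"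
    by (intro module_sum_least keyspan_subspace)
  fix \<eta> assume \<eta>: "\<eta> \<in> ?I"
  have "module_sum (?I - {\<eta>}) (Vmod q n) \<subseteq> keyspan (T - Blk \<eta>)"
  proof (intro module_sum_least keyspan_subspace)
    fix \<eta>' assume \<eta>': "\<eta>' \<in> ?I - {\<eta>}"
    then have "quo l \<eta>' \<noteq> quo l \<eta>" using \<eta> quo_top unfolding wp_alt by auto
    then have "Blk \<eta>' \<subseteq> T - Blk \<eta>" by auto
    moreover have "\<eta>' \<in> ?I" using \<eta>' by blast
    ultimately show "Vmod q n \<eta>' \<subseteq> keyspan (T - Blk \<eta>)"
      unfolding conjunct2[OF wp_Vmod[OF \<open>\<eta>' \<in> ?I\<close>]] by (intro keyspan_mono)
  qed
  moreover have "keyspan (Blk \<eta>) \<inter> keyspan (T - Blk \<eta>) = {0 :: midx \<Rightarrow>\<^sub>0 'k}" by (rule keyspan_disjoint) blast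
  ultimately show "Vmod q n \<eta> \<inter> module_sum (?I - {\<eta>}) (Vmod q n) \<subseteq> {0}"
    unfolding conjunct2[OF wp_Vmod[OF \<eta>]] by blast
  show "{0} \<subseteq> Vmod q n \<eta> \<inter> module_sum (?I - {\<eta>}) (Vmod q n)"
    unfolding conjunct2[OF wp_Vmod[OF \<eta>]]
    using scal.subspace_0[OF sub[OF Diff_subset]] scal.subspace_0[OF keyspan_subspace] by blast
qed

text \<open>kap \<ge> 1 allows a unit at position 1, and kap \<le> n (m - 1) - 1 allows room at
  position 2 at the same time; moving that unit gives the second energy.\<close>

lemma two_energies: obtains \<kappa> \<kappa>' where "\<kappa> \<in> energies n m kap" "\<kappa>' \<in> energies n m kap" "\<kappa> \<noteq> \<kappa>'"
proof -
  have "int n * (m - 1) > 0" using kap by simp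
  then have m2: "m \<ge> 2" by (smt (verit) mult_nonneg_nonpos of_nat_0_le_iff)
  define lo hi where "lo = (\<lambda>i::nat. 0::int)(1 := 1)" and "hi = (\<lambda>i::nat. m - 1)(2 := m - 2)"
  have "sum lo {1..n} = 1" "sum hi {1..n} = int n * (m - 1) - 1"
    unfolding lo_def hi_def using n3 by (subst sum_fun_upd; simp)+
  moreover have "lo i \<le> hi i" "0 \<le> lo i" "hi i \<le> m - 1" for i using m2 by (auto simp: lo_def hi_def)
  ultimately obtain f where f: "\<forall>i\<in>{1..n}. lo i \<le> f i \<and> f i \<le> hi i" "\<forall>i. i \<notin> {1..n} \<longrightarrow> f i = 0" "sum f {1..n} = kap"
    using box_sum_exists[of "{1..n}" lo hi kap] kap by auto
  have f': "0 \<le> f i \<and> f i \<le> m - 1" if "i \<in> {1..n}" for i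
    using f(1)[rule_format, OF that] \<open>0 \<le> lo i\<close> \<open>hi i \<le> m - 1\<close> by linarith
  have f12: "1 \<le> f 1" "f 2 \<le> m - 2"
    using f(1)[rule_format, of 1] f(1)[rule_format, of 2] n3 by (auto simp: lo_def hi_def)
  have 1: "f \<in> energies n m kap" using f f' by (auto simp: Zplus_trunc_def Zplus_def mabs_def)
  have "tr 1 2 f \<in> Zplus n" using f12 1 n3 by (subst tr_Zplus_iff) (auto simp: adj_def dest: Zplus_truncD)
  moreover have "tr 1 2 f i \<le> m - 1" if "i \<in> {1..n}" for i using f'[OF that] f12 by (auto simp: tr_def)
  ultimately have 2: "tr 1 2 f \<in> energies n m kap"
    using mabs_tr[of 1 n 2 f] n3 Zplus_truncD(2)[OF 1] by (auto simp: Zplus_trunc_def)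
  have "tr 1 2 f \<noteq> f" using tr_simps(2)[of 1 2 f] by (metis add_cancel_right_right zero_neq_one)
  then show ?thesis using that 1 2 by metis
qed

lemma Soc_not_simple: "\<not> uq_simple q n (keyspan B0)"
proof
  assume simple: "uq_simple q n (keyspan B0)"
  have AA: "keyspan B0 \<subseteq> AA" using T_AA keyspan_mono[of B0 T] by blast
  obtain \<kappa> \<kappa>' where \<kappa>: "\<kappa> \<in> energies n m kap" "\<kappa>' \<in> energies n m kap" "\<kappa> \<noteq> \<kappa>'" by (rule two_energies)
  let ?\<eta> = "comb l \<kappa> top_residue" and ?\<eta>' = "comb l \<kappa>' top_residue"
  note \<eta> = wp_B0[OF \<kappa>(1)] and \<eta>' = wp_B0[OF \<kappa>(2)]
  have "keyspan (Blk ?\<eta>) \<subseteq> (keyspan B0 :: (midx \<Rightarrow>\<^sub>0 'k) set)"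
    by (rule keyspan_mono[OF Blk_subset_B0[OF \<eta>]])
  moreover have "keyspan (Blk ?\<eta>) \<noteq> {0 :: midx \<Rightarrow>\<^sub>0 'k}"
    using Blk_simple[OF \<eta>] by (auto simp: simple_module_def)
  ultimately have eq: "keyspan (Blk ?\<eta>) = (keyspan B0 :: (midx \<Rightarrow>\<^sub>0 'k) set)"
    using simple gen_closed_Blk[OF \<eta>] unfolding simple_iff[OF AA] by blast
  have "(xpow n ?\<eta>' :: midx \<Rightarrow>\<^sub>0 'k) \<in> keyspan (Blk ?\<eta>)" unfolding eq by (rule xpow_in_keyspan[OF \<eta>'])
  moreover have "?\<eta>' \<in> Zplus n" using \<eta>' by (auto dest: Zplus_truncD)
  ultimately have "?\<eta>' \<in> Blk ?\<eta>" by (simp add: keyspan_def xpow_def)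
  then show False using quo_top \<kappa>(3) by simp
qed

end

end

theorem theorem3p8:
  fixes q :: "'k::{alg_closed_field, field_char_0}"
    and n l :: nat and m s N :: int
  assumes "q \<noteq> 0" and "q \<noteq> 1" and "q \<noteq> - 1"
    and "n \<ge> 3" and "qchar q = l" and "l \<ge> 3" and "m \<ge> 1"
    and N_def: "N = int n * (m * int l - 1)"
    and "0 \<le> s" and "s \<le> N"
  shows
    "(\<forall>y\<in>Aq q n m s. y \<noteq> 0 \<longrightarrow> uq_simple q n (uq_cyclic q n y) \<longrightarrow> Edeg n l y = Emin n l m s)
   \<and> Soc q n (Aq q n m s) =
       scal.span (xpow n ` {\<alpha>\<in>Zplus_trunc n l m s. Edeg_idx n l \<alpha> = Emin n l m s})
   \<and> Aq q n m s =
       module_sum {\<alpha>\<in>Zplus_trunc n l m s. Edeg_idx n l \<alpha> = Emax n l m s} (Vmod q n)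
   \<and> (s \<le> int l - 1 \<longrightarrow>
       Aq q n m s = Vmod q n (eta_low s) \<and> uq_simple q n (Aq q n m s) \<and>
       highest_weight_vector q n (Aq q n m s) (xpow n (eta_low s)))
   \<and> (N - (int l - 1) \<le> s \<longrightarrow>
       (\<exists>h. 0 \<le> h \<and> h \<le> int l - 1 \<and>
         s = int n * (m - 1) * int l + (int n - 1) * (int l - 1) + h \<and>
         mabs n (eta_high n l m h) = s \<and>
         Aq q n m s = Vmod q n (eta_high n l m h) \<and> uq_simple q n (Aq q n m s) \<and>
         highest_weight_vector q n (Aq q n m s) (xpow n (eta_high n l m h))))
   \<and> (int l \<le> s \<and> s \<le> N - int l \<longrightarrow>
       uq_indecomposable q n (Aq q n m s)
     \<and> ((int l - 1) + 1 \<le> s \<and> s \<le> int n * (int l - 1) \<longrightarrow>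
         (\<exists>j h. 1 \<le> j \<and> j < n \<and> 1 \<le> h \<and> h \<le> int l - 1 \<and>
           s = int j * (int l - 1) + h \<and>
           mabs n (eta_mid l j h) = s \<and>
           Soc q n (Aq q n m s) = Vmod q n (eta_mid l j h) \<and>
           uq_simple q n (Soc q n (Aq q n m s)) \<and>
           highest_weight_vector q n (Vmod q n (eta_mid l j h)) (xpow n (eta_mid l j h))))
     \<and> (int n * (int l - 1) + 1 \<le> s \<and> s \<le> N - int l \<longrightarrow>
         (\<exists>kap h. 1 \<le> kap \<and> kap \<le> int n * (m - 1) - 1 \<and> 0 \<le> h \<and> h \<le> int l - 1 \<and>
           s = kap * int l + h + (int n - 1) * (int l - 1) \<and>
           is_direct_sum (Soc q n (Aq q n m s)) (wp n l m kap h) (Vmod q n) \<and>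
           \<not> uq_simple q n (Soc q n (Aq q n m s)) \<and>
           (\<forall>\<eta>\<in>wp n l m kap h. highest_weight_vector q n (Vmod q n \<eta>) (xpow n \<eta>)))))"
proof -
  interpret truncated q n l m s
    using assms by unfold_locales auto
  have l1: "int l - 1 \<ge> 0" using l_pos by simp
  have Aq: "Aq q n m s = keyspan T" by (rule Aq_eq)
  have B0_span: "scal.span (xpow n ` B0) = (keyspan B0 :: (midx \<Rightarrow>\<^sub>0 'k) set)"
    by (rule span_xpow) (auto dest: Zplus_truncD)
  have 1: "\<forall>y\<in>Aq q n m s. y \<noteq> 0 \<longrightarrow> uq_simple q n (uq_cyclic q n y) \<longrightarrow> Edeg n l y = Emin n l m s"
    unfolding Aq using simple_cyclic_Edeg by blast
  have 2: "Soc q n (Aq q n m s) = scal.span (xpow n ` B0)"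
    unfolding Aq B0_span by (rule Soc_eq)
  have 3: "Aq q n m s = module_sum {\<alpha>\<in>T. Edeg_idx n l \<alpha> = Emax n l m s} (Vmod q n)"
    unfolding Aq by (rule generated_by_top)
  have 4: "Aq q n m s = Vmod q n (eta_low s) \<and> uq_simple q n (Aq q n m s) \<and>
       highest_weight_vector q n (Aq q n m s) (xpow n (eta_low s))" if "s \<le> int l - 1"
    unfolding Aq using low_case[OF that] by blast
  have 5: "\<exists>h. 0 \<le> h \<and> h \<le> int l - 1 \<and>
         s = int n * (m - 1) * int l + (int n - 1) * (int l - 1) + h \<and>
         mabs n (eta_high n l m h) = s \<and>
         Aq q n m s = Vmod q n (eta_high n l m h) \<and> uq_simple q n (Aq q n m s) \<and>
         highest_weight_vector q n (Aq q n m s) (xpow n (eta_high n l m h))" if "N - (int l - 1) \<le> s"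
  proof -
    \<comment> \<open>N - (l - 1) = n (m - 1) l + (n - 1) (l - 1) is the value of s for h =
      0.\<close>
    define h where "h = s - (N - (int l - 1))"
    have h: "0 \<le> h" "h \<le> int l - 1" "s = int n * (m - 1) * int l + (int n - 1) * (int l - 1) + h"
      using that \<open>s \<le> N\<close> unfolding h_def N_def by (simp_all add: algebra_simps)
    then show ?thesis
      unfolding Aq using high_case[OF h(3,1,2)] by (intro exI[of _ h] conjI)
  qed
  have 6: "uq_indecomposable q n (Aq q n m s)"
    "(int l - 1) + 1 \<le> s \<and> s \<le> int n * (int l - 1) \<longrightarrow>
         (\<exists>j h. 1 \<le> j \<and> j < n \<and> 1 \<le> h \<and> h \<le> int l - 1 \<and>
           s = int j * (int l - 1) + h \<and>
           mabs n (eta_mid l j h) = s \<and>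
           Soc q n (Aq q n m s) = Vmod q n (eta_mid l j h) \<and>
           uq_simple q n (Soc q n (Aq q n m s)) \<and>
           highest_weight_vector q n (Vmod q n (eta_mid l j h)) (xpow n (eta_mid l j h)))"
    "int n * (int l - 1) + 1 \<le> s \<and> s \<le> N - int l \<longrightarrow>
         (\<exists>kap h. 1 \<le> kap \<and> kap \<le> int n * (m - 1) - 1 \<and> 0 \<le> h \<and> h \<le> int l - 1 \<and>
           s = kap * int l + h + (int n - 1) * (int l - 1) \<and>
           is_direct_sum (Soc q n (Aq q n m s)) (wp n l m kap h) (Vmod q n) \<and>
           \<not> uq_simple q n (Soc q n (Aq q n m s)) \<and>
           (\<forall>\<eta>\<in>wp n l m kap h. highest_weight_vector q n (Vmod q n \<eta>) (xpow n \<eta>)))"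
    if range: "int l \<le> s" "s \<le> N - int l"
  proof -
    have low: "\<exists>j h. 1 \<le> j \<and> j < n \<and> 1 \<le> h \<and> h \<le> int l - 1 \<and> s = int j * (int l - 1) + h"
      if "s \<le> int n * (int l - 1)"
    proof -
      define L where "L = int l - 1"
      have L: "0 < L" using l_pos by (simp add: L_def)
      \<comment> \<open>Dividing s - 1 instead of s lets h run through 1, ..., l - 1 instead of 0,
        ..., l - 2.\<close>
      define j h where "j = (s - 1) div L" and "h = (s - 1) mod L + 1"
      have "L \<le> s - 1" using range(1) by (simp add: L_def)
      then have "1 \<le> j" unfolding j_def using zdiv_mono1[of L "s - 1" L] L by simp
      moreover have "j * L \<le> s - 1"
        unfolding j_def minus_mod_eq_div_mult[symmetric] using pos_mod_sign[OF L, of "s - 1"] by linarith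
      then have "j * L < int n * L" using that by (simp add: L_def)
      then have "j < int n" using L by (simp add: mult_less_cancel_right)
      moreover have "1 \<le> h" "h \<le> L" 
        using pos_mod_bound[OF L, of "s - 1"] pos_mod_sign[OF L, of "s - 1"] unfolding h_def by linarith+
      moreover have "s = j * L + h" by (simp add: j_def h_def)
      ultimately show ?thesis
        by (intro exI[of _ "nat j"] exI[of _ h]) (auto simp: L_def)
    qed
    have high: "\<exists>kap h. 1 \<le> kap \<and> kap \<le> int n * (m - 1) - 1 \<and> 0 \<le> h \<and> h \<le> int l - 1 \<and>
           s = kap * int l + h + (int n - 1) * (int l - 1)" if big: "int n * (int l - 1) + 1 \<le> s"
    proof -
      \<comment> \<open>The part l kap + h of s. The bounds on s become l \<le> t < n (m - 1) l,
        which gives the range of kap.\<close>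
      define t where "t = s - (int n - 1) * (int l - 1)"
      define kap h where "kap = t div int l" and "h = t mod int l"
      have h: "0 \<le> h" "h \<le> int l - 1" 
        using l_pos pos_mod_bound[of "int l" t] pos_mod_sign[of "int l" t] unfolding h_def by linarith+
      have t: "t = kap * int l + h" by (simp add: kap_def h_def)
      have "int l \<le> t" using big by (simp add: t_def algebra_simps)
      then have "0 * int l < kap * int l" using t h by linarith
      then have "0 < kap" by (rule mult_right_less_imp_less) simp
      then have "1 \<le> kap" by simp
      moreover have "t < int n * (m - 1) * int l"
        using range(2) by (simp add: t_def N_def algebra_simps)
      then have "kap * int l < int n * (m - 1) * int l" using t h by linarith
      then have "kap < int n * (m - 1)" by (rule mult_right_less_imp_less) simp
      then have "kap \<le> int n * (m - 1) - 1" by simp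
      moreover have "s = kap * int l + h + (int n - 1) * (int l - 1)" using t by (simp add: t_def)
      ultimately show ?thesis using h by blast
    qed
    show "uq_indecomposable q n (Aq q n m s)"
      unfolding Aq
    proof (rule indecomposable)
      show "int l \<le> s - int l * E0"
      proof (cases "s \<le> int n * (int l - 1)")
        case True
        then show ?thesis using E0_low range(1) by simp
      next
        case False
        then obtain kap h where k: "1 \<le> kap" "kap \<le> int n * (m - 1) - 1" "0 \<le> h" "h \<le> int l - 1"
           "s = kap * int l + h + (int n - 1) * (int l - 1)" using high by auto
        \<comment> \<open>As n \<ge> 3, the residue sum h + (n - 1) (l - 1) at minimal energy
          contains at least 2 (l - 1), which reaches l.\<close>
        have "int l \<le> 2 * (int l - 1)" using l3 by simp
        also have "\<dots> \<le> (int n - 1) * (int l - 1)" using n3 l_pos by (intro mult_right_mono) auto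
        also have "\<dots> \<le> h + (int n - 1) * (int l - 1)" using k(3) by simp
        also have "\<dots> = s - int l * E0"
          using E0_high[OF k(5,3,4)] k(1,2) by (subst k(5)) (simp add: mult.commute)
        finally show ?thesis .
      qed
    qed
    show "(int l - 1) + 1 \<le> s \<and> s \<le> int n * (int l - 1) \<longrightarrow>
         (\<exists>j h. 1 \<le> j \<and> j < n \<and> 1 \<le> h \<and> h \<le> int l - 1 \<and>
           s = int j * (int l - 1) + h \<and>
           mabs n (eta_mid l j h) = s \<and>
           Soc q n (Aq q n m s) = Vmod q n (eta_mid l j h) \<and>
           uq_simple q n (Soc q n (Aq q n m s)) \<and>
           highest_weight_vector q n (Vmod q n (eta_mid l j h)) (xpow n (eta_mid l j h)))"
    proof
      assume "(int l - 1) + 1 \<le> s \<and> s \<le> int n * (int l - 1)"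
      then obtain j h where jh: "1 \<le> j" "j < n" "1 \<le> h" "h \<le> int l - 1" "s = int j * (int l - 1) + h"
        using low by blast
      have h0: "0 \<le> h" using jh(3) by simp
      show "\<exists>j h. 1 \<le> j \<and> j < n \<and> 1 \<le> h \<and> h \<le> int l - 1 \<and>
           s = int j * (int l - 1) + h \<and>
           mabs n (eta_mid l j h) = s \<and>
           Soc q n (Aq q n m s) = Vmod q n (eta_mid l j h) \<and>
           uq_simple q n (Soc q n (Aq q n m s)) \<and>
           highest_weight_vector q n (Vmod q n (eta_mid l j h)) (xpow n (eta_mid l j h))"
        unfolding Aq Soc_eq
        by (intro exI[of _ j] exI[of _ h] conjI jh mid_case[OF jh(5,2) h0 jh(4)]
            Zplus_truncD(2)[OF eta_mid_T(1)[OF jh(5,2) h0 jh(4)]])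
    qed
    show "int n * (int l - 1) + 1 \<le> s \<and> s \<le> N - int l \<longrightarrow>
         (\<exists>kap h. 1 \<le> kap \<and> kap \<le> int n * (m - 1) - 1 \<and> 0 \<le> h \<and> h \<le> int l - 1 \<and>
           s = kap * int l + h + (int n - 1) * (int l - 1) \<and>
           is_direct_sum (Soc q n (Aq q n m s)) (wp n l m kap h) (Vmod q n) \<and>
           \<not> uq_simple q n (Soc q n (Aq q n m s)) \<and>
           (\<forall>\<eta>\<in>wp n l m kap h. highest_weight_vector q n (Vmod q n \<eta>) (xpow n \<eta>)))"
    proof
      assume "int n * (int l - 1) + 1 \<le> s \<and> s \<le> N - int l"
      then obtain kap h where k: "1 \<le> kap" "kap \<le> int n * (m - 1) - 1" "0 \<le> h" "h \<le> int l - 1"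
         "s = kap * int l + h + (int n - 1) * (int l - 1)" using high by blast
      note facts = k(5,3,4,1,2)
      show "\<exists>kap h. 1 \<le> kap \<and> kap \<le> int n * (m - 1) - 1 \<and> 0 \<le> h \<and> h \<le> int l - 1 \<and>
           s = kap * int l + h + (int n - 1) * (int l - 1) \<and>
           is_direct_sum (Soc q n (Aq q n m s)) (wp n l m kap h) (Vmod q n) \<and>
           \<not> uq_simple q n (Soc q n (Aq q n m s)) \<and>
           (\<forall>\<eta>\<in>wp n l m kap h. highest_weight_vector q n (Vmod q n \<eta>) (xpow n \<eta>))"
        unfolding Aq Soc_eq
        by (intro exI[of _ kap] exI[of _ h] conjI ballI k Soc_direct_sum[OF facts] Soc_not_simple[OF facts]
            wp_highest_weight[OF facts])
    qed
  qed
  show ?thesis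
    using 1 2 3 4 5 6 by (intro conjI impI; (elim conjE)?; assumption?) blast+
qed

end
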